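(* Let $t\ge2$ be a fixed integer and let $\hat m^{ens}_{k_n,boost}$ be the truncated ensemble of $B\ge 1$ ODT-based boosting trees (each with $k_n$ random ODTs of $t$ leaves, truncation level $\beta_n$), as defined in the context. Assume $\mathbf E(e^{cY^2})<\infty$ for some $c>0$ and that $m(X)$ is $L^2$ integrable. If $\beta_n\asymp\ln n$, $k_n\to\infty$ and $k_n=o\left(\frac n{\ln^4n}\right)$, then $$\mathbf E\left(\int|\hat m^{ens}_{k_n,boost}(x)-m(x)|^2\,d\mu(x)\right)\to0\quad\text{as }n\to\infty .$$
   Context: **Setting.** $p\ge1$ is fixed, $X$ is a random vector in $[0,1]^p$ with distribution $\mu$, $Y$ is a real random variable, $m(x)=\mathbf E(Y\mid X=x)$, and $\mathcal D_n=\{(X_i,Y_i)\}_{i=1}^n$ are i.i.d. copies of $(X,Y)$. "$m(X)$ is $L^2$ integrable" means $\mathbf E(m(X)^2)<\infty$. $\Theta^q=\{\theta\in\mathbb R^q:\|\theta\|_2=1\}$. For $\mathcal S\subseteq\{1,\dots,p\}$, $x_{\mathcal S}$ is the subvector of $x$ with coordinates in $\mathcal S$. **Random ODT with $t$ leaves on data $\{(X_i,R_i)\}_{i=1}^n$.** For $A\subseteq[0,1]^p$, $N(A)=\#\{i:X_i\in A\}$ and $\bar R_A$ is the mean of $R_i$ over $X_i\in A$ ($0$ if there are none). Let $\mathcal S_1,\dots,\mathcal S_{t-1}$ be i.i.d. random nonempty subsets of $\{1,\dots,p\}$, independent of the data, with $\mathbf P(\mathcal S)=\frac1p\binom p{\mathrm{Card}(\mathcal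 S)}^{-1}$. For a nonempty $\mathcal S$ of size $q$, $\theta\in\Theta^q$, $s\in\mathbb R$, let $A^+=\{x\in A:\theta^Tx_{\mathcal S}\le s\}$, $A^-=\{x\in A:\theta^Tx_{\mathcal S}>s\}$ and $$\Delta_{A,q}(\theta,s)=\frac1{N(A)}\Big[\sum_{X_i\in A}(R_i-\bar R_A)^2-\sum_{X_i\in A^+}(R_i-\bar R_{A^+})^2-\sum_{X_i\in A^-}(R_i-\bar R_{A^-})^2\Big].$$ Starting from layer $0$ consisting of the node $[0,1]^p$, nodes of the current layer are processed one after another: a node with at most one data point is passed unchanged to the next layer; a node $A$ with at least two data points is split, and if this is the $\tau$-th split it is split into $A^+,A^-$ using $\mathcal S=\mathcal S_\tau$ and a maximizer of $\Delta_{A,q}$ over $\Theta^q\times\mathbb R$, $q=\mathrm{Card}(\mathcal S_\tau)$; daughters go to the next layer. One stops as soon as there are $t$ leaves. The tree estimator at $x$ equals $\bar R_A$ with $A$ the leaf containing $x$. **Boosting tree with $k$ random ODTs.** Put $\mathcal D_n^1=\mathcal D_n$. For $j=1,\dots,k$: let $m_{n,t,\mathcal L_j}$ be the random ODT estimator with $t$ leaves built on $\mathcal D_n^j$ (with fresh independent random seeds for every tree); let $$m_{j,boost}(x)=\sum_{\ell=1}^ja^*_{j,\ell}m_{n,t,\mathcal L_\ell}(x),\qquad (a^*_{j,1},\dots,a^*_{j,j})\in\arg\min_{a_{j,1},\dots,a_{j,j}\in\mathbb R}\sum_{i=1}^n\Big(Y_i-\sum_{\ell=1}^ja_{j,\ell}m_{n,t,\mathcal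 L_\ell}(X_i)\Big)^2;$$ and put $\mathcal D_n^{j+1}=\{(X_i,Y_i-m_{j,boost}(X_i))\}_{i=1}^n$. The output is $m_{k,boost}$. **Ensemble.** Running this $B$ times with independent seeds on the same data gives $m^1_{k_n,boost},\dots,m^B_{k_n,boost}$, and $$\hat m^{ens}_{k_n,boost}(x)=\frac1B\sum_{b=1}^B\max\{\min\{m^b_{k_n,boost}(x),\beta_n\},-\beta_n\}.$$ $a_n\asymp b_n$ means that $a_n/b_n$ is bounded above and below by positive constants. The expectation is over the data and all random seeds. *)

theory Defs
  imports
    "HOL-Probability.Probability"
    "HOL-Library.Landau_Symbols"
    "HOL-Library.While_Combinator"
begin

section \<open>Samples, nodes and the splitting criterion\<close>

text \<open>
  A sample of size \<open>n\<close> is a function on \<open>{..<n}\<close> whose value at \<open>i\<close> is the pair of covariate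
  and response (or residual) of the \<open>i\<close>-th observation; indices start at 0.
  The covariate dimension is \<open>CARD('p)\<close> and feature sets are nonempty sets of type \<open>'p set\<close>.
\<close>

type_synonym 'p sample = "nat \<Rightarrow> (real ^ 'p) \<times> real"

definition unit_cube :: "(real ^ 'p::finite) set" where
  "unit_cube = {x. \<forall>i. 0 \<le> x $ i \<and> x $ i \<le> 1}"

definition node_count :: "nat \<Rightarrow> 'p::finite sample \<Rightarrow> (real ^ 'p) set \<Rightarrow> nat" where
  "node_count n D A = card {i. i < n \<and> fst (D i) \<in> A}"

text \<open>The mean over a node without data is \<open>0 / 0 = 0\<close>.\<close>

definition node_mean :: "nat \<Rightarrow> 'p::finite sample \<Rightarrow> (real ^ 'p) set \<Rightarrow> real" where
  "node_mean n D A = (\<Sum>i | i < n \<and> fst (D i) \<in> A. snd (D i)) / real (node_count n D A)"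

definition node_sse :: "nat \<Rightarrow> 'p::finite sample \<Rightarrow> (real ^ 'p) set \<Rightarrow> real" where
  "node_sse n D A = (\<Sum>i | i < n \<and> fst (D i) \<in> A. (snd (D i) - node_mean n D A)\<^sup>2)"

text \<open>
  For a feature set \<open>S\<close> of size \<open>q\<close>, the sphere of \<open>\<real>\<^sup>q\<close> is identified with the unit vectors
  of \<open>real ^ 'p\<close> that vanish outside \<open>S\<close>.
\<close>

definition directions :: "'p::finite set \<Rightarrow> (real ^ 'p) set" where
  "directions S = {\<theta>. norm \<theta> = 1 \<and> (\<forall>i. i \<notin> S \<longrightarrow> \<theta> $ i = 0)}"

definition left_child ::
    "(real ^ 'p::finite) set \<Rightarrow> 'p set \<Rightarrow> (real ^ 'p) \<times> real \<Rightarrow> (real ^ 'p) set" where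
  "left_child A S \<xi> = {x \<in> A. (\<Sum>i\<in>S. fst \<xi> $ i * x $ i) \<le> snd \<xi>}"

definition right_child ::
    "(real ^ 'p::finite) set \<Rightarrow> 'p set \<Rightarrow> (real ^ 'p) \<times> real \<Rightarrow> (real ^ 'p) set" where
  "right_child A S \<xi> = {x \<in> A. (\<Sum>i\<in>S. fst \<xi> $ i * x $ i) > snd \<xi>}"

definition split_gain ::
    "nat \<Rightarrow> 'p::finite sample \<Rightarrow> (real ^ 'p) set \<Rightarrow> 'p set \<Rightarrow> (real ^ 'p) \<times> real \<Rightarrow> real" where
  "split_gain n D A S \<xi> =
     (node_sse n D A - node_sse n D (left_child A S \<xi>) - node_sse n D (right_child A S \<xi>))
       / real (node_count n D A)"

text \<open>
  Maximizers of the gain are not unique. A split rule is a deterministic way of choosing one from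
  the sample, the node and the feature set; in particular the choice cannot look at later seeds.
\<close>

type_synonym 'p split_rule = "nat \<Rightarrow> 'p sample \<Rightarrow> (real ^ 'p) set \<Rightarrow> 'p set \<Rightarrow> (real ^ 'p) \<times> real"

definition maximizing_split_rule :: "'p::finite split_rule \<Rightarrow> bool" where
  "maximizing_split_rule spl \<longleftrightarrow>
     (\<forall>n D A S. A \<subseteq> unit_cube \<longrightarrow> S \<noteq> {} \<longrightarrow> 2 \<le> node_count n D A \<longrightarrow>
        is_arg_max (split_gain n D A S) (\<lambda>\<xi>. fst \<xi> \<in> directions S) (spl n D A S))"

section \<open>The random oblique decision tree\<close>

text \<open>
  A state \<open>(\<tau>, current, later)\<close> consists of the number \<open>\<tau>\<close> of the next split, the nodes of the current
  layer that are still to be processed, and the nodes collected so far for the next layer.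
  Each layer is processed in list order.
\<close>

type_synonym 'p odt_state = "nat \<times> (real ^ 'p) set list \<times> (real ^ 'p) set list"

fun odt_step ::
    "'p::finite split_rule \<Rightarrow> nat \<Rightarrow> 'p sample \<Rightarrow> (nat \<Rightarrow> 'p set) \<Rightarrow> 'p odt_state \<Rightarrow> 'p odt_state" where
  "odt_step spl n D \<sigma> (\<tau>, [], later) = (\<tau>, later, [])"
| "odt_step spl n D \<sigma> (\<tau>, A # current, later) =
     (if node_count n D A \<le> 1 then (\<tau>, current, later @ [A])
      else let \<xi> = spl n D A (\<sigma> \<tau>)
           in (Suc \<tau>, current, later @ [left_child A (\<sigma> \<tau>) \<xi>, right_child A (\<sigma> \<tau>) \<xi>]))"

text \<open>
  The second conjunct makes the loop terminate for small samples, where no node may be splittable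
  before \<open>t\<close> leaves are reached; it holds automatically as long as there are fewer than \<open>t\<close> leaves
  if \<open>t \<le> n\<close> and all covariates lie in the unit cube.
\<close>

definition odt_continue :: "nat \<Rightarrow> 'p::finite sample \<Rightarrow> nat \<Rightarrow> 'p odt_state \<Rightarrow> bool" where
  "odt_continue n D t = (\<lambda>(\<tau>, current, later).
     length current + length later < t \<and> (\<exists>A \<in> set current \<union> set later. 2 \<le> node_count n D A))"

definition odt_leaves ::
    "'p::finite split_rule \<Rightarrow> nat \<Rightarrow> nat \<Rightarrow> 'p sample \<Rightarrow> (nat \<Rightarrow> 'p set) \<Rightarrow> (real ^ 'p) set list" where
  "odt_leaves spl t n D \<sigma> =
     (case while (odt_continue n D t) (odt_step spl n D \<sigma>) (1, [unit_cube], []) of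
        (\<tau>, current, later) \<Rightarrow> current @ later)"

text \<open>The leaves partition the unit cube; off the cube the estimator is set to 0.\<close>

definition odt_est ::
    "'p::finite split_rule \<Rightarrow> nat \<Rightarrow> nat \<Rightarrow> 'p sample \<Rightarrow> (nat \<Rightarrow> 'p set) \<Rightarrow> real ^ 'p \<Rightarrow> real" where
  "odt_est spl t n D \<sigma> x =
     (case find (\<lambda>A. x \<in> A) (odt_leaves spl t n D \<sigma>) of
        None \<Rightarrow> 0 | Some A \<Rightarrow> node_mean n D A)"

section \<open>Boosting\<close>

text \<open>
  Least-squares coefficients need not be unique either, so they are chosen by a rule that may
  depend on the sample and on the trees grown so far.
\<close>

type_synonym 'p ls_rule = "nat \<Rightarrow> 'p sample \<Rightarrow> (real ^ 'p \<Rightarrow> real) list \<Rightarrow> nat \<Rightarrow> real"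

definition lin_comb :: "(real ^ 'p::finite \<Rightarrow> real) list \<Rightarrow> (nat \<Rightarrow> real) \<Rightarrow> real ^ 'p \<Rightarrow> real" where
  "lin_comb fs a x = (\<Sum>l < length fs. a l * (fs ! l) x)"

definition least_squares_rule :: "'p::finite ls_rule \<Rightarrow> bool" where
  "least_squares_rule ls \<longleftrightarrow>
     (\<forall>n D fs. is_arg_min (\<lambda>a. \<Sum>i<n. (snd (D i) - lin_comb fs a (fst (D i)))\<^sup>2)
                 (\<lambda>_. True) (ls n D fs))"

definition residual_sample ::
    "'p::finite ls_rule \<Rightarrow> nat \<Rightarrow> 'p sample \<Rightarrow> (real ^ 'p \<Rightarrow> real) list \<Rightarrow> 'p sample" where
  "residual_sample ls n D fs =
     (\<lambda>i\<in>{..<n}. (fst (D i), snd (D i) - lin_comb fs (ls n D fs) (fst (D i))))"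

text \<open>
  The seed \<open>\<sigma> j \<tau>\<close> is the feature set of the \<open>\<tau>\<close>-th split of the \<open>j\<close>-th tree, both counted from 1.
  For the first tree the list of previous trees is empty and the residuals are the responses.
\<close>

primrec boost_trees ::
    "'p::finite split_rule \<Rightarrow> 'p ls_rule \<Rightarrow> nat \<Rightarrow> nat \<Rightarrow> 'p sample \<Rightarrow> (nat \<Rightarrow> nat \<Rightarrow> 'p set)
      \<Rightarrow> nat \<Rightarrow> (real ^ 'p \<Rightarrow> real) list" where
  "boost_trees spl ls t n D \<sigma> 0 = []"
| "boost_trees spl ls t n D \<sigma> (Suc j) =
     boost_trees spl ls t n D \<sigma> j @
       [odt_est spl t n (residual_sample ls n D (boost_trees spl ls t n D \<sigma> j)) (\<sigma> (Suc j))]"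

definition boost_est ::
    "'p::finite split_rule \<Rightarrow> 'p ls_rule \<Rightarrow> nat \<Rightarrow> nat \<Rightarrow> nat \<Rightarrow> 'p sample \<Rightarrow> (nat \<Rightarrow> nat \<Rightarrow> 'p set)
      \<Rightarrow> real ^ 'p \<Rightarrow> real" where
  "boost_est spl ls t k n D \<sigma> =
     (let fs = boost_trees spl ls t n D \<sigma> k in lin_comb fs (ls n D fs))"

definition ens_est ::
    "'p::finite split_rule \<Rightarrow> 'p ls_rule \<Rightarrow> nat \<Rightarrow> nat \<Rightarrow> nat \<Rightarrow> real \<Rightarrow> nat \<Rightarrow> 'p sample
      \<Rightarrow> (nat \<times> nat \<times> nat \<Rightarrow> 'p set) \<Rightarrow> real ^ 'p \<Rightarrow> real" where
  "ens_est spl ls t B k \<beta> n D \<sigma> x =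
     (1 / real B) *
       (\<Sum>b = 1..B. max (min (boost_est spl ls t k n D (\<lambda>j \<tau>. \<sigma> (b, j, \<tau>)) x) \<beta>) (- \<beta>))"

text \<open>
  The choice rules must yield an estimator that is jointly measurable in the sample and in the
  evaluation point; otherwise its expected risk is meaningless.
\<close>

definition measurable_boost ::
    "'p::finite split_rule \<Rightarrow> 'p ls_rule \<Rightarrow> nat \<Rightarrow> nat \<Rightarrow> nat \<Rightarrow> bool" where
  "measurable_boost spl ls t k n \<longleftrightarrow>
     (\<forall>\<sigma>. (\<forall>j \<tau>. \<sigma> j \<tau> \<noteq> {}) \<longrightarrow>
        (\<lambda>(D, x). boost_est spl ls t k n D \<sigma> x)
          \<in> borel_measurable ((\<Pi>\<^sub>M i\<in>{..<n}. borel) \<Otimes>\<^sub>M borel))"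

section \<open>The probabilistic setting\<close>

text \<open>
  Independence of two random variables whose ranges have different types, which the library's
  \<open>indep_var\<close> does not cover; the right-hand side is that of \<open>indep_var_eq\<close>.
\<close>

definition indep_rvs ::
    "'w measure \<Rightarrow> 'a measure \<Rightarrow> ('w \<Rightarrow> 'a) \<Rightarrow> 'b measure \<Rightarrow> ('w \<Rightarrow> 'b) \<Rightarrow> bool" where
  "indep_rvs M N1 U N2 V \<longleftrightarrow>
     U \<in> measurable M N1 \<and> V \<in> measurable M N2 \<and>
     prob_space.indep_set M
       (sigma_sets (space M) {U -` A \<inter> space M | A. A \<in> sets N1})
       (sigma_sets (space M) {V -` A \<inter> space M | A. A \<in> sets N2})"

definition seed_index :: "nat \<Rightarrow> nat \<Rightarrow> nat \<Rightarrow> (nat \<times> nat \<times> nat) set" where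
  "seed_index B k t = {1..B} \<times> {1..k} \<times> {1..t - 1}"

definition seed_prob :: "'p::finite set \<Rightarrow> real" where
  "seed_prob S = 1 / (real CARD('p) * real (CARD('p) choose card S))"

definition regression_function ::
    "'w measure \<Rightarrow> ('w \<Rightarrow> real ^ 'p::finite) \<Rightarrow> ('w \<Rightarrow> real) \<Rightarrow> (real ^ 'p \<Rightarrow> real) \<Rightarrow> bool" where
  "regression_function M X Y m \<longleftrightarrow>
     m \<in> borel_measurable borel \<and>
     (AE \<omega> in M. m (X \<omega>) = real_cond_exp M (vimage_algebra (space M) X borel) Y \<omega>)"

text \<open>
  Unlike membership in \<open>\<Theta>(b)\<close>, this also forces \<open>a\<close> and \<open>b\<close> to have the same sign eventually.
\<close>

definition same_order :: "(nat \<Rightarrow> real) \<Rightarrow> (nat \<Rightarrow> real) \<Rightarrow> bool" where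
  "same_order a b \<longleftrightarrow>
     (\<exists>c C. 0 < c \<and> 0 < C \<and> (\<forall>\<^sub>F n in sequentially. c \<le> a n / b n \<and> a n / b n \<le> C))"

end

theory Submission
  imports Defs
begin

text \<open>
  By convexity of the square, the risk of the truncated ensemble is at most the average of the
  risks of its members. The seeds are independent of the data and take finitely many values, so
  everything rests on a bound for one truncated boosting tree with fixed seeds.

  Approximation. Boosting with refitted coefficients is an orthogonal greedy algorithm. If the
  first split of a tree may use all features, the tree lowers the residual sum of squares at least
  as much as the best indicator of a half-space does. After \<open>K\<close> such trees the sum of squares
  therefore exceeds that of a fixed step function \<open>h = (\<Sum>q. c q * indicator (H q))\<close> by at most
  \<open>4 * (\<Sum>q. \<bar>c q\<bar>)\<^sup>2 * n / K\<close> (lemma \<open>boost_sse_bound\<close>). These step functions are dense in \<open>L\<^sup>2\<close>: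
  exponentials of linear forms span an algebra to which the Stone-Weierstrass theorem applies, and
  each of them is a uniform limit of step functions of one linear form
  (\<open>approximable_square_integrable\<close>). A first split sees all features with probability \<open>1 / p\<close>,
  independently of the other trees, so \<open>K\<close> may be taken arbitrarily large as the number of trees
  grows.

  Estimation. With the response truncated at a fixed level \<open>L\<close>, the loss takes values in an
  interval of length \<open>(\<beta> + L)\<^sup>2\<close>. On a sample and a ghost sample of size \<open>n\<close> the set of points
  where the loss exceeds a given level has at most \<open>(4 * n + 3) ^ (C * k)\<close> forms
  (\<open>card_loss_patterns_le\<close>): a leaf is the intersection of the cube with fewer than \<open>t\<close>
  half-spaces, and once the leaves are known the estimator is linear in at most \<open>k * t\<close>
  coefficients. Randomly exchanging the sample with the ghost sample then gives expected loss
  \<open>\<le> (1 + \<epsilon>) *\<close> expected empirical loss \<open>+ O(\<beta>\<^sup>2 * k * ln n / n)\<close>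
  (\<open>expected_risk_le_empirical_risk\<close>). The factor \<open>1 + \<epsilon>\<close> matters: with factor 1 the comparison
  has an error of order \<open>\<beta>\<^sup>2 * sqrt (k * ln n / n)\<close>, which for \<open>\<beta>\<close> of order \<open>ln n\<close> need not vanish
  when \<open>k = o(n / ln n ^ 4)\<close>, while the error above is of order \<open>k * ln n ^ 3 / n\<close>. The factor is
  harmless because it multiplies a risk that stays bounded, and \<open>\<epsilon>\<close> tends to 0 last. The
  symmetrization is carried out for the estimator itself and not for a supremum over a class of
  functions, so the joint measurability of the estimator suffices.

  Adding up, the limit superior of the expected risk is at most the squared \<open>L\<^sup>2\<close> distance of \<open>h\<close>
  from \<open>m\<close>, which is arbitrarily small.
\<close>

section \<open>Sign patterns of affine families\<close>

definition shatters :: "'a set set \<Rightarrow> 'a set \<Rightarrow> bool" where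
  "shatters F S \<longleftrightarrow> (\<forall>T\<subseteq>S. \<exists>A\<in>F. A \<inter> S = T)"

text \<open>
  Pajor's form of the Sauer-Shelah lemma, by induction on the ground set. The members of \<open>F\<close>
  without \<open>x\<close> and the members with \<open>x\<close> leave two families on the smaller ground set. A set
  shattered by either family is shattered by \<open>F\<close>, and a set shattered by both yields a second one
  when \<open>x\<close> is added.
\<close>

lemma card_le_card_shattered:
  assumes "finite X" "F \<subseteq> Pow X"
  shows "card F \<le> card {S. S \<subseteq> X \<and> shatters F S}"
  using assms
proof (induction X arbitrary: F rule: finite_induct)
  case empty
  then have "F = {} \<or> F = {{}}" by auto
  moreover have "{S. S \<subseteq> {} \<and> shatters {{}} S} = {{}::'a set}"
    unfolding shatters_def by blast
  ultimately show ?case by (elim disjE) simp_all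
next
  case (insert x X)
  define F0 where "F0 = {A \<in> F. x \<notin> A}"
  define F1 where "F1 = (\<lambda>A. A - {x}) ` {A \<in> F. x \<in> A}"
  let ?sh = "\<lambda>G. {S. S \<subseteq> X \<and> shatters G S}"
  have finF: "finite F"
    using insert.hyps insert.prems finite_subset[of F "Pow (insert x X)"] by auto
  have sub: "F0 \<subseteq> Pow X" "F1 \<subseteq> Pow X"
    using insert.prems by (auto simp: F0_def F1_def)
  have inj: "inj_on (\<lambda>A. A - {x}) {A \<in> F. x \<in> A}"
    by (auto simp: inj_on_def)
  have fin: "finite (?sh G)" for G
    using insert.hyps by (auto intro: finite_subset[of _ "Pow X"])
  have "card F = card F0 + card {A \<in> F. x \<in> A}"
    unfolding F0_def using finF
    by (subst card_Un_disjoint[symmetric]) (auto intro: arg_cong[where f=card])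
  also have "card {A \<in> F. x \<in> A} = card F1"
    unfolding F1_def by (rule card_image[symmetric, OF inj])
  also have "card F0 + card F1 \<le> card (?sh F0) + card (?sh F1)"
    using insert.IH[OF sub(1)] insert.IH[OF sub(2)] by simp
  also have "\<dots> = card (?sh F0 \<union> ?sh F1) + card (?sh F0 \<inter> ?sh F1)"
    using card_Un_Int[OF fin fin] .
  also have "card (?sh F0 \<inter> ?sh F1) = card (insert x ` (?sh F0 \<inter> ?sh F1))"
    using insert.hyps by (intro card_image[symmetric]) (auto simp: inj_on_def)
  also have "card (?sh F0 \<union> ?sh F1) + \<dots> = card ((?sh F0 \<union> ?sh F1) \<union> insert x ` (?sh F0 \<inter> ?sh F1))"
    using insert.hyps fin by (intro card_Un_disjoint[symmetric]) auto
  also have "\<dots> \<le> card {S. S \<subseteq> insert x X \<and> shatters F S}"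
  proof (rule card_mono)
    show "finite {S. S \<subseteq> insert x X \<and> shatters F S}"
      using insert.hyps by (auto intro: finite_subset[of _ "Pow (insert x X)"])
    have F1_D: "\<exists>B\<in>F. x \<in> B \<and> A = B - {x}" if "A \<in> F1" for A
      using that by (auto simp: F1_def)
    have 0: "shatters F S" if "S \<subseteq> X" "shatters F0 S" for S
      using that unfolding shatters_def F0_def by blast
    have 1: "shatters F S" if "S \<subseteq> X" "shatters F1 S" for S
      unfolding shatters_def
    proof (intro allI impI)
      fix T assume "T \<subseteq> S"
      then obtain A where A: "A \<in> F1" "A \<inter> S = T"
        using \<open>shatters F1 S\<close> unfolding shatters_def by blast
      then obtain B where "B \<in> F" "A = B - {x}" using F1_D by blast
      then show "\<exists>A\<in>F. A \<inter> S = T"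
        using A \<open>S \<subseteq> X\<close> insert.hyps by (intro bexI[of _ B]) auto
    qed
    have 2: "shatters F (insert x S)" if S: "S \<subseteq> X" "shatters F0 S" "shatters F1 S" for S
      unfolding shatters_def
    proof (intro allI impI)
      fix T assume T: "T \<subseteq> insert x S"
      show "\<exists>A\<in>F. A \<inter> insert x S = T"
      proof (cases "x \<in> T")
        case True
        have "T - {x} \<subseteq> S" using T by auto
        then obtain A where A: "A \<in> F1" "A \<inter> S = T - {x}"
          using S(3) unfolding shatters_def by blast
        then obtain B where "B \<in> F" "x \<in> B" "A = B - {x}" using F1_D by blast
        then show ?thesis
          using A True \<open>S \<subseteq> X\<close> insert.hyps by (intro bexI[of _ B]) auto
      next
        case False
        then have "T \<subseteq> S" using T by auto
        then obtain A where "A \<in> F0" "A \<inter> S = T"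
          using S(2) unfolding shatters_def by blast
        then show ?thesis
          using False by (intro bexI[of _ A]) (auto simp: F0_def)
      qed
    qed
    show "(?sh F0 \<union> ?sh F1) \<union> insert x ` (?sh F0 \<inter> ?sh F1) \<subseteq> {S. S \<subseteq> insert x X \<and> shatters F S}"
      using 0 1 2 by auto
  qed
  finally show ?case .
qed

text \<open>
  Homogeneous linear systems with more unknowns than equations have nontrivial solutions. The
  induction is Gaussian elimination: the equation \<open>d\<close> is solved for the unknown at a pivot \<open>q0\<close>.
\<close>

lemma ex_nontrivial_relation:
  fixes \<phi> :: "'q \<Rightarrow> 'd \<Rightarrow> real"
  assumes "finite I" "finite S" "card I < card S"
  shows "\<exists>c. (\<exists>q\<in>S. c q \<noteq> 0) \<and> (\<forall>d\<in>I. (\<Sum>q\<in>S. c q * \<phi> q d) = 0)"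
  using assms
proof (induction I arbitrary: S \<phi> rule: finite_induct)
  case empty
  then have "S \<noteq> {}" by auto
  then show ?case by (intro exI[of _ "\<lambda>_. 1"]) auto
next
  case (insert d I)
  show ?case
  proof (cases "\<forall>q\<in>S. \<phi> q d = 0")
    case True
    have "card I < card S" using insert by simp
    from insert.IH[OF insert.prems(1) this, of \<phi>] obtain c where
      c: "\<exists>q\<in>S. c q \<noteq> 0" "\<forall>d\<in>I. (\<Sum>q\<in>S. c q * \<phi> q d) = 0" by blast
    moreover have "(\<Sum>q\<in>S. c q * \<phi> q d) = 0" using True by (intro sum.neutral) auto
    ultimately show ?thesis by auto
  next
    case False
    then obtain q0 where q0: "q0 \<in> S" "\<phi> q0 d \<noteq> 0" by blast
    define \<phi>' where "\<phi>' q e = \<phi> q e - \<phi> q d / \<phi> q0 d * \<phi> q0 e" for q e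
    have "card I < card (S - {q0})" using insert q0 by simp
    from insert.IH[OF _ this, of \<phi>'] insert.prems obtain c where
      c: "\<exists>q\<in>S - {q0}. c q \<noteq> 0" "\<forall>e\<in>I. (\<Sum>q\<in>S - {q0}. c q * \<phi>' q e) = 0" by auto
    define c' where "c' q = (if q = q0 then - (\<Sum>q\<in>S - {q0}. c q * \<phi> q d) / \<phi> q0 d else c q)" for q
    have c'_sum: "(\<Sum>q\<in>S. c' q * \<phi> q e)
        = - (\<Sum>q\<in>S - {q0}. c q * \<phi> q d) / \<phi> q0 d * \<phi> q0 e + (\<Sum>q\<in>S - {q0}. c q * \<phi> q e)" for e
      using insert.prems q0 by (subst sum.remove[of S q0]) (auto simp: c'_def intro!: sum.cong)
    have "(\<Sum>q\<in>S. c' q * \<phi> q e) = (\<Sum>q\<in>S - {q0}. c q * \<phi>' q e)" for e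
      unfolding c'_sum \<phi>'_def
      by (simp add: sum_subtractf right_diff_distrib sum_distrib_right sum_divide_distrib
          sum_negf[symmetric] mult.assoc)
    then have "\<forall>e\<in>I. (\<Sum>q\<in>S. c' q * \<phi> q e) = 0" using c by simp
    moreover have "(\<Sum>q\<in>S. c' q * \<phi> q d) = 0"
      using q0 unfolding c'_sum by simp
    moreover have "\<exists>q\<in>S. c' q \<noteq> 0" using c(1) by (auto simp: c'_def)
    ultimately show ?thesis by (intro exI[of _ c']) auto
  qed
qed

text \<open>
  The sign patterns on \<open>P\<close> of an affine family of functions. The coefficients \<open>a\<close> vary, while the
  offset \<open>\<psi>\<close> and the functions that the coefficients multiply are fixed.
\<close>

definition affine_patterns :: "'q set \<Rightarrow> 'd set \<Rightarrow> ('q \<Rightarrow> 'd \<Rightarrow> real) \<Rightarrow> ('q \<Rightarrow> real) \<Rightarrow> 'q set set" where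
  "affine_patterns P I \<phi> \<psi> = range (\<lambda>a. {q \<in> P. 0 < \<psi> q + (\<Sum>d\<in>I. a d * \<phi> q d)})"

text \<open>
  More points than parameters satisfy a nontrivial linear relation. It gives the same value to the
  corresponding combination of function values for all parameters, but a shattered set realizes a
  sign pattern that is incompatible with the sign of this value.
\<close>

lemma shattered_affine_patterns_card_le:
  assumes "finite P" "finite I" "S \<subseteq> P" "shatters (affine_patterns P I \<phi> \<psi>) S"
  shows "card S \<le> card I"
proof (rule ccontr)
  assume "\<not> card S \<le> card I"
  moreover have finS: "finite S" using assms finite_subset by blast
  ultimately obtain c0 where c0: "\<exists>q\<in>S. c0 q \<noteq> 0" "\<forall>d\<in>I. (\<Sum>q\<in>S. c0 q * \<phi> q d) = 0"
    using ex_nontrivial_relation[of I S \<phi>] assms(2) by auto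
  \<comment> \<open>After a change of sign, the combination of the constant terms is not positive, and if it
    vanishes then some coefficient is positive.\<close>
  obtain c where c: "\<forall>d\<in>I. (\<Sum>q\<in>S. c q * \<phi> q d) = 0"
    "(\<Sum>q\<in>S. c q * \<psi> q) \<le> 0" "(\<Sum>q\<in>S. c q * \<psi> q) < 0 \<or> (\<exists>q\<in>S. 0 < c q)"
  proof -
    have neg: "\<forall>d\<in>I. (\<Sum>q\<in>S. - c0 q * \<phi> q d) = 0" "(\<Sum>q\<in>S. - c0 q * \<psi> q) = - (\<Sum>q\<in>S. c0 q * \<psi> q)"
      using c0(2) by (simp_all add: sum_negf)
    consider "(\<Sum>q\<in>S. c0 q * \<psi> q) < 0" | "(\<Sum>q\<in>S. c0 q * \<psi> q) > 0" 
      | "(\<Sum>q\<in>S. c0 q * \<psi> q) = 0" "\<exists>q\<in>S. c0 q > 0" | "(\<Sum>q\<in>S. c0 q * \<psi> q) = 0" "\<exists>q\<in>S. - c0 q > 0"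
      using c0(1) by force
    then show ?thesis
    proof cases
      case 1
      show ?thesis by (rule that[of c0]) (use c0(2) 1 in simp_all)
    next
      case 2
      show ?thesis by (rule that[of "\<lambda>q. - c0 q"]) (use c0(2) 2 in \<open>simp_all add: sum_negf\<close>)
    next
      case 3
      show ?thesis by (rule that[of c0]) (use c0(2) 3 in simp_all)
    next
      case 4
      show ?thesis by (rule that[of "\<lambda>q. - c0 q"]) (use c0(2) 4 in \<open>simp_all add: sum_negf\<close>)
    qed
  qed
  let ?T = "{q \<in> S. 0 < c q}"
  obtain a where a: "{q \<in> P. 0 < \<psi> q + (\<Sum>d\<in>I. a d * \<phi> q d)} \<inter> S = ?T"
  proof -
    have "?T \<subseteq> S" by auto
    then have "\<exists>A\<in>affine_patterns P I \<phi> \<psi>. A \<inter> S = ?T"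
      using assms(4) by (simp add: shatters_def)
    then show ?thesis using that by (auto simp: affine_patterns_def)
  qed
  define v where "v q = \<psi> q + (\<Sum>d\<in>I. a d * \<phi> q d)" for q
  have v: "0 < v q \<longleftrightarrow> 0 < c q" if "q \<in> S" for q
    using that assms(3) a[unfolded set_eq_iff, rule_format, of q] by (auto simp: v_def)
  have nonneg: "0 \<le> c q * v q" if "q \<in> S" for q
    using v[OF that] by (cases "0 < c q") (auto intro: mult_nonneg_nonneg mult_nonpos_nonpos)
  have "(\<Sum>q\<in>S. c q * v q) = (\<Sum>q\<in>S. c q * \<psi> q) + (\<Sum>q\<in>S. \<Sum>d\<in>I. a d * (c q * \<phi> q d))"
    by (simp add: v_def distrib_left sum.distrib sum_distrib_left mult.left_commute)
  also have "(\<Sum>q\<in>S. \<Sum>d\<in>I. a d * (c q * \<phi> q d)) = (\<Sum>d\<in>I. a d * (\<Sum>q\<in>S. c q * \<phi> q d))"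
    by (subst sum.swap) (simp add: sum_distrib_left)
  also have "\<dots> = 0" using c(1) by simp
  finally have eq: "(\<Sum>q\<in>S. c q * v q) = (\<Sum>q\<in>S. c q * \<psi> q)" by simp
  have "0 \<le> (\<Sum>q\<in>S. c q * v q)" using nonneg by (intro sum_nonneg) auto
  moreover have "0 < (\<Sum>q\<in>S. c q * v q)" if "\<exists>q\<in>S. 0 < c q"
  proof -
    from that obtain q where "q \<in> S" "0 < c q" by blast
    then show ?thesis
      using v nonneg finS by (intro sum_pos2[of S q]) auto
  qed
  ultimately show False using eq c(2,3) by auto
qed

lemma sum_power_le_Suc_power: "(\<Sum>i\<le>D. N ^ i) \<le> (Suc N) ^ D" for N D :: nat
proof (induction D)
  case (Suc D)
  have "N ^ D \<le> Suc N ^ D" by (rule power_mono) auto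
  then have step: "N * N ^ D \<le> N * Suc N ^ D" by (rule mult_le_mono2)
  then show ?case using add_mono[OF Suc step] by (simp add: atMost_Suc)
qed simp

lemma card_lists_le:
  assumes "finite A"
  shows "finite {xs. set xs \<subseteq> A \<and> length xs \<le> r}"
    and "card {xs. set xs \<subseteq> A \<and> length xs \<le> r} \<le> Suc (card A) ^ r"
  using assms sum_power_le_Suc_power by (auto simp: card_lists_length_le finite_lists_length_le)

lemma card_small_subsets_le:
  assumes "finite P"
  shows "card {S. S \<subseteq> P \<and> card S \<le> D} \<le> Suc (card P) ^ D"
proof -
  let ?L = "{xs. set xs \<subseteq> P \<and> length xs \<le> D}"
  have "{S. S \<subseteq> P \<and> card S \<le> D} \<subseteq> set ` ?L"
  proof
    fix S assume S: "S \<in> {S. S \<subseteq> P \<and> card S \<le> D}"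
    then have "finite S" using assms finite_subset by blast
    then obtain xs where "set xs = S" "distinct xs" using finite_distinct_list by blast
    then show "S \<in> set ` ?L" using S distinct_card[of xs] by auto
  qed
  then have "card {S. S \<subseteq> P \<and> card S \<le> D} \<le> card ?L"
    using card_lists_le(1)[OF assms] by (rule surj_card_le[rotated])
  then show ?thesis using card_lists_le(2)[OF assms, of D] by linarith
qed

lemma affine_patterns_card_le:
  assumes "finite P" "finite I"
  shows "finite (affine_patterns P I \<phi> \<psi>)"
    and "card (affine_patterns P I \<phi> \<psi>) \<le> Suc (card P) ^ card I"
proof -
  let ?F = "affine_patterns P I \<phi> \<psi>"
  have sub: "?F \<subseteq> Pow P" by (auto simp: affine_patterns_def)
  then show "finite ?F" using assms finite_subset by blast
  have "card ?F \<le> card {S. S \<subseteq> P \<and> shatters ?F S}"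
    by (rule card_le_card_shattered[OF assms(1) sub])
  also have "\<dots> \<le> card {S. S \<subseteq> P \<and> card S \<le> card I}"
    using assms shattered_affine_patterns_card_le[OF assms, of _ \<phi> \<psi>]
    by (intro card_mono) (auto intro: finite_subset[of _ "Pow P"])
  also have "\<dots> \<le> Suc (card P) ^ card I" by (rule card_small_subsets_le[OF assms(1)])
  finally show "card ?F \<le> Suc (card P) ^ card I" .
qed


section \<open>Random exchanges with a ghost sample\<close>

text \<open>
  The left-hand side equals 2 at \<open>s = 0\<close> and has derivative \<open>- \<eta>\<close> there. The inequality bounds the
  exponential moment of a random exchange of two points exactly one of which lies in a given set.
\<close>

lemma ex_step_size:
  fixes \<eta> :: real
  assumes "0 < \<eta>"
  shows "\<exists>s>0. exp s + exp (- (1 + \<eta>) * s) \<le> 2"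
proof -
  let ?f = "\<lambda>s. exp s + exp (- (1 + \<eta>) * s)"
  have "(?f has_real_derivative (- \<eta>)) (at 0)"
    by (auto intro!: derivative_eq_intros)
  from DERIV_neg_dec_right[OF this] assms obtain d where
    d: "d > 0" "\<forall>h>0. h < d \<longrightarrow> ?f (0 + h) < ?f 0" by auto
  have "?f (0 + d / 2) < ?f 0" using d(1) by (intro d(2)[rule_format]) auto
  then have "?f (d / 2) \<le> 2" unfolding add_0 by simp
  then show ?thesis using \<open>d > 0\<close> by (intro exI[of _ "d / 2"]) auto
qed

text \<open>
  Of the two points with labels \<open>(j, True)\<close> and \<open>(j, False)\<close> the swap \<open>\<epsilon>\<close> assigns \<open>(j, \<epsilon> j)\<close> to
  the sample and the other one to the ghost sample.
\<close>

definition swaps :: "nat \<Rightarrow> (nat \<Rightarrow> bool) set" where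
  "swaps n = ({..<n} \<rightarrow>\<^sub>E UNIV)"

lemma card_swaps: "card (swaps n) = 2 ^ n" and finite_swaps: "finite (swaps n)"
  by (auto simp: swaps_def card_PiE intro!: finite_PiE)

text \<open>
  For one fixed set the exponential moment of \<open>s\<close> times the inner sum factorizes over the pairs,
  and every factor is at most 1 by the choice of \<open>s\<close>. Summing over all members of \<open>F\<close> bounds the
  moment for a set that depends on the swap by the cardinality of \<open>F\<close>, and the logarithm is taken
  with the help of \<open>v \<le> ln N - 1 + exp v / N\<close>, where \<open>N\<close> is this cardinality.
\<close>

lemma swap_average_sets:
  fixes A :: "(nat \<Rightarrow> bool) \<Rightarrow> (nat \<times> bool) set" and \<eta> s :: real
  assumes s: "0 < s" "exp s + exp (- (1 + \<eta>) * s) \<le> 2" and \<eta>: "0 < \<eta>"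
    and F: "finite F" "\<And>\<epsilon>. \<epsilon> \<in> swaps n \<Longrightarrow> A \<epsilon> \<in> F"
  shows "(\<Sum>\<epsilon>\<in>swaps n. \<Sum>j<n. indicator (A \<epsilon>) (j, \<not> \<epsilon> j) - (1 + \<eta>) * indicator (A \<epsilon>) (j, \<epsilon> j))
           \<le> 2 ^ n * (ln (card F) / s)"
proof -
  define v :: "(nat \<times> bool) set \<Rightarrow> nat \<Rightarrow> bool \<Rightarrow> real" where
    "v T j b = indicator T (j, \<not> b) - (1 + \<eta>) * indicator T (j, b)" for T j b
  have fac: "(\<Sum>b\<in>UNIV. exp (s * v T j b)) \<le> 2" for T j
  proof -
    have e: "exp (- (\<eta> * s)) \<le> 1" using s \<eta> by simp
    show ?thesis
      using s(2) e
      by (cases "(j, True) \<in> T"; cases "(j, False) \<in> T") (auto simp: v_def UNIV_bool algebra_simps)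
  qed
  have avg: "(\<Sum>\<epsilon>\<in>swaps n. exp (s * (\<Sum>j<n. v T j (\<epsilon> j)))) \<le> 2 ^ n" for T
  proof -
    have "(\<Sum>\<epsilon>\<in>swaps n. exp (s * (\<Sum>j<n. v T j (\<epsilon> j)))) = (\<Sum>\<epsilon>\<in>swaps n. \<Prod>j<n. exp (s * v T j (\<epsilon> j)))"
      by (simp add: sum_distrib_left exp_sum)
    also have "\<dots> = (\<Prod>j<n. \<Sum>b\<in>UNIV. exp (s * v T j b))"
      unfolding swaps_def by (rule prod_sum_PiE[symmetric]) auto
    also have "\<dots> \<le> (\<Prod>j<n. 2)"
      using fac by (intro prod_mono) (auto intro: sum_nonneg)
    finally show ?thesis by simp
  qed
  let ?N = "real (card F)"
  have "swaps n \<noteq> {}" using card_swaps[of n] by auto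
  then have "F \<noteq> {}" using F(2) by blast
  then have N: "0 < ?N" using F(1) by (simp add: card_gt_0_iff)
  have pt: "s * (\<Sum>j<n. v (A \<epsilon>) j (\<epsilon> j)) \<le> ln ?N - 1 + (\<Sum>T\<in>F. exp (s * (\<Sum>j<n. v T j (\<epsilon> j)))) / ?N"
    if "\<epsilon> \<in> swaps n" for \<epsilon>
  proof -
    let ?v = "s * (\<Sum>j<n. v (A \<epsilon>) j (\<epsilon> j))"
    have "1 + (?v - ln ?N) \<le> exp (?v - ln ?N)" by (rule exp_ge_add_one_self)
    also have "\<dots> = exp ?v / ?N" using N by (simp add: exp_diff)
    also have "exp ?v \<le> (\<Sum>T\<in>F. exp (s * (\<Sum>j<n. v T j (\<epsilon> j))))"
      using F(2)[OF that] F(1)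
      by (intro member_le_sum[where f="\<lambda>T. exp (s * (\<Sum>j<n. v T j (\<epsilon> j)))"]) auto
    finally show ?thesis using N by (simp add: divide_right_mono)
  qed
  have "(\<Sum>\<epsilon>\<in>swaps n. s * (\<Sum>j<n. v (A \<epsilon>) j (\<epsilon> j)))
      \<le> (\<Sum>\<epsilon>\<in>swaps n. ln ?N - 1 + (\<Sum>T\<in>F. exp (s * (\<Sum>j<n. v T j (\<epsilon> j)))) / ?N)"
    using pt by (intro sum_mono)
  also have "\<dots> = 2 ^ n * (ln ?N - 1) + (\<Sum>T\<in>F. \<Sum>\<epsilon>\<in>swaps n. exp (s * (\<Sum>j<n. v T j (\<epsilon> j)))) / ?N"
    by (simp add: sum.swap[of _ F "swaps n"] sum.distrib card_swaps sum_divide_distrib)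
  also have "\<dots> \<le> 2 ^ n * (ln ?N - 1) + (\<Sum>T\<in>F. 2 ^ n) / ?N"
    using N avg by (intro add_left_mono divide_right_mono sum_mono) auto
  also have "\<dots> = 2 ^ n * ln ?N" using N by (simp add: algebra_simps)
  finally have "s * (\<Sum>\<epsilon>\<in>swaps n. \<Sum>j<n. v (A \<epsilon>) j (\<epsilon> j)) \<le> 2 ^ n * ln ?N"
    by (simp add: sum_distrib_left)
  then show ?thesis using s(1) by (simp add: v_def field_simps)
qed

text \<open>
  A function with values in \<open>{0..M}\<close> is the integral over \<open>u\<close> of the indicators of its superlevel
  sets, so the bound for sets can be integrated over the levels.
\<close>

lemma swap_average_functions:
  fixes g :: "(nat \<Rightarrow> bool) \<Rightarrow> nat \<times> bool \<Rightarrow> real" and \<eta> s M S :: real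
  assumes s: "0 < s" "exp s + exp (- (1 + \<eta>) * s) \<le> 2" and \<eta>: "0 < \<eta>"
    and bnd: "\<And>\<epsilon> q. 0 \<le> g \<epsilon> q \<and> g \<epsilon> q \<le> M"
    and fam: "\<And>u. \<exists>F. finite F \<and> real (card F) \<le> S \<and>
                 (\<forall>\<epsilon>\<in>swaps n. {q \<in> {..<n} \<times> UNIV. u < g \<epsilon> q} \<in> F)"
  shows "(\<Sum>\<epsilon>\<in>swaps n. \<Sum>j<n. g \<epsilon> (j, \<not> \<epsilon> j) - (1 + \<eta>) * g \<epsilon> (j, \<epsilon> j)) \<le> 2 ^ n * (M * ln S / s)"
proof -
  let ?A = "\<lambda>u \<epsilon>. {q \<in> {..<n} \<times> UNIV. u < g \<epsilon> q}"
  let ?G = "\<lambda>u. (\<Sum>\<epsilon>\<in>swaps n. \<Sum>j<n. indicator {0..<g \<epsilon> (j, \<not> \<epsilon> j)} u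
                 - (1 + \<eta>) * indicator {0..<g \<epsilon> (j, \<epsilon> j)} u) :: real"
  have M: "0 \<le> M" using bnd[of undefined undefined] by linarith
  have int: "integrable lborel (indicator {0..<a::real} :: real \<Rightarrow> real)"
    "integral\<^sup>L lborel (indicator {0..<a}) = a" if "0 \<le> a" for a :: real
    using that by auto
  have b: "?G u \<le> 2 ^ n * (ln S / s) * indicator {0..<M} u" for u
  proof (cases "0 \<le> u \<and> u < M")
    case True
    from fam[of u] obtain F where F: "finite F" "real (card F) \<le> S" "\<forall>\<epsilon>\<in>swaps n. ?A u \<epsilon> \<in> F" by blast
    have "swaps n \<noteq> {}" using card_swaps[of n] by auto
    then have "F \<noteq> {}" using F(3) by blast
    then have N: "0 < real (card F)" using F(1) by (simp add: card_gt_0_iff)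
    have "?G u = (\<Sum>\<epsilon>\<in>swaps n. \<Sum>j<n. indicator (?A u \<epsilon>) (j, \<not> \<epsilon> j) - (1
        + \<eta>) * indicator (?A u \<epsilon>) (j, \<epsilon> j))"
      using True by (intro sum.cong refl) (auto simp: indicator_def)
    also have "\<dots> \<le> 2 ^ n * (ln (card F) / s)"
      using F by (intro swap_average_sets[OF s \<eta>]) auto
    also have "\<dots> \<le> 2 ^ n * (ln S / s)"
      using F(2) N s(1) by (intro mult_left_mono divide_right_mono) auto
    finally show ?thesis using True by simp
  next
    case False
    have "u \<notin> {0..<g \<epsilon> q}" for \<epsilon> q using False bnd[of \<epsilon> q] by auto
    then have "?G u = 0" by (intro sum.neutral ballI) auto
    then show ?thesis using False by auto
  qed
  have hG: "has_bochner_integral lborel ?G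
      (\<Sum>\<epsilon>\<in>swaps n. \<Sum>j<n. g \<epsilon> (j, \<not> \<epsilon> j) - (1 + \<eta>) * g \<epsilon> (j, \<epsilon> j))"
  proof -
    have "has_bochner_integral lborel (indicator {0..<g \<epsilon> q}) (g \<epsilon> q)" for \<epsilon> q
      using int bnd[of \<epsilon> q] by (simp add: has_bochner_integral_iff)
    then show ?thesis
      by (intro has_bochner_integral_sum has_bochner_integral_diff has_bochner_integral_mult_right)
  qed
  have "(\<Sum>\<epsilon>\<in>swaps n. \<Sum>j<n. g \<epsilon> (j, \<not> \<epsilon> j) - (1 + \<eta>) * g \<epsilon> (j, \<epsilon> j)) = integral\<^sup>L lborel ?G"
    using hG by (simp add: has_bochner_integral_iff)
  also have "\<dots> \<le> integral\<^sup>L lborel (\<lambda>u. 2 ^ n * (ln S / s) * indicator {0..<M} u)"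
    using int[OF M] b hG by (intro integral_mono) (simp_all add: has_bochner_integral_iff)
  also have "\<dots> = 2 ^ n * (ln S / s) * M" using int[OF M] by simp
  finally show ?thesis by (simp add: mult.commute)
qed

section \<open>Growth of a tree\<close>

text \<open>
  Keeping the regions obtained with fewer splits puts all leaves of a tree with \<open>t\<close> leaves into
  \<open>cells (t - 1)\<close>, whatever their depths are.
\<close>

primrec cells :: "nat \<Rightarrow> (real ^ 'p::finite) set set" where
  "cells 0 = {unit_cube}"
| "cells (Suc r) =
     cells r \<union> (\<Union>A\<in>cells r. \<Union>S. range (left_child A S) \<union> range (right_child A S))"

lemma cells_subset_Suc: "cells r \<subseteq> cells (Suc r)"
  by simp

lemma child_in_cells:
  assumes "A \<in> cells r"
  shows "left_child A S \<xi> \<in> cells (Suc r)" "right_child A S \<xi> \<in> cells (Suc r)"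
  using assms unfolding cells.simps by blast+

declare cells.simps(2) [simp del]

lemma cells_mono: "r \<le> r' \<Longrightarrow> cells r \<subseteq> cells r'"
  by (rule lift_Suc_mono_le[where f=cells]) (rule cells_subset_Suc)

lemma indicator_children:
  "indicator (left_child A S \<xi>) x + indicator (right_child A S \<xi>) x = (indicator A x :: 'b::semiring_1)"
  by (auto simp: left_child_def right_child_def indicator_def)

lemma node_sse_indicator:
  "node_sse n D A = (\<Sum>i<n. indicator A (fst (D i)) * (snd (D i) - node_mean n D A)\<^sup>2)"
  unfolding node_sse_def by (simp add: indicator_def if_distrib sum.If_cases Int_def cong: if_cong)

text \<open>
  The mean minimizes the sum of squared deviations.
\<close>

lemma node_sse_le:
  "node_sse n D A \<le> (\<Sum>i<n. indicator A (fst (D i)) * (snd (D i) - c)\<^sup>2)"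
proof -
  let ?J = "{i. i < n \<and> fst (D i) \<in> A}"
  let ?N = "real (node_count n D A)" and ?m = "node_mean n D A"
  have fin: "finite ?J" by simp
  have N: "?N = real (card ?J)" by (simp add: node_count_def)
  have s: "(\<Sum>i\<in>?J. snd (D i)) = ?N * ?m"
  proof (cases "?J = {}")
    case True
    then show ?thesis unfolding N True by simp
  next
    case False
    then have "?N \<noteq> 0" by (simp add: N card_gt_0_iff)
    then show ?thesis by (simp add: node_mean_def)
  qed
  have ex: "(snd (D i) - c)\<^sup>2 = (snd (D i) - ?m)\<^sup>2 + 2 * (?m - c) * (snd (D i) - ?m) + (?m - c)\<^sup>2" for i
    by (simp add: power2_eq_square algebra_simps)
  have "(\<Sum>i<n. indicator A (fst (D i)) * (snd (D i) - c)\<^sup>2) = (\<Sum>i\<in>?J. (snd (D i) - c)\<^sup>2)"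
    by (simp add: indicator_def if_distrib sum.If_cases Int_def cong: if_cong)
  also have "\<dots> = node_sse n D A + 2 * (?m - c) * (\<Sum>i\<in>?J. snd (D i) - ?m) + ?N * (?m - c)\<^sup>2"
    unfolding ex by (simp add: sum.distrib node_sse_def sum_distrib_left N)
  also have "(\<Sum>i\<in>?J. snd (D i) - ?m) = 0"
    using s by (simp add: sum_subtractf N)
  finally show ?thesis by simp
qed

lemma node_sse_children:
  "node_sse n D (left_child A S \<xi>) + node_sse n D (right_child A S \<xi>) \<le> node_sse n D A"
proof -
  have "node_sse n D (left_child A S \<xi>) + node_sse n D (right_child A S \<xi>)
      \<le> (\<Sum>i<n. indicator (left_child A S \<xi>) (fst (D i)) * (snd (D i) - node_mean n D A)\<^sup>2)
        + (\<Sum>i<n. indicator (right_child A S \<xi>) (fst (D i)) * (snd (D i) - node_mean n D A)\<^sup>2)"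
    by (intro add_mono node_sse_le)
  also have "\<dots> = node_sse n D A"
    by (simp only: node_sse_indicator[of n D A] sum.distrib[symmetric] distrib_right[symmetric]
        indicator_children)
  finally show ?thesis .
qed

text \<open>
  The order in which the loop descends. A split brings the number of leaves closer to \<open>t\<close>; passing
  a node on unchanged shortens the current layer; and when a layer is exhausted, the loop
  condition guarantees that a node of the next layer can be split, which lowers the second
  component.
\<close>

definition odt_order :: "nat \<Rightarrow> 'p::finite sample \<Rightarrow> nat \<Rightarrow> ('p odt_state \<times> 'p odt_state) set" where
  "odt_order n D t = measures
     [\<lambda>(\<tau>, current, later). t - (length current + length later),
      \<lambda>(\<tau>, current, later). if \<exists>A\<in>set current. 2 \<le> node_count n D A then 0 else 1,
      \<lambda>(\<tau>, current, later). length current]"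

lemma wf_odt_order: "wf (odt_order n D t)"
  by (simp add: odt_order_def)

lemma odt_step_decreases:
  assumes "odt_continue n D t s"
  shows "(odt_step spl n D \<sigma> s, s) \<in> odt_order n D t"
proof -
  obtain \<tau> current later where s: "s = (\<tau>, current, later)" by (cases s)
  show ?thesis
  proof (cases current)
    case Nil
    then show ?thesis using assms by (auto simp: s odt_order_def odt_continue_def)
  next
    case (Cons A rest)
    then show ?thesis using assms by (auto simp: s odt_order_def odt_continue_def Let_def)
  qed
qed

text \<open>
  The split counter starts at 1 and so agrees with the number of leaves. That the leaves partition
  the cube is expressed by their indicators adding up to 1, a form that one split visibly
  preserves. The parameter \<open>c\<close> bounds the total sum of squares within the leaves, which splits can
  only decrease.
\<close>

fun odt_inv :: "nat \<Rightarrow> 'p::finite sample \<Rightarrow> nat \<Rightarrow> real \<Rightarrow> 'p odt_state \<Rightarrow> bool" where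
  "odt_inv n D t c (\<tau>, current, later) \<longleftrightarrow>
     \<tau> = length (current @ later) \<and> 1 \<le> \<tau> \<and> \<tau> \<le> t \<and> set (current @ later) \<subseteq> cells (\<tau> - 1) \<and>
     (\<forall>x\<in>unit_cube. (\<Sum>A\<leftarrow>current @ later. indicator A x) = (1::nat)) \<and>
     (\<Sum>A\<leftarrow>current @ later. node_sse n D A) \<le> c"

lemma odt_inv_step:
  assumes "odt_continue n D t s" "odt_inv n D t c s"
  shows "odt_inv n D t c (odt_step spl n D \<sigma> s)"
proof -
  obtain \<tau> current later where s: "s = (\<tau>, current, later)" by (cases s)
  show ?thesis
  proof (cases current)
    case Nil
    then show ?thesis using assms by (auto simp: s)
  next
    case (Cons A rest)
    show ?thesis
    proof (cases "node_count n D A \<le> 1")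
      case True
      then show ?thesis using assms Cons by (auto simp: s algebra_simps)
    next
      case False
      define \<xi> where "\<xi> = spl n D A (\<sigma> \<tau>)"
      let ?L = "left_child A (\<sigma> \<tau>) \<xi>" and ?R = "right_child A (\<sigma> \<tau>) \<xi>"
      have step: "odt_step spl n D \<sigma> s = (Suc \<tau>, rest, later @ [?L, ?R])"
        using False Cons by (simp add: s \<xi>_def Let_def)
      have \<tau>: "\<tau> = Suc (length rest + length later)" "\<tau> < t" and A: "A \<in> cells (\<tau> - 1)"
        and sub: "set rest \<union> set later \<subseteq> cells (\<tau> - 1)"
        using assms Cons by (auto simp: s odt_continue_def)
      have "Suc (\<tau> - 1) = \<tau>" using \<tau> by simp
      then have in_cells: "?L \<in> cells \<tau>" "?R \<in> cells \<tau>" "cells (\<tau> - 1) \<subseteq> cells \<tau>"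
        using child_in_cells[OF A] cells_subset_Suc[of "\<tau> - 1"] by simp_all
      have ind: "(\<Sum>A\<leftarrow>rest @ later @ [?L, ?R]. indicator A x) = (1::nat)" if "x \<in> unit_cube" for x
      proof -
        have "(\<Sum>A\<leftarrow>(A # rest) @ later. indicator A x) = (1::nat)"
          using assms(2) that Cons unfolding s by simp
        then show ?thesis using indicator_children[of A "\<sigma> \<tau>" \<xi> x, where 'b=nat] by simp
      qed
      have sse: "(\<Sum>A\<leftarrow>rest @ later @ [?L, ?R]. node_sse n D A) \<le> c"
      proof -
        have "(\<Sum>A\<leftarrow>(A # rest) @ later. node_sse n D A) \<le> c"
          using assms(2) Cons unfolding s by simp
        then show ?thesis using node_sse_children[of n D A "\<sigma> \<tau>" \<xi>] by simp
      qed
      have "set (rest @ later @ [?L, ?R]) \<subseteq> cells \<tau>" using in_cells sub by auto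
      with \<tau> ind sse show ?thesis unfolding step odt_inv.simps by simp
    qed
  qed
qed

lemma odt_inv_while:
  assumes "odt_inv n D t c s"
  shows "odt_inv n D t c (while (odt_continue n D t) (odt_step spl n D \<sigma>) s)"
  by (rule while_rule[where P="odt_inv n D t c" and r="odt_order n D t"])
     (rule assms odt_inv_step odt_step_decreases wf_odt_order | assumption)+

lemma odt_inv_initial:
  assumes "1 \<le> t"
  shows "odt_inv n D t (node_sse n D unit_cube) (1, [unit_cube], [])"
  using assms by simp

lemma odt_leaves_partition:
  assumes "1 \<le> t"
  shows "length (odt_leaves spl t n D \<sigma>) \<le> t" "set (odt_leaves spl t n D \<sigma>) \<subseteq> cells (t - 1)"
    and "x \<in> unit_cube \<Longrightarrow> (\<Sum>A\<leftarrow>odt_leaves spl t n D \<sigma>. indicator A x) = (1::nat)"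
proof -
  obtain \<tau> current later where
    w: "while (odt_continue n D t) (odt_step spl n D \<sigma>) (1, [unit_cube], []) = (\<tau>, current, later)"
    by (metis prod_cases3)
  have inv: "odt_inv n D t (node_sse n D unit_cube) (\<tau>, current, later)"
    using odt_inv_while[OF odt_inv_initial[OF assms]] w by metis
  have l: "odt_leaves spl t n D \<sigma> = current @ later" unfolding odt_leaves_def w by simp
  show "length (odt_leaves spl t n D \<sigma>) \<le> t" using inv l by simp
  have "cells (\<tau> - 1) \<subseteq> (cells (t - 1) :: (real ^ 'a) set set)" using inv
      by (intro cells_mono diff_le_mono) auto
  then show "set (odt_leaves spl t n D \<sigma>) \<subseteq> cells (t - 1)" using inv l by auto
  show "x \<in> unit_cube \<Longrightarrow> (\<Sum>A\<leftarrow>odt_leaves spl t n D \<sigma>. indicator A x) = (1::nat)"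
    using inv unfolding l odt_inv.simps by blast
qed

text \<open>
  Maximizing the gain means minimizing the sum of squares of the two daughters. Hence the first
  pass of the loop establishes the bound, and the later passes maintain it.
\<close>

lemma odt_leaves_sse_le:
  assumes spl: "maximizing_split_rule spl" and t: "2 \<le> t" and n: "2 \<le> node_count n D unit_cube"
    and S: "\<sigma> 1 \<noteq> {}" and \<xi>: "fst \<xi> \<in> directions (\<sigma> 1)"
  shows "(\<Sum>A\<leftarrow>odt_leaves spl t n D \<sigma>. node_sse n D A)
     \<le> node_sse n D (left_child unit_cube (\<sigma> 1) \<xi>) + node_sse n D (right_child unit_cube (\<sigma> 1) \<xi>)"
proof -
  define \<xi>' where "\<xi>' = spl n D unit_cube (\<sigma> 1)"
  let ?L = "left_child unit_cube (\<sigma> 1)" and ?R = "right_child unit_cube (\<sigma> 1)"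
  let ?b = "odt_continue n D t" and ?c = "odt_step spl n D \<sigma>"
  let ?s = "(2, [], [?L \<xi>', ?R \<xi>'])"
  have b: "?b (1, [unit_cube], [])" using t n by (simp add: odt_continue_def)
  have step: "?c (1, [unit_cube], []) = ?s" using n by (simp add: \<xi>'_def Let_def)
  have w: "while ?b ?c (1, [unit_cube], []) = while ?b ?c ?s"
    using b step by (subst while_unfold) simp
  have "odt_inv n D t (node_sse n D (?L \<xi>') + node_sse n D (?R \<xi>')) ?s"
  proof -
    have "(\<Sum>A\<leftarrow>[?L \<xi>', ?R \<xi>']. indicator A x) = (1::nat)" if "x \<in> unit_cube" for x
      using that indicator_children[of unit_cube "\<sigma> 1" \<xi>' x, where 'b=nat] by simp
    moreover have "{?L \<xi>', ?R \<xi>'} \<subseteq> cells 1"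
      by (auto intro!: child_in_cells)
    ultimately show ?thesis using t by simp
  qed
  then have "odt_inv n D t (node_sse n D (?L \<xi>') + node_sse n D (?R \<xi>')) (while ?b ?c ?s)"
    by (rule odt_inv_while)
  then have "(\<Sum>A\<leftarrow>odt_leaves spl t n D \<sigma>. node_sse n D A) \<le> node_sse n D (?L \<xi>') + node_sse n D (?R \<xi>')"
    unfolding odt_leaves_def w by (cases "while ?b ?c ?s") auto
  also have "\<dots> \<le> node_sse n D (?L \<xi>) + node_sse n D (?R \<xi>)"
  proof -
    have "is_arg_max (split_gain n D unit_cube (\<sigma> 1)) (\<lambda>\<xi>. fst \<xi> \<in> directions (\<sigma> 1)) \<xi>'"
      using spl S n unfolding maximizing_split_rule_def \<xi>'_def by blast
    then have "split_gain n D unit_cube (\<sigma> 1) \<xi> \<le> split_gain n D unit_cube (\<sigma> 1) \<xi>'"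
      using \<xi> unfolding is_arg_max_linorder by blast
    then show ?thesis using n by (simp add: split_gain_def divide_le_cancel)
  qed
  finally show ?thesis .
qed

lemma find_partition:
  fixes g :: "'a set \<Rightarrow> real"
  assumes "(\<Sum>A\<leftarrow>ls. indicator A x) = (1::nat)"
  shows "\<exists>A. find (\<lambda>A. x \<in> A) ls = Some A \<and> (\<Sum>A\<leftarrow>ls. indicator A x * g A) = g A"
  using assms
proof (induction ls)
  case (Cons B ls)
  show ?case
  proof (cases "x \<in> B")
    case True
    then have "(\<Sum>A\<leftarrow>ls. indicator A x) = (0::nat)" using Cons.prems by simp
    then have "(\<Sum>A\<leftarrow>ls. indicator A x * g A) = 0"
      by (induction ls) (auto simp: indicator_def split: if_splits)
    then show ?thesis using True by simp
  next
    case False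
    then show ?thesis using Cons by simp
  qed
qed simp

lemma odt_est_sse:
  assumes t: "1 \<le> t" and cube: "\<And>i. i < n \<Longrightarrow> fst (D i) \<in> unit_cube"
  shows "(\<Sum>i<n. (snd (D i) - odt_est spl t n D \<sigma> (fst (D i)))\<^sup>2)
    = (\<Sum>A\<leftarrow>odt_leaves spl t n D \<sigma>. node_sse n D A)"
proof -
  let ?ls = "odt_leaves spl t n D \<sigma>"
  have "(\<Sum>i<n. (snd (D i) - odt_est spl t n D \<sigma> (fst (D i)))\<^sup>2)
      = (\<Sum>i<n. \<Sum>A\<leftarrow>?ls. indicator A (fst (D i)) * (snd (D i) - node_mean n D A)\<^sup>2)"
  proof (intro sum.cong refl)
    fix i assume "i \<in> {..<n}"
    then have "(\<Sum>A\<leftarrow>?ls. indicator A (fst (D i))) = (1::nat)"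
      using odt_leaves_partition(3)[OF t cube] by simp
    from find_partition[OF this, of "\<lambda>A. (snd (D i) - node_mean n D A)\<^sup>2"]
    show "(snd (D i) - odt_est spl t n D \<sigma> (fst (D i)))\<^sup>2
        = (\<Sum>A\<leftarrow>?ls. indicator A (fst (D i)) * (snd (D i) - node_mean n D A)\<^sup>2)"
      by (auto simp: odt_est_def)
  qed
  also have "\<dots> = (\<Sum>A\<leftarrow>?ls. \<Sum>i<n. indicator A (fst (D i)) * (snd (D i) - node_mean n D A)\<^sup>2)"
  proof -
    have "(\<Sum>i<n. \<Sum>A\<leftarrow>ls. f A i) = (\<Sum>A\<leftarrow>ls. \<Sum>i<n. f A i)" for ls and f :: "_ \<Rightarrow> nat \<Rightarrow> real"
      by (induction ls) (simp_all add: sum.distrib)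
    then show ?thesis .
  qed
  also have "\<dots> = (\<Sum>A\<leftarrow>?ls. node_sse n D A)"
    by (simp only: node_sse_indicator)
  finally show ?thesis .
qed

definition half_space :: "real ^ 'p::finite \<Rightarrow> real \<Rightarrow> (real ^ 'p) set" where
  "half_space \<theta> s = {x. \<theta> \<bullet> x \<le> s}"

text \<open>
  A maximizing first split is at least as good as the split along the given half-space, and this
  one is at least as good as fitting a constant on the half-space and 0 on its complement.
\<close>

lemma odt_est_gain:
  assumes spl: "maximizing_split_rule spl" and t: "2 \<le> t" and n: "2 \<le> n" and S: "\<sigma> 1 = UNIV"
    and \<theta>: "norm \<theta> = 1" and cube: "\<And>i. i < n \<Longrightarrow> fst (D i) \<in> unit_cube"
  shows "(\<Sum>i<n. (snd (D i) - odt_est spl t n D \<sigma> (fst (D i)))\<^sup>2)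
     \<le> (\<Sum>i<n. (snd (D i))\<^sup>2) - (\<Sum>i<n. snd (D i) * indicator (half_space \<theta> s) (fst (D i)))\<^sup>2 / real n"
proof -
  have cnt: "node_count n D unit_cube = n"
    using cube by (simp add: node_count_def) (metis (mono_tags, lifting) Collect_cong
        card_Collect_less_nat)
  let ?L = "left_child unit_cube UNIV (\<theta>, s)" and ?R = "right_child unit_cube UNIV (\<theta>, s)"
  let ?I = "\<lambda>i. indicator (half_space \<theta> s) (fst (D i)) :: real"
  define G where "G = (\<Sum>i<n. snd (D i) * ?I i)"
  \<comment> \<open>Dividing by \<open>n\<close> and not by the number of points in the half-space is slightly suboptimal,
    but gives the gain \<open>G\<^sup>2 / n\<close> without a case distinction.\<close>
  define c where "c = G / n"
  have L: "indicator ?L (fst (D i)) = ?I i" "indicator ?R (fst (D i)) = 1 - ?I i" if "i < n" for i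
    using cube[OF that]
    by (auto simp: left_child_def right_child_def half_space_def inner_vec_def indicator_def)
  have "(\<Sum>i<n. (snd (D i) - odt_est spl t n D \<sigma> (fst (D i)))\<^sup>2) \<le> node_sse n D ?L + node_sse n D ?R"
    using odt_leaves_sse_le[OF spl t, of n D \<sigma> "(\<theta>, s)"] t n S \<theta> odt_est_sse[OF _ cube, where t=t
        and spl=spl and \<sigma>=\<sigma>]
    by (simp add: cnt directions_def)
  also have "\<dots> \<le> (\<Sum>i<n. indicator ?L (fst (D i)) * (snd (D i) - c)\<^sup>2)
      + (\<Sum>i<n. indicator ?R (fst (D i)) * (snd (D i) - 0)\<^sup>2)"
    by (intro add_mono node_sse_le)
  also have "\<dots> = (\<Sum>i<n. (snd (D i))\<^sup>2 - 2 * c * (snd (D i) * ?I i) + c\<^sup>2 * ?I i)"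
    unfolding sum.distrib[symmetric]
    by (intro sum.cong refl) (simp add: L, simp add: power2_eq_square algebra_simps)
  also have "\<dots> = (\<Sum>i<n. (snd (D i))\<^sup>2) - 2 * c * G + c\<^sup>2 * (\<Sum>i<n. ?I i)"
    by (simp only: sum.distrib sum_subtractf sum_distrib_left[symmetric] G_def)
  also have "\<dots> \<le> (\<Sum>i<n. (snd (D i))\<^sup>2) - 2 * c * G + c\<^sup>2 * (\<Sum>i<n. 1)"
    by (intro add_left_mono mult_left_mono sum_mono) (auto simp: indicator_def)
  also have "\<dots> = (\<Sum>i<n. (snd (D i))\<^sup>2) - G\<^sup>2 / n"
    using n by (simp add: c_def power2_eq_square field_simps)
  finally show ?thesis unfolding G_def .
qed

text \<open>
  The loop splits only while the number of leaves, which equals the split counter, is below \<open>t\<close>.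
\<close>

lemma odt_leaves_cong:
  assumes "\<And>\<tau>. 1 \<le> \<tau> \<Longrightarrow> \<tau> < t \<Longrightarrow> \<sigma> \<tau> = \<sigma>' \<tau>" and "1 \<le> t"
  shows "odt_leaves spl t n D \<sigma> = odt_leaves spl t n D \<sigma>'"
proof -
  let ?b = "odt_continue n D t" and ?c = "odt_step spl n D"
  have "while ?b (?c \<sigma>) s = while ?b (?c \<sigma>') s" if "odt_inv n D t c s" for s c
    using that
  proof (induction s rule: wf_induct_rule[OF wf_odt_order[of n D t]])
    case (1 s)
    show ?case
    proof (cases "?b s")
      case True
      obtain \<tau> current later where s: "s = (\<tau>, current, later)" by (cases s)
      have "1 \<le> \<tau>" "\<tau> < t" using True 1(2) by (auto simp: s odt_continue_def)
      then have eq: "?c \<sigma> s = ?c \<sigma>' s"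
        using assms(1) by (cases current) (auto simp: s Let_def)
      have "while ?b (?c \<sigma>) s = while ?b (?c \<sigma>) (?c \<sigma> s)" using True by (subst while_unfold) simp
      also have "\<dots> = while ?b (?c \<sigma>') (?c \<sigma> s)"
        using True 1(2) by (intro 1(1) odt_step_decreases odt_inv_step)
      also have "\<dots> = while ?b (?c \<sigma>') s" using True eq by (subst (2) while_unfold) simp
      finally show ?thesis .
    next
      case False
      then show ?thesis by (simp add: while_unfold)
    qed
  qed
  from this[OF odt_inv_initial[OF assms(2)]] show ?thesis by (simp add: odt_leaves_def)
qed

section \<open>Boosting as a greedy algorithm\<close>

definition fit_sse :: "'p::finite ls_rule \<Rightarrow> nat \<Rightarrow> 'p sample \<Rightarrow> (real ^ 'p \<Rightarrow> real) list \<Rightarrow> real" where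
  "fit_sse ls n D fs = (\<Sum>i<n. (snd (D i) - lin_comb fs (ls n D fs) (fst (D i)))\<^sup>2)"

lemma fit_sse_le:
  assumes "least_squares_rule ls"
  shows "fit_sse ls n D fs \<le> (\<Sum>i<n. (snd (D i) - lin_comb fs a (fst (D i)))\<^sup>2)"
  using assms unfolding least_squares_rule_def is_arg_min_linorder fit_sse_def by blast

lemma fit_sse_le_response:
  assumes "least_squares_rule ls"
  shows "fit_sse ls n D fs \<le> (\<Sum>i<n. (snd (D i))\<^sup>2)"
  using fit_sse_le[OF assms, of n D fs "\<lambda>_. 0"] by (simp add: lin_comb_def)

lemma lin_comb_append:
  "lin_comb (fs @ [f]) (a(length fs := c)) x = lin_comb fs a x + c * f x"
  by (simp add: lin_comb_def nth_append)

lemma lin_comb_scale: "lin_comb fs (\<lambda>l. c * a l) x = c * lin_comb fs a x"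
  by (simp add: lin_comb_def sum_distrib_left mult.assoc)

text \<open>
  The residuals of a least squares fit are orthogonal to the fitted values, because rescaling the
  fitted values by \<open>1 + c\<close> cannot lower the sum of squares.
\<close>

lemma fit_sse_eq_inner_response:
  assumes ls: "least_squares_rule ls"
  shows "fit_sse ls n D fs = (\<Sum>i<n. (snd (D i) - lin_comb fs (ls n D fs) (fst (D i))) * snd (D i))"
proof -
  let ?f = "\<lambda>i. lin_comb fs (ls n D fs) (fst (D i))"
  define p where "p = (\<Sum>i<n. (snd (D i) - ?f i) * ?f i)"
  define q where "q = (\<Sum>i<n. (?f i)\<^sup>2)"
  have q: "0 \<le> q" unfolding q_def by (intro sum_nonneg) auto
  have le: "0 \<le> - 2 * c * p + c\<^sup>2 * q" for c
  proof -
    have "fit_sse ls n D fs \<le> (\<Sum>i<n. (snd (D i) - lin_comb fs (\<lambda>l. (1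
        + c) * ls n D fs l) (fst (D i)))\<^sup>2)"
      by (rule fit_sse_le[OF ls])
    also have "\<dots> = (\<Sum>i<n. (snd (D i) - ?f i)\<^sup>2 + - 2 * c * ((snd (D i) - ?f i) * ?f i)
        + c\<^sup>2 * (?f i)\<^sup>2)"
      unfolding lin_comb_scale by (intro sum.cong refl) (simp add: power2_eq_square algebra_simps)
    also have "\<dots> = fit_sse ls n D fs + - 2 * c * p + c\<^sup>2 * q"
      by (simp only: sum.distrib sum_distrib_left[symmetric] fit_sse_def p_def q_def)
    finally show ?thesis by simp
  qed
  have "p = 0"
  proof (cases "q = 0")
    case True
    then show ?thesis using le[of 1] le[of "-1"] by simp
  next
    case False
    then have "0 < q" using q by simp
    then have "- 2 * (p / q) * p + (p / q)\<^sup>2 * q = - (p\<^sup>2 / q)"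
        by (simp add: power2_eq_square field_simps)
    then have "p\<^sup>2 / q \<le> 0" using le[of "p / q"] by linarith
    then show ?thesis using \<open>0 < q\<close> by (simp add: divide_le_0_iff)
  qed
  moreover have "fit_sse ls n D fs + p = (\<Sum>i<n. (snd (D i) - ?f i) * snd (D i))"
    unfolding fit_sse_def p_def sum.distrib[symmetric]
    by (intro sum.cong refl) (simp add: power2_eq_square algebra_simps)
  ultimately show ?thesis by simp
qed

lemma length_boost_trees [simp]: "length (boost_trees spl ls t n D \<sigma> j) = j"
  by (induction j) auto

abbreviation boost_sse where
  "boost_sse spl ls t n D \<sigma> j \<equiv> fit_sse ls n D (boost_trees spl ls t n D \<sigma> j)"

text \<open>
  The old fit, with coefficient 0 for the new tree, is a competitor in the new least squares
  problem.
\<close>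

lemma boost_sse_antimono:
  assumes "least_squares_rule ls"
  shows "boost_sse spl ls t n D \<sigma> (Suc j) \<le> boost_sse spl ls t n D \<sigma> j"
proof -
  let ?fs = "boost_trees spl ls t n D \<sigma> j"
  have "boost_sse spl ls t n D \<sigma> (Suc j) \<le> (\<Sum>i<n. (snd (D i)
      - lin_comb (boost_trees spl ls t n D \<sigma> (Suc j)) ((ls n D ?fs)(length ?fs := 0)) (fst (D i)))\<^sup>2)"
    by (rule fit_sse_le[OF assms])
  also have "\<dots> = fit_sse ls n D ?fs"
    unfolding boost_trees.simps lin_comb_append by (simp add: fit_sse_def)
  finally show ?thesis .
qed

text \<open>
  The old fit plus the new tree with coefficient 1 is a competitor in the new least squares
  problem, and the new tree was grown on the residuals of the old fit.
\<close>

lemma boost_sse_gain: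
  assumes spl: "maximizing_split_rule spl" and ls: "least_squares_rule ls"
    and t: "2 \<le> t" and n: "2 \<le> n" and S: "\<sigma> (Suc j) 1 = UNIV"
    and \<theta>: "norm \<theta> = 1" and cube: "\<And>i. i < n \<Longrightarrow> fst (D i) \<in> unit_cube"
  defines "fs \<equiv> boost_trees spl ls t n D \<sigma> j"
  shows "(\<Sum>i<n. (snd (D i) - lin_comb fs (ls n D fs) (fst (D i))) * indicator (half_space \<theta> s) (fst
      (D i)))\<^sup>2
      \<le> real n * (boost_sse spl ls t n D \<sigma> j - boost_sse spl ls t n D \<sigma> (Suc j))"
    (is "?G\<^sup>2 \<le> _")
proof -
  let ?R = "residual_sample ls n D fs"
  let ?f = "odt_est spl t n ?R (\<sigma> (Suc j))"
  have R: "fst (?R i) = fst (D i)" "snd (?R i) = snd (D i) - lin_comb fs (ls n D fs) (fst (D i))" if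
      "i < n" for i
    using that by (simp_all add: residual_sample_def)
  have "boost_sse spl ls t n D \<sigma> (Suc j) \<le> (\<Sum>i<n. (snd (D i)
      - lin_comb (boost_trees spl ls t n D \<sigma> (Suc j)) ((ls n D fs)(length fs := 1)) (fst (D i)))\<^sup>2)"
    by (rule fit_sse_le[OF ls])
  also have "\<dots> = (\<Sum>i<n. (snd (?R i) - ?f (fst (?R i)))\<^sup>2)"
    unfolding boost_trees.simps fs_def[symmetric] lin_comb_append
    by (intro sum.cong refl) (simp add: R algebra_simps)
  also have "\<dots> \<le> (\<Sum>i<n. (snd (?R i))\<^sup>2)
      - (\<Sum>i<n. snd (?R i) * indicator (half_space \<theta> s) (fst (?R i)))\<^sup>2 / real n"
    using cube R by (intro odt_est_gain[where \<theta>=\<theta>] spl t n S \<theta>) auto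
  also have "(\<Sum>i<n. (snd (?R i))\<^sup>2) = boost_sse spl ls t n D \<sigma> j"
    unfolding fs_def[symmetric] fit_sse_def by (intro sum.cong refl) (simp add: R)
  also have "(\<Sum>i<n. snd (?R i) * indicator (half_space \<theta> s) (fst (?R i))) = ?G"
    by (intro sum.cong refl) (simp only: R lessThan_iff)
  finally show ?thesis using n by (simp add: field_simps)
qed

text \<open>
  As long as \<open>e\<close> is positive, \<open>1 / e\<close> grows by at least \<open>1 / C\<close> in a step with
  \<open>e\<^sup>2 \<le> C * (e - e')\<close>.
\<close>

lemma excess_recursion:
  fixes e e' C K :: real
  assumes "e' \<le> e" "0 \<le> C" "0 \<le> K" "e * K \<le> C" and step: "0 \<le> e \<Longrightarrow> e\<^sup>2 \<le> C * (e - e')"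
  shows "e' * (K + 1) \<le> C"
proof (cases "0 < e'")
  case True
  then have e: "0 < e" using assms by simp
  have "e * (e' * (K + 1)) = e' * (e * K) + e * e'" by (simp add: algebra_simps)
  also have "\<dots> \<le> e' * C + e * e"
    using True e assms by (intro add_mono mult_left_mono) auto
  also have "\<dots> \<le> e' * C + C * (e - e')"
    using step e by (simp add: power2_eq_square)
  also have "\<dots> = e * C" by (simp add: algebra_simps)
  finally show ?thesis using e by simp
next
  case False
  then have "e' * (K + 1) \<le> 0" using assms by (intro mult_nonpos_nonneg) auto
  then show ?thesis using assms by linarith
qed

definition step_fun :: "'q set \<Rightarrow> ('q \<Rightarrow> real) \<Rightarrow> ('q \<Rightarrow> real ^ 'p::finite) \<Rightarrow> ('q \<Rightarrow> real) \<Rightarrow> real ^ 'p \<Rightarrow>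
    real" where
  "step_fun Q c \<theta> s x = (\<Sum>q\<in>Q. c q * indicator (half_space (\<theta> q) (s q)) x)"

text \<open>
  The residual \<open>r\<close> satisfies \<open>\<parallel>r\<parallel>\<^sup>2 = \<langle>r, Y\<rangle> = \<langle>r, h\<rangle> + \<langle>r, Y - h\<rangle>\<close>. The first term is at most the
  sum of the \<open>\<bar>c q\<bar>\<close> times the largest inner product of \<open>r\<close> with a half-space indicator, which the
  decrease of the sum of squares controls; the second one is at most \<open>(\<parallel>r\<parallel>\<^sup>2 + \<parallel>Y - h\<parallel>\<^sup>2) / 2\<close>.
\<close>

lemma boost_sse_excess_step:
  fixes c s :: "'q \<Rightarrow> real"
  assumes spl: "maximizing_split_rule spl" and ls: "least_squares_rule ls"
    and t: "2 \<le> t" and n: "2 \<le> n" and S: "\<sigma> (Suc j) 1 = UNIV"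
    and \<theta>: "\<And>q. q \<in> Q \<Longrightarrow> norm (\<theta> q) = 1" and cube: "\<And>i. i < n \<Longrightarrow> fst (D i) \<in> unit_cube"
  defines "V \<equiv> (\<Sum>q\<in>Q. \<bar>c q\<bar>)"
    and "Rh \<equiv> (\<Sum>i<n. (snd (D i) - step_fun Q c \<theta> s (fst (D i)))\<^sup>2)"
    and "E \<equiv> boost_sse spl ls t n D \<sigma>"
  assumes pos: "0 \<le> E j - Rh"
  shows "(E j - Rh)\<^sup>2 \<le> 4 * V\<^sup>2 * real n * ((E j - Rh) - (E (Suc j) - Rh))"
proof -
  define fs where "fs = boost_trees spl ls t n D \<sigma> j"
  define r where "r i = snd (D i) - lin_comb fs (ls n D fs) (fst (D i))" for i
  define I where "I q i = (indicator (half_space (\<theta> q) (s q)) (fst (D i)) :: real)" for q i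
  define h where "h i = step_fun Q c \<theta> s (fst (D i))" for i
  define d where "d = E j - E (Suc j)"
  have d: "0 \<le> d" using boost_sse_antimono[OF ls, of n D spl t \<sigma> j] by (simp add: d_def E_def)
  have Ej: "E j = (\<Sum>i<n. (r i)\<^sup>2)" "E j = (\<Sum>i<n. r i * snd (D i))"
    unfolding E_def r_def fs_def by (simp add: fit_sse_def, rule fit_sse_eq_inner_response[OF ls])
  have G: "\<bar>\<Sum>i<n. r i * I q i\<bar> \<le> sqrt (n * d)" if "q \<in> Q" for q
  proof -
    have "(\<Sum>i<n. r i * I q i)\<^sup>2 \<le> n * d"
      using boost_sse_gain[OF spl ls t n, where \<theta>="\<theta> q" and s="s q" and \<sigma>=\<sigma> and j=j
          and D=D, OF S \<theta>[OF that] cube]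
      unfolding r_def I_def fs_def d_def E_def by simp
    then show ?thesis by (rule real_le_rsqrt[of "\<bar>_\<bar>", simplified])
  qed
  have "(\<Sum>i<n. r i * h i) = (\<Sum>q\<in>Q. c q * (\<Sum>i<n. r i * I q i))"
    unfolding h_def step_fun_def I_def[symmetric] sum_distrib_left
    by (subst sum.swap) (simp add: mult_ac)
  also have "\<dots> \<le> (\<Sum>q\<in>Q. \<bar>c q\<bar> * sqrt (n * d))"
  proof (intro sum_mono)
    fix q assume q: "q \<in> Q"
    have "c q * (\<Sum>i<n. r i * I q i) \<le> \<bar>c q\<bar> * \<bar>\<Sum>i<n. r i * I q i\<bar>"
      by (metis abs_ge_self abs_mult)
    also have "\<dots> \<le> \<bar>c q\<bar> * sqrt (n * d)" by (intro mult_left_mono G[OF q]) auto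
    finally show "c q * (\<Sum>i<n. r i * I q i) \<le> \<bar>c q\<bar> * sqrt (n * d)" .
  qed
  also have "\<dots> = V * sqrt (n * d)" by (simp add: V_def sum_distrib_right)
  finally have rh: "(\<Sum>i<n. r i * h i) \<le> V * sqrt (n * d)" .
  have "E j = (\<Sum>i<n. r i * h i) + (\<Sum>i<n. r i * (snd (D i) - h i))"
    unfolding Ej(2) by (simp add: sum.distrib[symmetric] algebra_simps)
  also have "(\<Sum>i<n. r i * (snd (D i) - h i)) \<le> (\<Sum>i<n. (r i)\<^sup>2 / 2 + (snd (D i) - h i)\<^sup>2 / 2)"
  proof (intro sum_mono)
    fix i
    show "r i * (snd (D i) - h i) \<le> (r i)\<^sup>2 / 2 + (snd (D i) - h i)\<^sup>2 / 2"
      using sum_squares_bound[of "r i" "snd (D i) - h i"] by simp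
  qed
  also have "\<dots> = E j / 2 + Rh / 2"
    unfolding Ej(1) Rh_def h_def by (simp add: sum.distrib sum_divide_distrib)
  finally have "E j - Rh \<le> 2 * (V * sqrt (n * d))" using rh by simp
  then have "(E j - Rh)\<^sup>2 \<le> (2 * (V * sqrt (n * d)))\<^sup>2"
    using pos by (intro power_mono)
  also have "\<dots> = 4 * V\<^sup>2 * n * d"
    using d by (simp add: power_mult_distrib)
  finally show ?thesis by (simp add: d_def)
qed

text \<open>
  The rate \<open>1 / K\<close> of the orthogonal greedy algorithm, where \<open>K\<close> counts the trees whose first
  split sees all features. The other trees do no harm since the sum of squares never increases.
\<close>

lemma boost_sse_bound:
  fixes c s :: "'q \<Rightarrow> real"
  assumes spl: "maximizing_split_rule spl" and ls: "least_squares_rule ls"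
    and t: "2 \<le> t" and n: "2 \<le> n"
    and \<theta>: "\<And>q. q \<in> Q \<Longrightarrow> norm (\<theta> q) = 1" and cube: "\<And>i. i < n \<Longrightarrow> fst (D i) \<in> unit_cube"
  shows "(boost_sse spl ls t n D \<sigma> k - (\<Sum>i<n. (snd (D i) - step_fun Q c \<theta> s (fst (D i)))\<^sup>2))
          * real (card {j \<in> {1..k}. \<sigma> j 1 = UNIV}) \<le> 4 * (\<Sum>q\<in>Q. \<bar>c q\<bar>)\<^sup>2 * real n"
proof (induction k)
  case 0
  then show ?case by simp
next
  case (Suc k)
  let ?Rh = "\<Sum>i<n. (snd (D i) - step_fun Q c \<theta> s (fst (D i)))\<^sup>2"
  let ?E = "boost_sse spl ls t n D \<sigma>"
  let ?K = "\<lambda>k. card {j \<in> {1..k}. \<sigma> j 1 = UNIV}"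
  let ?C = "4 * (\<Sum>q\<in>Q. \<bar>c q\<bar>)\<^sup>2 * real n"
  have anti: "?E (Suc k) - ?Rh \<le> ?E k - ?Rh"
    using boost_sse_antimono[OF ls, of n D spl t \<sigma> k] by simp
  show ?case
  proof (cases "\<sigma> (Suc k) 1 = UNIV")
    case True
    then have "{j \<in> {1..Suc k}. \<sigma> j 1 = UNIV} = insert (Suc k) {j \<in> {1..k}. \<sigma> j 1 = UNIV}"
      by (auto simp: le_Suc_eq)
    then have K: "real (?K (Suc k)) = real (?K k) + 1" by simp
    show ?thesis
      unfolding K
    proof (rule excess_recursion[OF anti])
      show "(?E k - ?Rh)\<^sup>2 \<le> ?C * ((?E k - ?Rh) - (?E (Suc k) - ?Rh))" if "0 \<le> ?E k - ?Rh"
        using boost_sse_excess_step[OF spl ls t n, where \<sigma>=\<sigma> and j=k and D=D and Q=Q and c=c and s=s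
            and \<theta>=\<theta>, OF True \<theta> cube that] by blast
    qed (use Suc in auto)
  next
    case False
    then have "{j \<in> {1..Suc k}. \<sigma> j 1 = UNIV} = {j \<in> {1..k}. \<sigma> j 1 = UNIV}"
      by (auto simp: le_Suc_eq)
    moreover have "(?E (Suc k) - ?Rh) * real (?K k) \<le> (?E k - ?Rh) * real (?K k)"
      using anti by (intro mult_right_mono) auto
    ultimately show ?thesis using Suc by simp
  qed
qed

text \<open>
  For few trees whose first split sees all features the zero function replaces \<open>h\<close> as the
  competitor; this case will have small probability.
\<close>

lemma boost_sse_average_le:
  fixes c s :: "'q \<Rightarrow> real"
  assumes spl: "maximizing_split_rule spl" and ls: "least_squares_rule ls"
    and t: "2 \<le> t" and n: "2 \<le> n" and K: "1 \<le> K"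
    and \<theta>: "\<And>q. q \<in> Q \<Longrightarrow> norm (\<theta> q) = 1" and cube: "\<And>i. i < n \<Longrightarrow> fst (D i) \<in> unit_cube"
  shows "boost_sse spl ls t n D \<sigma> k / real n
    \<le> (\<Sum>i<n. (snd (D i) - step_fun Q c \<theta> s (fst (D i)))\<^sup>2) / real n + 4 * (\<Sum>q\<in>Q. \<bar>c q\<bar>)\<^sup>2 / real K
      + (if card {j \<in> {1..k}. \<sigma> j 1 = UNIV} < K then (\<Sum>i<n. (snd (D i))\<^sup>2) / real n else 0)"
    (is "?E / _ \<le> ?R / _ + 4 * ?V\<^sup>2 / _ + (if ?K' < K then ?Y / _ else 0)")
proof (cases "?K' < K")
  case True
  have "?E / n \<le> ?Y / n"
    using fit_sse_le_response[OF ls] by (rule divide_right_mono) simp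
  moreover have "0 \<le> ?R / n" by (intro divide_nonneg_nonneg sum_nonneg) auto
  moreover have "0 \<le> 4 * ?V\<^sup>2 / K" by simp
  ultimately show ?thesis using True by (simp only: if_True)
next
  case False
  have "(?E - ?R) * real ?K' \<le> 4 * ?V\<^sup>2 * n"
    using cube by (intro boost_sse_bound[OF spl ls t n \<theta>]) auto
  moreover have "(?E - ?R) * real K \<le> max 0 ((?E - ?R) * real ?K')"
  proof (cases "0 \<le> ?E - ?R")
    case True
    then have "(?E - ?R) * real K \<le> (?E - ?R) * real ?K'" using False by (intro mult_left_mono) auto
    then show ?thesis by simp
  next
    case False
    then have "(?E - ?R) * real K \<le> 0" by (intro mult_nonpos_nonneg) auto
    then show ?thesis by simp
  qed
  moreover have "0 \<le> 4 * ?V\<^sup>2 * n" by simp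
  ultimately have "(?E - ?R) * real K \<le> 4 * ?V\<^sup>2 * n" by linarith
  then have "?E - ?R \<le> 4 * ?V\<^sup>2 * n / K" using K by (simp add: field_simps)
  then have "(?E - ?R) / n \<le> 4 * ?V\<^sup>2 / K" using n by (simp add: field_simps)
  then show ?thesis using False by (simp add: diff_divide_distrib)
qed

lemma boost_trees_cong:
  assumes "\<And>j \<tau>. 1 \<le> j \<Longrightarrow> j \<le> k \<Longrightarrow> 1 \<le> \<tau> \<Longrightarrow> \<tau> < t \<Longrightarrow> \<sigma> j \<tau> = \<sigma>' j \<tau>" and "1 \<le> t"
  shows "boost_trees spl ls t n D \<sigma> k = boost_trees spl ls t n D \<sigma>' k"
  using assms(1)
proof (induction k)
  case (Suc k)
  then have "boost_trees spl ls t n D \<sigma> k = boost_trees spl ls t n D \<sigma>' k" by simp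
  moreover have "odt_leaves spl t n D' (\<sigma> (Suc k)) = odt_leaves spl t n D' (\<sigma>' (Suc k))" for D'
    using Suc.prems assms(2) by (intro odt_leaves_cong) auto
  ultimately show ?case by (simp add: odt_est_def fun_eq_iff)
qed simp

section \<open>The number of loss patterns\<close>

definition points_in :: "'q set \<Rightarrow> ('q \<Rightarrow> 'x) \<Rightarrow> 'x set \<Rightarrow> 'q set" where
  "points_in P x A = {q \<in> P. x q \<in> A}"

text \<open>
  The extra coordinate with constant value 1 turns the threshold of a half-space into a
  coefficient.
\<close>

definition coord_or_one :: "('q \<Rightarrow> real ^ 'p::finite) \<Rightarrow> 'q \<Rightarrow> 'p option \<Rightarrow> real" where
  "coord_or_one x q d = (case d of None \<Rightarrow> 1 | Some i \<Rightarrow> x q $ i)"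

lemma sum_option_UNIV: "(\<Sum>d\<in>UNIV. f d) = f None + (\<Sum>i\<in>UNIV. f (Some i))"
    for f :: "'a::finite option \<Rightarrow> real"
  by (simp add: UNIV_option_conv sum.reindex)

lemma points_in_children:
  fixes x :: "'q \<Rightarrow> real ^ 'p::finite"
  shows "\<exists>h\<in>affine_patterns P UNIV (coord_or_one x) (\<lambda>_. 0).
     points_in P x (left_child A S \<xi>) = points_in P x A - h \<and> points_in P x (right_child A S \<xi>)
         = points_in P x A \<inter> h"
proof -
  define a where "a d = (case d of None \<Rightarrow> - snd \<xi> | Some i \<Rightarrow> if i \<in> S then fst \<xi> $ i else 0)" for d
  have "0 + (\<Sum>d\<in>UNIV. a d * coord_or_one x q d) = (\<Sum>i\<in>S. fst \<xi> $ i * x q $ i) - snd \<xi>" for q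
  proof -
    have "(\<Sum>i\<in>UNIV. a (Some i) * x q $ i) = (\<Sum>i\<in>UNIV. if i \<in> S then fst \<xi> $ i * x q $ i else 0)"
      by (intro sum.cong refl) (simp add: a_def)
    then show ?thesis
      unfolding sum_option_UNIV by (simp add: a_def coord_or_one_def sum.If_cases)
  qed
  note a = this
  let ?h = "{q \<in> P. 0 < 0 + (\<Sum>d\<in>UNIV. a d * coord_or_one x q d)}"
  have "?h \<in> affine_patterns P UNIV (coord_or_one x) (\<lambda>_. 0)"
    unfolding affine_patterns_def by (rule rangeI)
  moreover have "points_in P x (left_child A S \<xi>) = points_in P x A - ?h"
    "points_in P x (right_child A S \<xi>) = points_in P x A \<inter> ?h"
    unfolding a by (auto simp: points_in_def left_child_def right_child_def)
  ultimately show ?thesis by blast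
qed

text \<open>
  One split intersects the points of a cell with those of a half-space or of its complement, and
  the half-spaces, an affine family with \<open>p + 1\<close> parameters, cut out few sets of points.
\<close>

lemma card_points_in_cells_le:
  fixes x :: "'q \<Rightarrow> real ^ 'p::finite"
  assumes "finite P"
  shows "finite (points_in P x ` cells r)"
    and "card (points_in P x ` cells r) \<le> (1 + 2 * Suc (card P) ^ (CARD('p) + 1)) ^ r"
proof -
  let ?H = "affine_patterns P UNIV (coord_or_one x) (\<lambda>_. 0)"
  have H: "finite ?H" "card ?H \<le> Suc (card P) ^ (CARD('p) + 1)"
    using affine_patterns_card_le[OF assms, of "UNIV :: 'p option set" "coord_or_one x" "\<lambda>_. 0"]
    by (simp_all add: card_UNIV_option)
  have "finite (points_in P x ` cells r) \<and>
        card (points_in P x ` cells r) \<le> (1 + 2 * Suc (card P) ^ (CARD('p) + 1)) ^ r"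
  proof (induction r)
    case 0
    then show ?case by simp
  next
    case (Suc r)
    let ?T = "points_in P x ` cells r"
    let ?L = "(\<lambda>(a, h). a - h) ` (?T \<times> ?H)" and ?R = "(\<lambda>(a, h). a \<inter> h) ` (?T \<times> ?H)"
    have sub: "points_in P x ` cells (Suc r) \<subseteq> ?T \<union> (?L \<union> ?R)"
    proof
      fix y assume "y \<in> points_in P x ` cells (Suc r)"
      then consider "y \<in> ?T" | A S \<xi> where "A \<in> cells r" "y = points_in P x (left_child A S \<xi>)"
        | A S \<xi> where "A \<in> cells r" "y = points_in P x (right_child A S \<xi>)"
        by (auto simp: cells.simps(2))
      then show "y \<in> ?T \<union> (?L \<union> ?R)"
      proof cases
        case 2
        obtain h where "h \<in> ?H" "y = points_in P x A - h" using points_in_children[of P x A S \<xi>] 2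
            by blast
        then have "y \<in> ?L" using 2 by (intro image_eqI[of _ _ "(points_in P x A, h)"]) auto
        then show ?thesis by blast
      next
        case 3
        obtain h where "h \<in> ?H" "y = points_in P x A \<inter> h" using points_in_children[of P x A S \<xi>] 3
            by blast
        then have "y \<in> ?R" using 3 by (intro image_eqI[of _ _ "(points_in P x A, h)"]) auto
        then show ?thesis by blast
      qed auto
    qed
    have fin: "finite ?T" "finite ?L" "finite ?R" using Suc H by auto
    have "card (points_in P x ` cells (Suc r)) \<le> card (?T \<union> (?L \<union> ?R))"
      using sub fin by (intro card_mono) auto
    also have "\<dots> \<le> card ?T + (card ?L + card ?R)"
      by (meson add_left_mono card_Un_le le_trans)
    also have "\<dots> \<le> card ?T + (card ?T * card ?H + card ?T * card ?H)"
      using fin H by (intro add_mono order_refl order_trans[OF card_image_le]) (auto simp: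
          card_cartesian_product)
    also have "\<dots> = (1 + 2 * card ?H) * card ?T" by (simp add: algebra_simps)
    also have "\<dots> \<le> (1 + 2 * Suc (card P) ^ (CARD('p) + 1)) * (1 + 2 * Suc (card P) ^ (CARD('p)
        + 1)) ^ r"
      using Suc H by (intro mult_mono) auto
    finally show ?case using sub fin finite_subset
        by (auto simp del: power_Suc simp: power_Suc[symmetric])
  qed
  then show "finite (points_in P x ` cells r)"
    "card (points_in P x ` cells r) \<le> (1 + 2 * Suc (card P) ^ (CARD('p) + 1)) ^ r" by auto
qed

text \<open>
  The weight that turns the value found by a search through a list of sets into a linear function
  of the values attached to the sets.
\<close>

definition first_hit :: "'x set list \<Rightarrow> 'x \<Rightarrow> nat \<Rightarrow> real" where
  "first_hit ls x j = of_bool (j < length ls \<and> x \<in> ls ! j \<and> (\<forall>i<j. x \<notin> ls ! i))"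

lemma find_eq_sum_first_hit:
  assumes "length ls \<le> t"
  shows "(case find (\<lambda>A. x \<in> A) ls of None \<Rightarrow> 0 | Some A \<Rightarrow> g A)
    = (\<Sum>j<t. g (ls ! j) * first_hit ls x j)"
proof (cases "find (\<lambda>A. x \<in> A) ls")
  case None
  then have "first_hit ls x j = 0" for j
    by (auto simp: first_hit_def find_None_iff)
  then show ?thesis using None by simp
next
  case (Some A)
  then obtain j0 where j0: "j0 < length ls" "x \<in> ls ! j0" "A = ls ! j0" "\<forall>i<j0. x \<notin> ls ! i"
    by (auto simp: find_Some_iff)
  have "first_hit ls x j = of_bool (j = j0)" for j
    using j0 by (auto simp: first_hit_def) (metis linorder_neqE_nat)+
  then show ?thesis using Some j0 assms by simp
qed

lemma first_hit_points_in:
  assumes "q \<in> P"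
  shows "first_hit (map (points_in P x) ls) q j = first_hit ls (x q) j"
  using assms unfolding first_hit_def by (auto simp: points_in_def)

lemma boost_trees_nth:
  "l < k \<Longrightarrow> \<exists>D' \<sigma>'. boost_trees spl ls t n D \<sigma> k ! l = odt_est spl t n D' \<sigma>'"
proof (induction k)
  case (Suc k)
  then show ?case
    by (cases "l = k") (simp_all add: nth_append, blast)
qed simp

definition leaf_traces :: "nat \<Rightarrow> 'q set \<Rightarrow> ('q \<Rightarrow> real ^ 'p::finite) \<Rightarrow> 'q set list set" where
  "leaf_traces t P x = {xs. set xs \<subseteq> points_in P x ` cells (t - 1) \<and> length xs \<le> t}"

text \<open>
  Once the traces of the leaves on the points are known, the values of the estimator at the points
  are linear in \<open>k * t\<close> coefficients, each being a leaf mean times a least squares coefficient.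
  The traces and these coefficients are all that remains of the dependence on the data and on the
  choices of maximizers and minimizers.
\<close>

lemma boost_est_on_points:
  fixes x :: "'q \<Rightarrow> real ^ 'p::finite"
  assumes t: "1 \<le> t"
  shows "\<exists>tr\<in>{..<k} \<rightarrow>\<^sub>E leaf_traces t P x. \<exists>b. \<forall>q\<in>P. boost_est spl ls t k n D \<sigma> (x q) =
     (\<Sum>d\<in>{..<k} \<times> {..<t}. b d * first_hit (tr (fst d)) q (snd d))"
proof -
  let ?fs = "boost_trees spl ls t n D \<sigma> k"
  define a where "a = ls n D ?fs"
  have "\<forall>l\<in>{..<k}. \<exists>p. ?fs ! l = odt_est spl t n (fst p) (snd p)"
    using boost_trees_nth[of _ k spl ls t n D \<sigma>] by fastforce
  from bchoice[OF this] obtain p where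
    p: "\<forall>l\<in>{..<k}. ?fs ! l = odt_est spl t n (fst (p l)) (snd (p l))" by blast
  define D' where "D' l = fst (p l)" for l
  define \<sigma>' where "\<sigma>' l = snd (p l)" for l
  have fs: "?fs ! l = odt_est spl t n (D' l) (\<sigma>' l)" if "l < k" for l
    using p that by (simp add: D'_def \<sigma>'_def)
  define L where "L l = odt_leaves spl t n (D' l) (\<sigma>' l)" for l
  define tr where "tr = (\<lambda>l\<in>{..<k}. map (points_in P x) (L l))"
  define b where "b d = a (fst d) * node_mean n (D' (fst d)) (L (fst d) ! snd d)" for d
  have "tr \<in> {..<k} \<rightarrow>\<^sub>E leaf_traces t P x"
    using odt_leaves_partition(1,2)[OF t] unfolding tr_def leaf_traces_def L_def
    by (auto simp: image_iff) blast
  moreover have "boost_est spl ls t k n D \<sigma> (x q) =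
     (\<Sum>d\<in>{..<k} \<times> {..<t}. b d * first_hit (tr (fst d)) q (snd d))" if "q \<in> P" for q
  proof -
    have "boost_est spl ls t k n D \<sigma> (x q) = (\<Sum>l<k. a l * odt_est spl t n (D' l) (\<sigma>' l) (x q))"
      using fs by (simp add: boost_est_def Let_def lin_comb_def a_def)
    also have "\<dots> = (\<Sum>l<k. \<Sum>j<t. b (l, j) * first_hit (tr l) q j)"
    proof (intro sum.cong refl)
      fix l assume "l \<in> {..<k}"
      have "odt_est spl t n (D' l) (\<sigma>' l) (x q)
          = (\<Sum>j<t. node_mean n (D' l) (L l ! j) * first_hit (L l) (x q) j)"
        unfolding odt_est_def L_def[symmetric]
        by (rule find_eq_sum_first_hit) (simp add: L_def odt_leaves_partition(1)[OF t])
      then show "a l * odt_est spl t n (D' l) (\<sigma>' l) (x q) = (\<Sum>j<t. b (l, j) * first_hit (tr l) q j)"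
        using \<open>l \<in> {..<k}\<close> first_hit_points_in[OF that, of x "L l"]
        by (simp add: b_def tr_def sum_distrib_left mult.assoc)
    qed
    also have "\<dots> = (\<Sum>d\<in>{..<k} \<times> {..<t}. b d * first_hit (tr (fst d)) q (snd d))"
      by (simp add: sum.cartesian_product case_prod_unfold)
    finally show ?thesis .
  qed
  ultimately show ?thesis by blast
qed

definition clip :: "real \<Rightarrow> real \<Rightarrow> real" where
  "clip b y = max (min y b) (- b)"

lemma sq_gt_iff: "0 \<le> u \<Longrightarrow> u < (a - w)\<^sup>2 \<longleftrightarrow> w + sqrt u < a \<or> a < w - sqrt u" for a u w :: real
proof -
  assume "0 \<le> u"
  then have "u < (a - w)\<^sup>2 \<longleftrightarrow> sqrt u < \<bar>a - w\<bar>"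
    by (metis real_sqrt_abs real_sqrt_less_iff)
  then show ?thesis by auto
qed

text \<open>
  The loss at a point exceeds \<open>u\<close> if the truncated estimator is above or below two thresholds that
  only depend on the point. The pattern is thus determined by the signs of two affine functionals
  at each point, that is, by a sign pattern on twice as many points, together with the traces of
  the leaves.
\<close>

lemma card_loss_patterns_le:
  fixes x :: "'q \<Rightarrow> real ^ 'p::finite" and w :: "'q \<Rightarrow> real"
    and spl :: "'p split_rule" and ls :: "'p ls_rule" and \<sigma> :: "nat \<Rightarrow> nat \<Rightarrow> 'p set"
    and t k n :: nat and u \<beta> :: real
  assumes P: "finite P" and t: "1 \<le> t"
  defines "F \<equiv> range (\<lambda>D. {q \<in> P. u < (clip \<beta> (boost_est spl ls t k n D \<sigma> (x q)) - w q)\<^sup>2})"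
  shows "finite F"
    and "card F \<le> (2 * card P + 3) ^ (((CARD('p) + 2) * (t - 1) + 2) * t * k)"
proof -
  let ?I = "{..<k} \<times> {..<t}"
  let ?v = "\<lambda>q. w q + sqrt u" and ?v' = "\<lambda>q. w q - sqrt u"
  define \<phi> where "\<phi> tr = (\<lambda>(q, b) d. (if b then 1 else - 1) * first_hit (tr (fst d)) q (snd d))"
    for tr :: "nat \<Rightarrow> 'q set list"
  define \<psi> where "\<psi> = (\<lambda>(q, b). if b then - ?v q else ?v' q)"
  \<comment> \<open>\<open>\<Psi>\<close> recovers the pattern from the signs. The comparisons with \<open>\<beta>\<close> decide the points at which the
    truncation of the estimator settles the answer.\<close>
  define \<Psi> where "\<Psi> A = {q \<in> P. u < 0 \<or> (?v q < - \<beta> \<or> (q, True) \<in> A \<and> ?v q < \<beta>)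
      \<or> (- \<beta> < ?v' q \<and> ((q, False) \<in> A \<or> \<beta> < ?v' q))}" for A
  let ?LT = "leaf_traces t P x" and ?TR = "{..<k} \<rightarrow>\<^sub>E leaf_traces t P x"
  let ?Q = "P \<times> (UNIV :: bool set)"
  let ?AP = "\<lambda>tr. affine_patterns ?Q ?I (\<phi> tr) \<psi>"
  have sub: "F \<subseteq> \<Psi> ` (\<Union>tr\<in>?TR. ?AP tr)"
  proof
    fix y assume "y \<in> F"
    then obtain D where y: "y = {q \<in> P. u < (clip \<beta> (boost_est spl ls t k n D \<sigma> (x q)) - w q)\<^sup>2}"
      by (auto simp: F_def)
    let ?f = "\<lambda>q. boost_est spl ls t k n D \<sigma> (x q)"
    obtain tr b where tr: "tr \<in> ?TR" and f: "\<forall>q\<in>P. ?f q =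
     (\<Sum>d\<in>?I. b d * first_hit (tr (fst d)) q (snd d))"
      using boost_est_on_points[OF t, of k P x spl ls n D \<sigma>] by auto
    define A where "A = {q \<in> ?Q. 0 < \<psi> q + (\<Sum>d\<in>?I. b d * \<phi> tr q d)}"
    have A: "(q, True) \<in> A \<longleftrightarrow> ?v q < ?f q" "(q, False) \<in> A \<longleftrightarrow> ?f q < ?v' q" if "q \<in> P" for q
      using that f by (auto simp: A_def \<psi>_def \<phi>_def sum_negf)
    have "(u < (clip \<beta> (?f q) - w q)\<^sup>2) \<longleftrightarrow> u < 0 \<or> (?v q < - \<beta> \<or> (q, True) \<in> A \<and> ?v q < \<beta>)
      \<or> (- \<beta> < ?v' q \<and> ((q, False) \<in> A \<or> \<beta> < ?v' q))" if "q \<in> P" for q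
    proof (cases "u < 0")
      case True
      then show ?thesis by (smt (verit) zero_le_power2)
    next
      case False
      then show ?thesis
        by (subst sq_gt_iff) (auto simp: A[OF that] clip_def)
    qed
    then have "y = \<Psi> A" unfolding y \<Psi>_def by blast
    moreover have "A \<in> ?AP tr" unfolding A_def affine_patterns_def by (rule rangeI)
    ultimately show "y \<in> \<Psi> ` (\<Union>tr\<in>?TR. ?AP tr)" using tr by blast
  qed
  let ?N = "card P" and ?y = "2 * card P + 3" and ?p = "CARD('p)"
  have finT: "finite (points_in P x ` cells (t - 1))"
    by (rule card_points_in_cells_le(1)[OF P])
  have LT: "finite ?LT" "card ?LT \<le> ?y ^ (((?p + 2) * (t - 1) + 1) * t)"
  proof -
    show "finite ?LT" unfolding leaf_traces_def by (rule card_lists_le(1)[OF finT])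
    have "1 + 2 * Suc ?N ^ (?p + 1) \<le> ?y ^ (?p + 2)"
    proof -
      have "Suc ?N ^ (?p + 1) \<le> ?y ^ (?p + 1)" by (rule power_mono) auto
      moreover have "1 \<le> ?y ^ (?p + 1)" by simp
      ultimately have "1 + 2 * Suc ?N ^ (?p + 1) \<le> 3 * ?y ^ (?p + 1)" by linarith
      also have "\<dots> \<le> ?y * ?y ^ (?p + 1)" by (intro mult_right_mono) auto
      finally show ?thesis by simp
    qed
    then have "(1 + 2 * Suc ?N ^ (?p + 1)) ^ (t - 1) \<le> (?y ^ (?p + 2)) ^ (t - 1)"
      by (rule power_mono) auto
    then have "card (points_in P x ` cells (t - 1)) \<le> ?y ^ ((?p + 2) * (t - 1))"
      using card_points_in_cells_le(2)[OF P, of x "t - 1"] unfolding power_mult by linarith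
    moreover have "1 \<le> ?y ^ ((?p + 2) * (t - 1))" by simp
    ultimately have "Suc (card (points_in P x ` cells (t - 1))) \<le> 2 * ?y ^ ((?p + 2) * (t - 1))"
        by linarith
    also have "\<dots> \<le> ?y * ?y ^ ((?p + 2) * (t - 1))" by (intro mult_right_mono) auto
    finally have "Suc (card (points_in P x ` cells (t - 1))) ^ t \<le> (?y ^ ((?p + 2) * (t - 1) + 1)) ^ t"
      by (intro power_mono) auto
    then show "card ?LT \<le> ?y ^ (((?p + 2) * (t - 1) + 1) * t)"
      using card_lists_le(2)[OF finT, of t] unfolding leaf_traces_def power_mult by linarith
  qed
  have AP: "finite (?AP tr)" "card (?AP tr) \<le> ?y ^ (k * t)" for tr
  proof -
    have Q: "finite ?Q" and I: "finite ?I" using P by auto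
    show "finite (?AP tr)" by (rule affine_patterns_card_le(1)[OF Q I])
    have "card (?AP tr) \<le> Suc (card ?Q) ^ card ?I" by (rule affine_patterns_card_le(2)[OF Q I])
    also have "\<dots> = Suc (2 * ?N) ^ (k * t)" by (simp add: card_cartesian_product mult.commute)
    also have "\<dots> \<le> ?y ^ (k * t)" by (intro power_mono) auto
    finally show "card (?AP tr) \<le> ?y ^ (k * t)" .
  qed
  have TR: "finite ?TR" "card ?TR = card ?LT ^ k"
    using LT by (auto simp: card_PiE intro: finite_PiE)
  have fin: "finite (\<Union>tr\<in>?TR. ?AP tr)" using TR AP by blast
  then show "finite F" using sub finite_subset by blast
  have "card F \<le> card (\<Psi> ` (\<Union>tr\<in>?TR. ?AP tr))" using sub fin by (intro card_mono) auto
  also have "\<dots> \<le> card (\<Union>tr\<in>?TR. ?AP tr)" by (rule card_image_le[OF fin])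
  also have "\<dots> \<le> (\<Sum>tr\<in>?TR. card (?AP tr))" by (rule card_UN_le[OF TR(1)])
  also have "\<dots> \<le> (\<Sum>tr\<in>?TR. ?y ^ (k * t))" using AP by (intro sum_mono)
  also have "\<dots> = card ?LT ^ k * ?y ^ (k * t)" by (simp add: TR)
  also have "\<dots> \<le> (?y ^ (((?p + 2) * (t - 1) + 1) * t)) ^ k * ?y ^ (k * t)"
    using LT by (intro mult_right_mono power_mono) auto
  also have "\<dots> = ?y ^ (((?p + 2) * (t - 1) + 2) * t * k)"
    by (simp add: power_mult[symmetric] power_add[symmetric] algebra_simps)
  finally show "card F \<le> ?y ^ (((?p + 2) * (t - 1) + 2) * t * k)" .
qed

section \<open>Density of oblique step functions\<close>

text \<open>
  These functions form an algebra because the product of two exponentials is an exponential.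
\<close>

inductive_set exp_sums :: "(real ^ 'p::finite \<Rightarrow> real) set" where
  exp: "(\<lambda>x. c * exp (a \<bullet> x)) \<in> exp_sums"
| add: "f \<in> exp_sums \<Longrightarrow> g \<in> exp_sums \<Longrightarrow> (\<lambda>x. f x + g x) \<in> exp_sums"

lemma exp_sums_mult:
  assumes "f \<in> exp_sums" "g \<in> exp_sums"
  shows "(\<lambda>x. f x * g x) \<in> exp_sums"
  using assms(1)
proof induction
  case (exp c a)
  from assms(2) show ?case
  proof induction
    case (exp c' a')
    have "(\<lambda>x. c * exp (a \<bullet> x) * (c' * exp (a' \<bullet> x))) = (\<lambda>x. (c * c') * exp ((a + a') \<bullet> x))"
      by (simp add: fun_eq_iff inner_add_left exp_add)
    then show ?case using exp_sums.exp by simp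
  next
    case (add f g)
    then show ?case by (simp add: distrib_left exp_sums.add)
  qed
next
  case (add f f')
  then show ?case by (simp add: distrib_right exp_sums.add)
qed

lemma unit_cube_cbox: "unit_cube = cbox 0 (1 :: real ^ 'p::finite)"
  by (auto simp: unit_cube_def mem_box_cart)

lemma compact_unit_cube: "compact (unit_cube :: (real ^ 'p::finite) set)"
  unfolding unit_cube_cbox by (rule compact_cbox)

lemma exp_sums_ring: "function_ring_on exp_sums (unit_cube :: (real ^ 'p::finite) set)"
proof
  show "compact (unit_cube :: (real ^ 'p) set)" by (rule compact_unit_cube)
  show "continuous_on unit_cube f" if "f \<in> exp_sums" for f :: "real ^ 'p \<Rightarrow> real"
    using that by induction (auto intro!: continuous_intros)
  show "(\<lambda>x. c) \<in> exp_sums" for c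
    using exp_sums.exp[of c 0] by simp
  show "\<exists>f\<in>exp_sums. f x \<noteq> f y" if "x \<noteq> y" for x y :: "real ^ 'p"
  proof
    have "(x - y) \<bullet> x \<noteq> (x - y) \<bullet> y"
      using that by (metis inner_eq_zero_iff inner_diff_right right_minus_eq)
    then show "1 * exp ((x - y) \<bullet> x) \<noteq> 1 * exp ((x - y) \<bullet> y)" by simp
  qed (rule exp_sums.exp)
qed (auto intro: exp_sums.add exp_sums_mult)

text \<open>
  Linear combinations are indexed by lists since appending lists adds the functions.
\<close>

definition list_step_fun :: "(real \<times> (real ^ 'p::finite) \<times> real) list \<Rightarrow> real ^ 'p \<Rightarrow> real" where
  "list_step_fun xs x = (\<Sum>(c, \<theta>, s)\<leftarrow>xs. c * indicator (half_space \<theta> s) x)"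

definition step_combs :: "(real ^ 'p::finite \<Rightarrow> real) set" where
  "step_combs = {list_step_fun xs | xs. \<forall>(c, \<theta>, s)\<in>set xs. norm \<theta> = 1}"

lemma step_combs_add:
  assumes "f \<in> step_combs" "g \<in> step_combs"
  shows "(\<lambda>x. f x + g x) \<in> step_combs"
proof -
  obtain xs ys where xs: "f = list_step_fun xs" "\<forall>(c, \<theta>, s)\<in>set xs. norm \<theta> = 1"
    "g = list_step_fun ys" "\<forall>(c, \<theta>, s)\<in>set ys. norm \<theta> = 1"
    using assms by (auto simp: step_combs_def)
  have "(\<lambda>x. f x + g x) = list_step_fun (xs @ ys)"
    by (simp add: fun_eq_iff xs list_step_fun_def)
  then show ?thesis using xs by (auto simp: step_combs_def intro!: exI[of _ "xs @ ys"])
qed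

lemma step_combs_scale:
  assumes "f \<in> step_combs"
  shows "(\<lambda>x. b * f x) \<in> step_combs"
proof -
  obtain xs where xs: "f = list_step_fun xs" "\<forall>(c, \<theta>, s)\<in>set xs. norm \<theta> = 1"
    using assms by (auto simp: step_combs_def)
  have "b * list_step_fun xs x = list_step_fun (map (\<lambda>(c, \<theta>, s). (b * c, \<theta>, s)) xs) x" for x
    by (induction xs) (auto simp: list_step_fun_def distrib_left)
  then have "(\<lambda>x. b * f x) = list_step_fun (map (\<lambda>(c, \<theta>, s). (b * c, \<theta>, s)) xs)"
    by (simp add: xs)
  then show ?thesis using xs unfolding step_combs_def
    by (intro CollectI exI[of _ "map (\<lambda>(c, \<theta>, s). (b * c, \<theta>, s)) xs"]) auto
qed

lemma step_combs_half_space: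
  assumes "norm \<theta> = 1"
  shows "indicator (half_space \<theta> s) \<in> step_combs"
  unfolding step_combs_def using assms
  by (intro CollectI exI[of _ "[(1, \<theta>, s)]"]) (auto simp: list_step_fun_def fun_eq_iff)

lemma borel_half_space [measurable]: "half_space \<theta> s \<in> sets borel"
  unfolding half_space_def by measurable

lemma step_fun_measurable [measurable]: "step_fun Q c \<theta> s \<in> borel_measurable borel"
  unfolding step_fun_def by measurable

lemma step_combs_step_fun:
  assumes "f \<in> step_combs"
  obtains N c \<theta> s where "f = step_fun {..<N::nat} c \<theta> s" "\<And>q. q < N \<Longrightarrow> norm (\<theta> q) = 1"
proof -
  obtain xs where xs: "f = list_step_fun xs" "\<forall>(c, \<theta>, s)\<in>set xs. norm \<theta> = 1"
    using assms by (auto simp: step_combs_def)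
  have "f = step_fun {..<length xs} (\<lambda>q. fst (xs ! q)) (\<lambda>q. fst (snd (xs ! q))) (\<lambda>q. snd (snd (xs !
      q)))"
    unfolding xs(1) by (simp add: fun_eq_iff list_step_fun_def step_fun_def sum_list_sum_nth
        case_prod_unfold atLeast0LessThan)
  moreover have "norm (fst (snd (xs ! q))) = 1" if "q < length xs" for q
    using xs(2) nth_mem[OF that] by (auto simp: case_prod_unfold)
  ultimately show ?thesis using that by blast
qed

lemma step_combs_measurable: "f \<in> step_combs \<Longrightarrow> f \<in> borel_measurable borel"
  by (erule step_combs_step_fun) simp

lemma sq_add_le: "(a + b)\<^sup>2 \<le> 2 * a\<^sup>2 + 2 * b\<^sup>2" for a b :: real
  using sum_squares_bound[of a b] by (simp add: power2_eq_square algebra_simps)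

locale cube_distribution = prob_space \<mu> for \<mu> :: "(real ^ 'p::finite) measure" +
  assumes sets_eq [measurable_cong, simp]: "sets \<mu> = sets borel"
    and in_cube: "AE x in \<mu>. x \<in> unit_cube"
begin

lemma space_eq [simp]: "space \<mu> = UNIV"
  using sets_eq_imp_space_eq[OF sets_eq] by simp

definition approximable :: "(real ^ 'p \<Rightarrow> real) \<Rightarrow> bool" where
  "approximable f \<longleftrightarrow> f \<in> borel_measurable borel \<and>
     (\<forall>e>0. \<exists>h\<in>step_combs. (\<integral>\<^sup>+x. ennreal ((f x - h x)\<^sup>2) \<partial>\<mu>) \<le> ennreal e)"

lemma nn_integral_sq_add_le:
  assumes [measurable]: "f \<in> borel_measurable borel" "g \<in> borel_measurable borel"
  assumes "(\<integral>\<^sup>+x. ennreal ((f x)\<^sup>2) \<partial>\<mu>) \<le> ennreal a" "(\<integral>\<^sup>+x. ennreal ((g x)\<^sup>2) \<partial>\<mu>) \<le> ennreal b"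
    and "0 \<le> a" "0 \<le> b"
  shows "(\<integral>\<^sup>+x. ennreal ((f x + g x)\<^sup>2) \<partial>\<mu>) \<le> ennreal (2 * a + 2 * b)"
proof -
  have "(\<integral>\<^sup>+x. ennreal ((f x + g x)\<^sup>2) \<partial>\<mu>) \<le> (\<integral>\<^sup>+x. 2 * ennreal ((f x)\<^sup>2) + 2 * ennreal ((g x)\<^sup>2) \<partial>\<mu>)"
  proof (intro nn_integral_mono)
    fix x
    have "ennreal ((f x + g x)\<^sup>2) \<le> ennreal (2 * (f x)\<^sup>2 + 2 * (g x)\<^sup>2)"
      by (intro ennreal_leI sq_add_le)
    then show "ennreal ((f x + g x)\<^sup>2) \<le> 2 * ennreal ((f x)\<^sup>2) + 2 * ennreal ((g x)\<^sup>2)"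
      by (simp add: ennreal_plus ennreal_mult)
  qed
  also have "\<dots> = 2 * (\<integral>\<^sup>+x. ennreal ((f x)\<^sup>2) \<partial>\<mu>) + 2 * (\<integral>\<^sup>+x. ennreal ((g x)\<^sup>2) \<partial>\<mu>)"
    by (simp add: nn_integral_add nn_integral_cmult)
  also have "\<dots> \<le> 2 * ennreal a + 2 * ennreal b"
    using assms by (intro add_mono mult_left_mono) auto
  also have "\<dots> = ennreal (2 * a + 2 * b)"
    using assms by (simp add: ennreal_plus ennreal_mult)
  finally show ?thesis .
qed

lemma approximable_measurable: "approximable f \<Longrightarrow> f \<in> borel_measurable borel"
  by (simp add: approximable_def)

lemma approximable_step_comb: "f \<in> step_combs \<Longrightarrow> approximable f"
  unfolding approximable_def by (auto intro!: bexI[of _ f] step_combs_measurable)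

text \<open>
  Approximability means membership in the \<open>L\<^sup>2\<close> closure of the step functions, so it passes to
  \<open>L\<^sup>2\<close> limits.
\<close>

lemma approximable_limit:
  assumes [measurable]: "f \<in> borel_measurable borel"
    and "\<And>e. 0 < e \<Longrightarrow> \<exists>g. approximable g \<and> (\<integral>\<^sup>+x. ennreal ((f x - g x)\<^sup>2) \<partial>\<mu>) \<le> ennreal e"
  shows "approximable f"
  unfolding approximable_def
proof (intro conjI allI impI)
  fix e :: real assume "0 < e"
  then have e: "0 < e / 4" by simp
  from assms(2)[OF e] obtain g where g: "approximable g"
    "(\<integral>\<^sup>+x. ennreal ((f x - g x)\<^sup>2) \<partial>\<mu>) \<le> ennreal (e / 4)" by blast
  from g(1) e obtain h where h: "h \<in> step_combs" "(\<integral>\<^sup>+x. ennreal ((g x - h x)\<^sup>2) \<partial>\<mu>) \<le> ennreal (e / 4)"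
    unfolding approximable_def by blast
  have [measurable]: "g \<in> borel_measurable borel" "h \<in> borel_measurable borel"
    using g(1) h(1) by (auto simp: approximable_measurable step_combs_measurable)
  have "(\<integral>\<^sup>+x. ennreal (((f x - g x) + (g x - h x))\<^sup>2) \<partial>\<mu>) \<le> ennreal (2 * (e / 4) + 2 * (e / 4))"
    using g(2) h(2) e by (intro nn_integral_sq_add_le) auto
  then show "\<exists>h\<in>step_combs. (\<integral>\<^sup>+x. ennreal ((f x - h x)\<^sup>2) \<partial>\<mu>) \<le> ennreal e"
    using h(1) by (intro bexI[of _ h]) simp_all
qed (rule assms(1))

lemma approximable_add:
  assumes f: "approximable f" and g: "approximable g"
  shows "approximable (\<lambda>x. f x + g x)"
proof (rule approximable_limit)
  have [measurable]: "f \<in> borel_measurable borel" "g \<in> borel_measurable borel"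
    using f g by (auto simp: approximable_measurable)
  show "(\<lambda>x. f x + g x) \<in> borel_measurable borel" by simp
  fix e :: real assume "0 < e"
  then have e: "0 < e / 4" by simp
  from f e obtain h where h: "h \<in> step_combs" "(\<integral>\<^sup>+x. ennreal ((f x - h x)\<^sup>2) \<partial>\<mu>) \<le> ennreal (e / 4)"
    unfolding approximable_def by blast
  from g e obtain h' where h': "h' \<in> step_combs" "(\<integral>\<^sup>+x. ennreal ((g x - h' x)\<^sup>2) \<partial>\<mu>) \<le> ennreal (e / 4)"
    unfolding approximable_def by blast
  have [measurable]: "h \<in> borel_measurable borel" "h' \<in> borel_measurable borel"
    using h h' by (auto simp: step_combs_measurable)
  have "(\<integral>\<^sup>+x. ennreal (((f x - h x) + (g x - h' x))\<^sup>2) \<partial>\<mu>) \<le> ennreal (2 * (e / 4) + 2 * (e / 4))"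
    using h(2) h'(2) e by (intro nn_integral_sq_add_le) auto
  then show "\<exists>k. approximable k \<and> (\<integral>\<^sup>+x. ennreal ((f x + g x - k x)\<^sup>2) \<partial>\<mu>) \<le> ennreal e"
    using step_combs_add[OF h(1) h'(1)]
    by (intro exI[of _ "\<lambda>x. h x + h' x"]) (simp add: approximable_step_comb algebra_simps)
qed

lemma approximable_scale:
  assumes f: "approximable f"
  shows "approximable (\<lambda>x. b * f x)"
proof (rule approximable_limit)
  have [measurable]: "f \<in> borel_measurable borel"
    using f by (auto simp: approximable_measurable)
  show "(\<lambda>x. b * f x) \<in> borel_measurable borel" by simp
  fix e :: real assume e: "0 < e"
  then have "0 < e / (b\<^sup>2 + 1)" by (simp add: add_nonneg_pos)
  with f obtain h where h: "h \<in> step_combs" "(\<integral>\<^sup>+x. ennreal ((f x - h x)\<^sup>2) \<partial>\<mu>) \<le> ennreal (e / (b\<^sup>2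
      + 1))"
    unfolding approximable_def by blast
  have [measurable]: "h \<in> borel_measurable borel" using h by (auto simp: step_combs_measurable)
  have "(\<integral>\<^sup>+x. ennreal ((b * f x - b * h x)\<^sup>2) \<partial>\<mu>) = (\<integral>\<^sup>+x. ennreal (b\<^sup>2) * ennreal ((f x - h x)\<^sup>2) \<partial>\<mu>)"
    by (simp add: right_diff_distrib[symmetric] power_mult_distrib ennreal_mult)
  also have "\<dots> = ennreal (b\<^sup>2) * (\<integral>\<^sup>+x. ennreal ((f x - h x)\<^sup>2) \<partial>\<mu>)"
    by (simp add: nn_integral_cmult)
  also have "\<dots> \<le> ennreal (b\<^sup>2) * ennreal (e / (b\<^sup>2 + 1))"
    using h(2) by (intro mult_left_mono) auto
  also have "\<dots> = ennreal (b\<^sup>2 * (e / (b\<^sup>2 + 1)))"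
  proof -
    have "0 \<le> e / (b\<^sup>2 + 1)" using e by (intro divide_nonneg_nonneg add_nonneg_nonneg) simp_all
    then show ?thesis by (rule ennreal_mult[OF zero_le_power2, symmetric])
  qed
  also have "b\<^sup>2 * (e / (b\<^sup>2 + 1)) \<le> e"
  proof -
    have "0 < b\<^sup>2 + 1" using zero_le_power2[of b] by linarith
    then show ?thesis using e by (simp add: field_simps)
  qed
  finally show "\<exists>k. approximable k \<and> (\<integral>\<^sup>+x. ennreal ((b * f x - k x)\<^sup>2) \<partial>\<mu>) \<le> ennreal e"
    using step_combs_scale[OF h(1), of b]
    by (intro exI[of _ "\<lambda>x. b * h x"]) (auto simp: approximable_step_comb ennreal_leI)
qed

lemma approximable_uniform:
  assumes [measurable]: "f \<in> borel_measurable borel"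
    and u: "\<And>e. 0 < e \<Longrightarrow> \<exists>g. approximable g \<and> (\<forall>x\<in>unit_cube. \<bar>f x - g x\<bar> \<le> e)"
  shows "approximable f"
proof (rule approximable_limit[OF assms(1)])
  fix e :: real assume e: "0 < e"
  then have "0 < sqrt e" by simp
  from u[OF this] obtain g where g: "approximable g" "\<forall>x\<in>unit_cube. \<bar>f x - g x\<bar> \<le> sqrt e" by blast
  have "(\<integral>\<^sup>+x. ennreal ((f x - g x)\<^sup>2) \<partial>\<mu>) \<le> (\<integral>\<^sup>+x. ennreal e \<partial>\<mu>)"
  proof (rule nn_integral_mono_AE)
    show "AE x in \<mu>. ennreal ((f x - g x)\<^sup>2) \<le> ennreal e"
      using in_cube
    proof eventually_elim
      case (elim x)
      then have "(f x - g x)\<^sup>2 \<le> (sqrt e)\<^sup>2" using g(2) by (intro abs_le_square_iff[THEN iffD1]) auto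
      then show ?case using e by (simp add: ennreal_leI)
    qed
  qed
  also have "\<dots> = ennreal e" by (simp add: emeasure_space_1[simplified])
  finally show "\<exists>g. approximable g \<and> (\<integral>\<^sup>+x. ennreal ((f x - g x)\<^sup>2) \<partial>\<mu>) \<le> ennreal e"
    using g(1) by blast
qed

lemma approximable_cong_cube:
  assumes "approximable g" "f \<in> borel_measurable borel" "\<And>x. x \<in> unit_cube \<Longrightarrow> f x = g x"
  shows "approximable f"
  using assms by (intro approximable_uniform) (auto intro!: exI[of _ g])

lemma approximable_const: "approximable (\<lambda>_. c)"
proof -
  let ?H = "half_space (axis undefined 1 :: real ^ 'p) 1"
  have "approximable (\<lambda>x. c * indicator ?H x)"
    by (intro approximable_scale approximable_step_comb step_combs_half_space) simp
  then show ?thesis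
    by (rule approximable_cong_cube)
       (auto simp: half_space_def inner_axis' unit_cube_def)
qed

lemma approximable_diff:
  assumes "approximable f" "approximable g"
  shows "approximable (\<lambda>x. f x - g x)"
  using approximable_add[OF assms(1) approximable_scale[OF assms(2), of "-1"]] by simp

lemma approximable_sum:
  assumes "finite A" "\<And>a. a \<in> A \<Longrightarrow> approximable (f a)"
  shows "approximable (\<lambda>x. \<Sum>a\<in>A. f a x)"
  using assms by (induction rule: finite_induct) (auto intro: approximable_const approximable_add)

text \<open>
  A half-space with an arbitrary normal vector is a half-space with a unit normal vector, or
  trivial.
\<close>

lemma approximable_half_space: "approximable (indicator (half_space a s))"
proof (cases "a = 0")
  case True
  then have "(indicator (half_space a s) :: real ^ 'p \<Rightarrow> real) = (\<lambda>_. of_bool (0 \<le> s))"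
    by (auto simp: half_space_def indicator_def)
  then show ?thesis using approximable_const by simp
next
  case False
  then have "half_space a s = half_space (a /\<^sub>R norm a) (s / norm a)"
    by (auto simp: half_space_def field_simps)
  moreover have "norm (a /\<^sub>R norm a) = 1" using False by simp
  ultimately show ?thesis by (metis approximable_step_comb step_combs_half_space)
qed

text \<open>
  The linear form is bounded on the cube. Rounding it up to a multiple of \<open>\<delta>\<close> changes the
  exponential uniformly little and leaves a step function, because differences of indicators of
  nested half-spaces single out the values that are rounded to a given multiple.
\<close>

lemma approximable_exp: "approximable (\<lambda>x. exp (a \<bullet> x))"
proof (rule approximable_uniform)
  fix e :: real assume e: "0 < e"
  have "bounded ((\<lambda>x. a \<bullet> x) ` unit_cube)"
    by (intro compact_imp_bounded compact_continuous_image compact_unit_cube continuous_intros)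
  then obtain r where r: "\<And>x. x \<in> unit_cube \<Longrightarrow> \<bar>a \<bullet> x\<bar> \<le> r" 
    unfolding bounded_iff by auto
  \<comment> \<open>Chosen such that rounding up by at most \<open>\<delta>\<close> changes \<open>exp u\<close> by at most \<open>e\<close> for \<open>u \<le> r\<close>.\<close>
  define \<delta> where "\<delta> = ln (1 + e / exp r)"
  have \<delta>: "0 < \<delta>" "exp r * (exp \<delta> - 1) = e"
    using e by (simp_all add: \<delta>_def ln_gt_zero add_pos_pos)
  define J where "J = \<lceil>r / \<delta>\<rceil> + 1"
  define g where "g x = (\<Sum>j\<in>{-J..J}. exp (\<delta> * real_of_int j) *
      (indicator (half_space a (\<delta> * real_of_int j)) x
        - indicator (half_space a (\<delta> * real_of_int (j - 1))) x))" for x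
  have "approximable g" unfolding g_def
    by (intro approximable_sum approximable_scale approximable_diff approximable_half_space) auto
  moreover have "\<bar>exp (a \<bullet> x) - g x\<bar> \<le> e" if x: "x \<in> unit_cube" for x
  proof -
    define u where "u = a \<bullet> x"
    define j0 where "j0 = \<lceil>u / \<delta>\<rceil>"
    have u: "- r \<le> u" "u \<le> r" using r[OF x] by (auto simp: u_def)
    have "u / \<delta> \<le> r / \<delta>" "- (r / \<delta>) \<le> u / \<delta>" using u \<delta>(1) by (auto simp: field_simps)
    then have j0: "j0 \<in> {-J..J}" unfolding j0_def J_def by (auto; linarith)
    have "u = \<delta> * (u / \<delta>)" using \<delta>(1) by simp
    also have "\<dots> \<le> \<delta> * j0" using \<delta>(1) unfolding j0_def by (intro mult_left_mono le_of_int_ceiling) auto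
    finally have jb0: "u \<le> \<delta> * j0" .
    have jb: "u \<le> \<delta> * j0" "\<delta> * j0 \<le> u + \<delta>"
    proof -
      have "\<delta> * j0 \<le> \<delta> * (u / \<delta> + 1)"
        using \<delta>(1) unfolding j0_def by (intro mult_left_mono of_int_ceiling_le_add_one) auto
      then show "\<delta> * j0 \<le> u + \<delta>" using \<delta>(1) by (simp add: distrib_left)
    qed (fact jb0)
    have "indicator (half_space a (\<delta> * real_of_int j)) x
        - indicator (half_space a (\<delta> * real_of_int (j - 1))) x
       = (of_bool (j = j0) :: real)" for j
    proof -
      have "u \<le> \<delta> * real_of_int i \<longleftrightarrow> j0 \<le> i" for i
        using \<delta>(1) by (simp add: j0_def ceiling_le_iff field_simps)
      then have ind: "indicator (half_space a (\<delta> * real_of_int i)) x = (of_bool (j0 \<le> i) :: real)" for i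
        unfolding indicator_def half_space_def mem_Collect_eq u_def[symmetric] by simp
      show ?thesis unfolding ind by (simp add: of_bool_def)
    qed
    then have "g x = exp (\<delta> * j0)" using j0 by (simp add: g_def)
    moreover have "exp (\<delta> * j0) \<le> exp (u + \<delta>)" "exp u \<le> exp (\<delta> * j0)" using jb by auto
    moreover have "exp (u + \<delta>) - exp u \<le> e"
    proof -
      have "exp (u + \<delta>) - exp u = exp u * (exp \<delta> - 1)" by (simp add: exp_add algebra_simps)
      also have "\<dots> \<le> exp r * (exp \<delta> - 1)" using u \<delta>(1) by (intro mult_right_mono) auto
      finally show ?thesis using \<delta>(2) by simp
    qed
    ultimately show ?thesis unfolding u_def[symmetric] by linarith
  qed
  ultimately show "\<exists>g. approximable g \<and> (\<forall>x\<in>unit_cube. \<bar>exp (a \<bullet> x) - g x\<bar> \<le> e)" by blast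
qed simp

lemma approximable_exp_sums: "f \<in> exp_sums \<Longrightarrow> approximable f"
  by (induction rule: exp_sums.induct) (auto intro: approximable_add approximable_scale
      approximable_exp)

lemma approximable_continuous:
  assumes "continuous_on UNIV f"
  shows "approximable f"
proof (rule approximable_uniform)
  show "f \<in> borel_measurable borel" using assms by (rule borel_measurable_continuous_onI)
  fix e :: real assume "0 < e"
  interpret function_ring_on exp_sums "unit_cube :: (real ^ 'p) set" by (rule exp_sums_ring)
  obtain g where "g \<in> exp_sums" "\<forall>x\<in>unit_cube. \<bar>f x - g x\<bar> < e"
    using Stone_Weierstrass_basic[OF continuous_on_subset[OF assms] \<open>0 < e\<close>] by auto
  then show "\<exists>g. approximable g \<and> (\<forall>x\<in>unit_cube. \<bar>f x - g x\<bar> \<le> e)"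
    by (intro exI[of _ g]) (auto simp: approximable_exp_sums less_imp_le)
qed

lemma approximable_dominated:
  assumes F: "\<And>i. approximable (F i)" and lim: "\<And>x. (\<lambda>i. F i x) \<longlonglongrightarrow> f x"
    and w: "\<And>i x. (f x - F i x)\<^sup>2 \<le> w x" "integrable \<mu> w"
  shows "approximable f"
proof -
  have F' [measurable]: "F i \<in> borel_measurable borel" for i using F by (rule approximable_measurable)
  have f [measurable]: "f \<in> borel_measurable borel"
    using borel_measurable_LIMSEQ_real[OF lim F'] by simp
  have [measurable]: "w \<in> borel_measurable borel" using borel_measurable_integrable[OF w(2)] by simp
  have w0: "0 \<le> w x" for x using w(1)[of x 0] by (meson order_trans zero_le_power2)
  have "(\<lambda>i. \<integral>\<^sup>+x. ennreal ((f x - F i x)\<^sup>2) \<partial>\<mu>) \<longlonglongrightarrow> (\<integral>\<^sup>+x. ennreal 0 \<partial>\<mu>)"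
  proof (rule nn_integral_dominated_convergence[where w="\<lambda>x. ennreal (w x)"])
    show "(\<integral>\<^sup>+x. ennreal (w x) \<partial>\<mu>) < \<infinity>" using w(2) w0 by (simp add: integrable_iff_bounded)
    show "AE x in \<mu>. (\<lambda>i. ennreal ((f x - F i x)\<^sup>2)) \<longlonglongrightarrow> ennreal 0"
    proof (intro AE_I2 tendsto_ennrealI)
      fix x
      have "(\<lambda>i. (f x - F i x)\<^sup>2) \<longlonglongrightarrow> (f x - f x)\<^sup>2" by (intro tendsto_intros lim)
      then show "(\<lambda>i. (f x - F i x)\<^sup>2) \<longlonglongrightarrow> 0" by simp
    qed
  qed (use w in \<open>auto intro!: ennreal_leI\<close>)
  then have z: "(\<lambda>i. \<integral>\<^sup>+x. ennreal ((f x - F i x)\<^sup>2) \<partial>\<mu>) \<longlonglongrightarrow> 0" by simp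
  show ?thesis
  proof (rule approximable_limit[OF f])
    fix e :: real assume "0 < e"
    then have "\<forall>\<^sub>F i in sequentially. (\<integral>\<^sup>+x. ennreal ((f x - F i x)\<^sup>2) \<partial>\<mu>) < ennreal e"
      by (intro order_tendstoD(2)[OF z]) simp
    then obtain i where "(\<integral>\<^sup>+x. ennreal ((f x - F i x)\<^sup>2) \<partial>\<mu>) < ennreal e"
      using eventually_happens'[OF sequentially_bot] by blast
    then show "\<exists>g. approximable g \<and> (\<integral>\<^sup>+x. ennreal ((f x - g x)\<^sup>2) \<partial>\<mu>) \<le> ennreal e"
      using F by (intro exI[of _ "F i"]) auto
  qed
qed

text \<open>
  The functions \<open>max 0 (1 - i * infdist x K)\<close> are continuous and decrease to the indicator.
\<close>

lemma approximable_closed: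
  assumes "closed K"
  shows "approximable (indicator K)"
proof (cases "K = {}")
  case True
  then have "indicator K = (\<lambda>_. 0 :: real)" by (simp add: fun_eq_iff)
  then show ?thesis using approximable_const[of 0] by simp
next
  case False
  define F where "F i x = max 0 (1 - real i * infdist x K)" for i :: nat and x :: "real ^ 'p"
  have F01: "0 \<le> F i x" "F i x \<le> 1" for i x by (auto simp: F_def infdist_nonneg)
  show ?thesis
  proof (rule approximable_dominated[where F=F and w="\<lambda>_. 1"])
    show "approximable (F i)" for i
      unfolding F_def by (intro approximable_continuous continuous_intros)
    show "(\<lambda>i. F i x) \<longlonglongrightarrow> indicator K x" for x
    proof (cases "x \<in> K")
      case True
      then show ?thesis by (simp add: F_def)
    next
      case notin: False
      then have d: "0 < infdist x K"
        using assms False by (metis in_closed_iff_infdist_zero infdist_nonneg less_eq_real_def)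
      obtain N :: nat where N: "1 / infdist x K < N" using reals_Archimedean2 by blast
      have "\<forall>\<^sub>F i in sequentially. F i x = 0"
        using eventually_ge_at_top[of N]
      proof eventually_elim
        case (elim i)
        then have "1 / infdist x K < i" using N by simp
        then show ?case using d by (simp add: F_def field_simps)
      qed
      then show ?thesis using notin by (simp add: tendsto_eventually)
    qed
    show "(indicator K x - F i x)\<^sup>2 \<le> 1" for i x
      using F01[of i x] by (auto simp: indicator_def abs_square_le_1)
  qed simp
qed

text \<open>
  The closed sets are an intersection-stable generator of the Borel sets, and approximability
  passes to complements and disjoint unions.
\<close>

lemma approximable_indicator:
  assumes "A \<in> sets borel"
  shows "approximable (indicator A)"
proof -
  have gen: "sets borel = sigma_sets UNIV {K :: (real ^ 'p) set. closed K}"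
    by (simp add: borel_eq_closed)
  have Int: "Int_stable {K :: (real ^ 'p) set. closed K}" by (auto simp: Int_stable_def)
  have PowUNIV: "{K :: (real ^ 'p) set. closed K} \<subseteq> Pow UNIV" by simp
  have "A \<in> sigma_sets UNIV {K. closed K}" using assms gen by simp
  then show ?thesis
  proof (induction rule: sigma_sets_induct_disjoint[OF Int PowUNIV,
        consumes 1, case_names basic empty compl union])
    case (basic A)
    then show ?case by (simp add: approximable_closed)
  next
    case empty
    have "indicator {} = (\<lambda>_. 0 :: real)" by (simp add: fun_eq_iff)
    then show ?case using approximable_const[of 0] by simp
  next
    case (compl A)
    have "indicator (UNIV - A) = (\<lambda>x. 1 - indicator A x :: real)" by (auto simp: indicator_def)
    then show ?case using approximable_diff[OF approximable_const compl(2), of 1] by simp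
  next
    case (union A)
    show ?case
    proof (rule approximable_dominated[where F="\<lambda>n x. \<Sum>i<n. indicator (A i) x" and w="\<lambda>_. 1"])
      have eq: "(\<Sum>i<n. indicator (A i) x) = (indicator (\<Union>i<n. A i) x :: real)" for n x
      proof -
        have "disjoint_family_on A {..<n}" using union(1)
            by (rule disjoint_family_on_mono[rotated]) simp
        then show ?thesis by (rule indicator_UN_disjoint[OF finite_lessThan, symmetric])
      qed
      show "approximable (\<lambda>x. \<Sum>i<n. indicator (A i) x)" for n
        using union by (intro approximable_sum) auto
      show "(\<lambda>n. \<Sum>i<n. indicator (A i) x) \<longlonglongrightarrow> (indicator (\<Union>i. A i) x :: real)" for x
        unfolding eq by (rule LIMSEQ_indicator_UN)
      show "(indicator (\<Union>i. A i) x - (\<Sum>i<n. indicator (A i) x :: real))\<^sup>2 \<le> 1" for n x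
        unfolding eq by (auto simp: indicator_def)
    qed simp
  qed
qed

lemma approximable_square_integrable:
  assumes [measurable]: "f \<in> borel_measurable borel" and "integrable \<mu> (\<lambda>x. (f x)\<^sup>2)"
  shows "approximable f"
proof -
  obtain F where F: "\<And>i. simple_function borel (F i)" "\<And>x. (\<lambda>i. F i x) \<longlonglongrightarrow> f x"
    "\<And>i x. dist (F i x) 0 \<le> 2 * dist (f x) 0"
    using borel_measurable_implies_sequence_metric[OF assms(1), of 0] by auto
  show ?thesis
  proof (rule approximable_dominated[where F=F and w="\<lambda>x. 9 * (f x)\<^sup>2"])
    show "approximable (F i)" for i
    proof -
      have fin: "finite (range (F i))" using simple_functionD(1)[OF F(1)[of i]] by simp
      have "approximable (\<lambda>x. \<Sum>y\<in>range (F i). y * indicator (F i -` {y}) x)"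
        using fin simple_functionD(2)[OF F(1)[of i]]
        by (intro approximable_sum approximable_scale approximable_indicator) auto
      moreover have "(\<Sum>y\<in>range (F i). y * indicator (F i -` {y}) x) = F i x" for x
        using fin by (simp add: indicator_def if_distrib cong: if_cong)
      ultimately show ?thesis by simp
    qed
    show "(f x - F i x)\<^sup>2 \<le> 9 * (f x)\<^sup>2" for i x
    proof -
      have "\<bar>f x - F i x\<bar> \<le> \<bar>3 * f x\<bar>" using F(3)[of i x] by (auto simp: dist_real_def)
      then have "(f x - F i x)\<^sup>2 \<le> (3 * f x)\<^sup>2" by (simp only: abs_le_square_iff)
      then show ?thesis by (simp add: power_mult_distrib)
    qed
  qed (use F assms in auto)
qed

end

section \<open>Symmetrization\<close>

lemma integral_PiM_reindex:
  fixes f :: "('i \<Rightarrow> 'z) \<Rightarrow> real"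
  assumes P: "prob_space P" and \<pi>: "inj_on \<pi> I" "\<pi> \<in> I \<rightarrow> K"
    and f: "f \<in> borel_measurable (\<Pi>\<^sub>M i\<in>I. P)"
  shows "(\<integral>w. f (\<lambda>i\<in>I. w (\<pi> i)) \<partial>(\<Pi>\<^sub>M i\<in>K. P)) = (\<integral>w. f w \<partial>(\<Pi>\<^sub>M i\<in>I. P))"
proof -
  have m: "(\<lambda>w. \<lambda>i\<in>I. w (\<pi> i)) \<in> measurable (\<Pi>\<^sub>M i\<in>K. P) (\<Pi>\<^sub>M i\<in>I. P)"
    using \<pi>(2) by (intro measurable_restrict measurable_component_singleton) auto
  have "distr (\<Pi>\<^sub>M i\<in>K. P) (\<Pi>\<^sub>M i\<in>I. P) (\<lambda>w. \<lambda>i\<in>I. w (\<pi> i)) = (\<Pi>\<^sub>M i\<in>I. P)"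
    using distr_PiM_reindex[of K "\<lambda>_. P" \<pi> I] P \<pi> by simp
  then show ?thesis using integral_distr[OF m f] by simp
qed

text \<open>
  Symmetrization in expectation. Draw \<open>n\<close> pairs of points. For every swap \<open>\<epsilon>\<close> the selected points
  are distributed like the sample, the rejected ones are independent of them, so the mean of the
  loss over the rejected points has the expected risk as expectation and the mean over the
  selected ones has the expected empirical risk. Averaging over all swaps before integrating over
  the pairs leaves a combinatorial quantity for a fixed set of \<open>2 * n\<close> points, which
  \<open>swap_average_functions\<close> bounds.
\<close>

lemma expected_risk_le_empirical_risk:
  fixes g :: "(nat \<Rightarrow> 'z) \<Rightarrow> 'z \<Rightarrow> real" and M \<eta> s S :: real
  assumes P: "prob_space P"
    and g: "(\<lambda>(D, z). g D z) \<in> borel_measurable ((\<Pi>\<^sub>M i\<in>{..<n}. P) \<Otimes>\<^sub>M P)"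
    and bnd: "\<And>D z. 0 \<le> g D z \<and> g D z \<le> M"
    and fam: "\<And>w u. \<exists>F. finite F \<and> real (card F) \<le> S \<and>
           (\<forall>D. {q \<in> {..<n} \<times> (UNIV :: bool set). u < g D (w q)} \<in> F)"
    and \<eta>: "0 < \<eta>" and s: "0 < s" "exp s + exp (- (1 + \<eta>) * s) \<le> 2" and n: "0 < n"
  shows "(\<integral>D. (\<integral>z. g D z \<partial>P) \<partial>(\<Pi>\<^sub>M i\<in>{..<n}. P))
     \<le> (1 + \<eta>) * (\<integral>D. (\<Sum>j<n. g D (D j)) / n \<partial>(\<Pi>\<^sub>M i\<in>{..<n}. P)) + M * ln S / (s * n)"
proof -
  let ?I = "{..<n}" and ?K = "{..<n} \<times> (UNIV :: bool set)"
  let ?Q = "\<Pi>\<^sub>M i\<in>?I. P" and ?W = "\<Pi>\<^sub>M q\<in>?K. P"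
  interpret P: prob_space P by fact
  interpret PP: product_prob_space "\<lambda>_. P" by unfold_locales
  interpret Q: prob_space ?Q by (intro prob_space_PiM P)
  interpret W: prob_space ?W by (intro prob_space_PiM P)
  have M: "0 \<le> M" using bnd[of undefined undefined] by linarith
  have g_comp: "(\<lambda>x. g (f x) (h x)) \<in> borel_measurable N"
    if "f \<in> measurable N ?Q" "h \<in> measurable N P" for f h and N :: "'b measure"
    using measurable_compose[OF measurable_Pair[OF that] g] by simp
  have g_comp': "(\<lambda>x. g (f x) (h x)) \<in> borel_measurable N"
    if "f \<in> measurable N ?Q" "h \<in> measurable N P" for f h and N :: "(nat \<Rightarrow> 'z) measure"
    using measurable_compose[OF measurable_Pair[OF that] g] by simp
  define sel where "sel \<epsilon> w = (\<lambda>i\<in>?I. w (i, \<epsilon> i))" for \<epsilon> :: "nat \<Rightarrow> bool" and w :: "nat \<times> bool \<Rightarrow> 'z"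
  have sel_m: "sel \<epsilon> \<in> measurable ?W ?Q" for \<epsilon>
    unfolding sel_def by (intro measurable_restrict measurable_component_singleton) auto
  have comp_m: "(\<lambda>w. w q) \<in> measurable ?W P" if "q \<in> ?K" for q
    using that by (intro measurable_component_singleton)
  define gen where "gen = (\<integral>D. (\<integral>z. g D z \<partial>P) \<partial>?Q)"
  define emp where "emp = (\<integral>D. (\<Sum>j<n. g D (D j)) / n \<partial>?Q)"
  have int_m: "integrable N f" if "f \<in> borel_measurable N" "finite_measure N" "\<And>x. 0 \<le> f x \<and> f x \<le> M"
    for N :: "'c measure" and f
    using that by (intro finite_measure.integrable_const_bound[of N f M]) auto
  have int_W: "integrable ?W (\<lambda>w. g (sel \<epsilon> w) (w q))" if "q \<in> ?K" for \<epsilon> q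
    by (intro W.integrable_const_bound[of _ M] g_comp sel_m comp_m that) (use bnd in auto)
  \<comment> \<open>A rejected point is independent of the selected sample and so acts as a fresh observation.\<close>
  have gen_eq: "(\<integral>w. g (sel \<epsilon> w) (w (j, \<not> \<epsilon> j)) \<partial>?W) = gen" if "j < n" for \<epsilon> j
  proof -
    \<comment> \<open>The additional index \<open>n\<close> stands for the rejected point of the pair \<open>j\<close>.\<close>
    define \<pi> where "\<pi> i = (if i = n then (j, \<not> \<epsilon> j) else (i, \<epsilon> i))" for i
    let ?J = "insert n ?I"
    define f where "f D = g (restrict D ?I) (D n)" for D :: "nat \<Rightarrow> 'z"
    have f: "f \<in> borel_measurable (\<Pi>\<^sub>M i\<in>?J. P)"
      unfolding f_def by (intro g_comp' measurable_restrict_subset measurable_component_singleton) auto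
    interpret J: prob_space "\<Pi>\<^sub>M i\<in>?J. P" by (intro prob_space_PiM P)
    have fint: "integrable (\<Pi>\<^sub>M i\<in>?J. P) f"
      by (intro J.integrable_const_bound[of _ M] f) (use bnd in \<open>auto simp: f_def\<close>)
    have inj: "inj_on \<pi> ?J" using that by (auto simp: inj_on_def \<pi>_def)
    have into: "\<pi> \<in> ?J \<rightarrow> ?K" using that by (auto simp: \<pi>_def)
    have "(\<integral>w. g (sel \<epsilon> w) (w (j, \<not> \<epsilon> j)) \<partial>?W) = (\<integral>w. f (\<lambda>i\<in>?J. w (\<pi> i)) \<partial>?W)"
    proof (intro Bochner_Integration.integral_cong refl)
      fix w
      have "restrict (\<lambda>i\<in>?J. w (\<pi> i)) ?I = sel \<epsilon> w"
        by (auto simp: sel_def \<pi>_def fun_eq_iff)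
      then show "g (sel \<epsilon> w) (w (j, \<not> \<epsilon> j)) = f (\<lambda>i\<in>?J. w (\<pi> i))"
        by (simp add: f_def \<pi>_def)
    qed
    also have "\<dots> = (\<integral>D. f D \<partial>(\<Pi>\<^sub>M i\<in>?J. P))"
      by (rule integral_PiM_reindex[OF P inj into f])
    also have "\<dots> = (\<integral>D. (\<integral>z. f (D(n := z)) \<partial>P) \<partial>?Q)"
      by (rule PP.product_integral_insert[OF _ _ fint]) auto
    also have "\<dots> = gen"
      unfolding gen_def
    proof (intro Bochner_Integration.integral_cong refl)
      fix D z assume "D \<in> space ?Q"
      then have "restrict (D(n := z)) ?I = D"
        by (auto simp: space_PiM PiE_def extensional_def fun_eq_iff)
      then show "f (D(n := z)) = g D z" by (simp add: f_def)
    qed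
    finally show ?thesis .
  qed
  have emp_eq: "(\<integral>w. (\<Sum>j<n. g (sel \<epsilon> w) (w (j, \<epsilon> j))) / n \<partial>?W) = emp" for \<epsilon>
  proof -
    let ?\<pi> = "\<lambda>i. (i, \<epsilon> i)" and ?f = "\<lambda>D. (\<Sum>j<n. g D (D j)) / n"
    have "(\<integral>w. (\<Sum>j<n. g (sel \<epsilon> w) (w (j, \<epsilon> j))) / n \<partial>?W) = (\<integral>w. ?f (\<lambda>i\<in>?I. w (?\<pi> i)) \<partial>?W)"
      by (intro Bochner_Integration.integral_cong refl arg_cong2[where f="(/)"] sum.cong)
         (simp_all add: sel_def)
    also have "\<dots> = emp"
      unfolding emp_def
    proof (rule integral_PiM_reindex[OF P])
      have "(\<lambda>D. g D (D j)) \<in> borel_measurable ?Q" if "j < n" for j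
        using g_comp'[of "\<lambda>D. D" ?Q "\<lambda>D. D j"] that by simp
      then show "?f \<in> borel_measurable ?Q" by (intro borel_measurable_divide borel_measurable_sum) auto
    qed (auto simp: inj_on_def)
    finally show ?thesis .
  qed
  have sum_eq: "(\<integral>w. (\<Sum>j<n. g (sel \<epsilon> w) (w (j, \<not> \<epsilon> j)) - (1 + \<eta>) * g (sel \<epsilon> w) (w (j, \<epsilon> j))) \<partial>?W)
      = n * (gen - (1 + \<eta>) * emp)" for \<epsilon>
  proof -
    have "emp = (\<Sum>j<n. \<integral>w. g (sel \<epsilon> w) (w (j, \<epsilon> j)) \<partial>?W) / n"
      unfolding emp_eq[of \<epsilon>, symmetric] using int_W
      by (subst Bochner_Integration.integral_divide_zero, subst Bochner_Integration.integral_sum) auto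
    then have e: "(\<Sum>j<n. \<integral>w. g (sel \<epsilon> w) (w (j, \<epsilon> j)) \<partial>?W) = n * emp" using n by simp
    have "(\<integral>w. (\<Sum>j<n. g (sel \<epsilon> w) (w (j, \<not> \<epsilon> j)) - (1 + \<eta>) * g (sel \<epsilon> w) (w (j, \<epsilon> j))) \<partial>?W)
       = (\<Sum>j<n. gen - (1 + \<eta>) * (\<integral>w. g (sel \<epsilon> w) (w (j, \<epsilon> j)) \<partial>?W))"
      using int_W by (subst Bochner_Integration.integral_sum) (auto simp: gen_eq)
    also have "\<dots> = n * (gen - (1 + \<eta>) * emp)"
      by (simp only: sum_subtractf sum_distrib_left[symmetric] e) (simp add: algebra_simps)
    finally show ?thesis .
  qed
  let ?B = "2 ^ n * (M * ln S / s)"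
  have int_sum: "integrable ?W (\<lambda>w. \<Sum>j<n. g (sel \<epsilon> w) (w (j, \<not> \<epsilon> j)) - (1
      + \<eta>) * g (sel \<epsilon> w) (w (j, \<epsilon> j)))" for \<epsilon>
    using int_W by (intro Bochner_Integration.integrable_sum Bochner_Integration.integrable_diff
        Bochner_Integration.integrable_mult_right) auto
  have "2 ^ n * (n * (gen - (1 + \<eta>) * emp))
     = (\<integral>w. (\<Sum>\<epsilon>\<in>swaps n. \<Sum>j<n. g (sel \<epsilon> w) (w (j, \<not> \<epsilon> j)) - (1 + \<eta>) * g (sel \<epsilon> w) (w (j, \<epsilon> j))) \<partial>?W)"
    by (subst Bochner_Integration.integral_sum) (simp_all add: int_sum sum_eq card_swaps)
  also have "\<dots> \<le> (\<integral>w. ?B \<partial>?W)"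
  proof (rule integral_mono)
    show "integrable ?W (\<lambda>w. \<Sum>\<epsilon>\<in>swaps n. \<Sum>j<n.
        g (sel \<epsilon> w) (w (j, \<not> \<epsilon> j)) - (1 + \<eta>) * g (sel \<epsilon> w) (w (j, \<epsilon> j)))"
      by (rule Bochner_Integration.integrable_sum) (rule int_sum)
    show "integrable ?W (\<lambda>w. ?B)" by (rule W.integrable_const)
    fix w :: "nat \<times> bool \<Rightarrow> 'z"
    show "(\<Sum>\<epsilon>\<in>swaps n. \<Sum>j<n. g (sel \<epsilon> w) (w (j, \<not> \<epsilon> j)) - (1 + \<eta>) * g (sel \<epsilon> w) (w (j, \<epsilon> j))) \<le> ?B"
    proof (rule swap_average_functions[where g="\<lambda>\<epsilon> q. g (sel \<epsilon> w) (w q)", OF s \<eta>])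
      show "\<exists>F. finite F \<and> real (card F) \<le> S \<and>
          (\<forall>\<epsilon>\<in>swaps n. {q \<in> {..<n} \<times> UNIV. u < g (sel \<epsilon> w) (w q)} \<in> F)" for u
        using fam[of u w] by blast
    qed (rule bnd)
  qed
  also have "\<dots> = ?B" by (simp add: W.prob_space[simplified])
  finally have "n * (gen - (1 + \<eta>) * emp) \<le> M * ln S / s"
    by (rule mult_left_le_imp_le) simp
  then have "gen - (1 + \<eta>) * emp \<le> M * ln S / (s * n)"
    using n s(1) by (simp add: field_simps)
  then show ?thesis unfolding gen_def[symmetric] emp_def[symmetric] by simp
qed

section \<open>Risk of a boosting tree with fixed seeds\<close>

lemma clip_measurable [measurable]: "clip b \<in> borel_measurable borel"
  unfolding clip_def by measurable

lemma abs_clip_le: "0 \<le> b \<Longrightarrow> \<bar>clip b y\<bar> \<le> b"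
  by (auto simp: clip_def)

lemma clip_dist_le: "\<bar>w\<bar> \<le> b \<Longrightarrow> (clip b y - w)\<^sup>2 \<le> (y - w)\<^sup>2"
  unfolding abs_le_square_iff[symmetric] by (auto simp: clip_def)

lemma clip_error_le: "0 \<le> b \<Longrightarrow> (clip b y - y)\<^sup>2 \<le> y\<^sup>2"
  unfolding abs_le_square_iff[symmetric] by (auto simp: clip_def)

text \<open>
  The inequality between the arithmetic and the geometric mean, weighted with \<open>\<epsilon>\<close>, for the mixed
  term.
\<close>

lemma sq_triangle:
  fixes a b c \<epsilon> :: real
  assumes "0 < \<epsilon>"
  shows "(a - c)\<^sup>2 \<le> (1 + \<epsilon>) * (a - b)\<^sup>2 + (1 + 1 / \<epsilon>) * (b - c)\<^sup>2"
proof -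
  let ?x = "a - b" and ?y = "b - c"
  have "0 \<le> (\<epsilon> * ?x - ?y)\<^sup>2 / \<epsilon>" using assms by simp
  also have "\<dots> = \<epsilon> * ?x\<^sup>2 - 2 * ?x * ?y + ?y\<^sup>2 / \<epsilon>"
    using assms by (simp add: power2_eq_square field_simps)
  finally have "2 * ?x * ?y \<le> \<epsilon> * ?x\<^sup>2 + ?y\<^sup>2 / \<epsilon>" by simp
  moreover have "(a - c)\<^sup>2 = ?x\<^sup>2 + 2 * ?x * ?y + ?y\<^sup>2"
    by (simp add: power2_eq_square algebra_simps)
  ultimately show ?thesis by (simp add: distrib_right)
qed

lemma integrable_sq_diff:
  fixes f g :: "'a \<Rightarrow> real"
  assumes [measurable]: "f \<in> borel_measurable M" "g \<in> borel_measurable M"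
    and "integrable M (\<lambda>x. (f x)\<^sup>2)" "integrable M (\<lambda>x. (g x)\<^sup>2)"
  shows "integrable M (\<lambda>x. (f x - g x)\<^sup>2)"
proof (rule Bochner_Integration.integrable_bound)
  show "integrable M (\<lambda>x. 2 * (f x)\<^sup>2 + 2 * (g x)\<^sup>2)" using assms by auto
  show "AE x in M. norm ((f x - g x)\<^sup>2) \<le> norm (2 * (f x)\<^sup>2 + 2 * (g x)\<^sup>2)"
    using sq_add_le[of "f _" "- g _"] by (intro AE_I2) simp
qed simp

lemma integrable_mult_sq:
  fixes f g :: "'a \<Rightarrow> real"
  assumes [measurable]: "f \<in> borel_measurable M" "g \<in> borel_measurable M"
    and "integrable M (\<lambda>x. (f x)\<^sup>2)" "integrable M (\<lambda>x. (g x)\<^sup>2)"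
  shows "integrable M (\<lambda>x. f x * g x)"
proof (rule Bochner_Integration.integrable_bound)
  show "integrable M (\<lambda>x. (f x)\<^sup>2 + (g x)\<^sup>2)" using assms by auto
  show "AE x in M. norm (f x * g x) \<le> norm ((f x)\<^sup>2 + (g x)\<^sup>2)"
  proof (intro AE_I2)
    fix x
    have "2 * (\<bar>f x\<bar> * \<bar>g x\<bar>) \<le> (f x)\<^sup>2 + (g x)\<^sup>2"
      using sum_squares_bound[of "\<bar>f x\<bar>" "\<bar>g x\<bar>"] by simp
    moreover have "0 \<le> \<bar>f x\<bar> * \<bar>g x\<bar>" by simp
    ultimately show "norm (f x * g x) \<le> norm ((f x)\<^sup>2 + (g x)\<^sup>2)"
      unfolding real_norm_def abs_mult by linarith
  qed
qed simp

text \<open>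
  \<open>P\<close> is the law of covariate and response. The last assumption characterizes the regression
  function as the orthogonal projection of the response to the square-integrable functions of the
  covariate.
\<close>

locale regression_law = prob_space P for P :: "((real ^ 'p::finite) \<times> real) measure" +
  fixes m :: "real ^ 'p \<Rightarrow> real"
  assumes sets_eq [measurable_cong, simp]: "sets P = sets borel"
    and in_cube: "AE z in P. fst z \<in> unit_cube"
    and response_sq: "integrable P (\<lambda>z. (snd z)\<^sup>2)"
    and m_measurable [measurable]: "m \<in> borel_measurable borel"
    and m_sq: "integrable P (\<lambda>z. (m (fst z))\<^sup>2)"
    and regression: "\<And>\<phi>. \<phi> \<in> borel_measurable borel \<Longrightarrow> integrable P (\<lambda>z. (\<phi> (fst z))\<^sup>2) \<Longrightarrow>
        (\<integral>z. \<phi> (fst z) * snd z \<partial>P) = (\<integral>z. \<phi> (fst z) * m (fst z) \<partial>P)"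
begin

lemma space_eq [simp]: "space P = UNIV"
  using sets_eq_imp_space_eq[OF sets_eq] by simp

lemma fst_snd_measurable [measurable]: "fst \<in> measurable P borel" "snd \<in> borel_measurable P"
  by (simp_all add: measurable_cong_sets[OF sets_eq refl] borel_prod[symmetric])

definition noise :: real where "noise = (\<integral>z. (m (fst z) - snd z)\<^sup>2 \<partial>P)"

definition clip_error :: "real \<Rightarrow> real" where "clip_error L = (\<integral>z. (clip L (snd z) - snd z)\<^sup>2 \<partial>P)"

lemma clip_square_integrable:
  assumes [measurable]: "f \<in> borel_measurable borel" and b: "0 \<le> b"
  shows "integrable P (\<lambda>z. (clip b (f (fst z)))\<^sup>2)"
proof (rule integrable_const_bound[of _ "b\<^sup>2"])
  show "AE z in P. norm ((clip b (f (fst z)))\<^sup>2) \<le> b\<^sup>2"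
    using abs_clip_le[OF b] b by (auto simp: abs_le_square_iff[symmetric])
qed measurable

lemma clip_error_integrable:
  "0 \<le> b \<Longrightarrow> integrable P (\<lambda>z. (clip b (snd z) - snd z)\<^sup>2)"
  by (rule Bochner_Integration.integrable_bound[OF response_sq]) (use clip_error_le in auto)

lemma risk_decomposition:
  assumes [measurable]: "\<phi> \<in> borel_measurable borel" and \<phi>: "integrable P (\<lambda>z. (\<phi> (fst z))\<^sup>2)"
  shows "(\<integral>z. (\<phi> (fst z) - snd z)\<^sup>2 \<partial>P) = (\<integral>z. (\<phi> (fst z) - m (fst z))\<^sup>2 \<partial>P) + noise"
proof -
  have [measurable]: "(\<lambda>z. \<phi> (fst z)) \<in> borel_measurable P" "(\<lambda>z. m (fst z)) \<in> borel_measurable P"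
    by measurable
  let ?d = "\<lambda>x. \<phi> x - m x"
  have d: "integrable P (\<lambda>z. (?d (fst z))\<^sup>2)"
    using \<phi> m_sq by (intro integrable_sq_diff) auto
  have n: "integrable P (\<lambda>z. (m (fst z) - snd z)\<^sup>2)"
    using response_sq m_sq by (intro integrable_sq_diff) auto
  have "(\<integral>z. ?d (fst z) * snd z \<partial>P) = (\<integral>z. ?d (fst z) * m (fst z) \<partial>P)"
    using d by (intro regression) auto
  moreover have i: "integrable P (\<lambda>z. ?d (fst z) * snd z)" "integrable P (\<lambda>z. ?d (fst z) * m (fst z))"
    using d response_sq m_sq by (auto intro!: integrable_mult_sq)
  ultimately have cross: "(\<integral>z. ?d (fst z) * m (fst z) - ?d (fst z) * snd z \<partial>P) = 0" by simp
  have "(\<integral>z. (\<phi> (fst z) - snd z)\<^sup>2 \<partial>P) =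
    (\<integral>z. ((?d (fst z))\<^sup>2 + (m (fst z) - snd z)\<^sup>2) + 2 * (?d (fst z) * m (fst z)
      - ?d (fst z) * snd z) \<partial>P)"
    by (intro Bochner_Integration.integral_cong refl) (simp add: power2_eq_square algebra_simps)
  also have "\<dots> = (\<integral>z. (?d (fst z))\<^sup>2 + (m (fst z) - snd z)\<^sup>2 \<partial>P) 
      + 2 * (\<integral>z. ?d (fst z) * m (fst z) - ?d (fst z) * snd z \<partial>P)"
    using d n i by (subst Bochner_Integration.integral_add) auto
  also have "\<dots> = (\<integral>z. (?d (fst z))\<^sup>2 \<partial>P) + noise"
    using d n unfolding cross noise_def by simp
  finally show ?thesis .
qed

lemma step_fun_square_integrable:
  fixes c s :: "'q \<Rightarrow> real"
  shows "integrable P (\<lambda>z. (step_fun Q c \<theta> s (fst z))\<^sup>2)"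
proof (rule integrable_const_bound[of _ "(\<Sum>q\<in>Q. \<bar>c q\<bar>)\<^sup>2"])
  have "\<bar>step_fun Q c \<theta> s x\<bar> \<le> (\<Sum>q\<in>Q. \<bar>c q\<bar>)" for x
    unfolding step_fun_def
    by (rule order_trans[OF sum_abs]) (intro sum_mono, auto simp: abs_mult indicator_def)
  then have "\<bar>step_fun Q c \<theta> s x\<bar> \<le> \<bar>\<Sum>q\<in>Q. \<bar>c q\<bar>\<bar>" for x by (rule order_trans) simp
  then show "AE z in P. norm ((step_fun Q c \<theta> s (fst z))\<^sup>2) \<le> (\<Sum>q\<in>Q. \<bar>c q\<bar>)\<^sup>2"
    unfolding abs_le_square_iff by auto
qed measurable

lemma clip_error_tendsto_0: "(\<lambda>i. clip_error (real i)) \<longlonglongrightarrow> 0"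
proof -
  have "(\<lambda>i. \<integral>z. (clip (real i) (snd z) - snd z)\<^sup>2 \<partial>P) \<longlonglongrightarrow> (\<integral>z. 0 \<partial>P)"
  proof (rule integral_dominated_convergence[where w="\<lambda>z. (snd z)\<^sup>2"])
    show "AE z in P. (\<lambda>i. (clip (real i) (snd z) - snd z)\<^sup>2) \<longlonglongrightarrow> 0"
    proof (intro AE_I2)
      fix z :: "(real ^ 'p) \<times> real"
      obtain N :: nat where N: "\<bar>snd z\<bar> < N" using reals_Archimedean2 by blast
      have "\<forall>\<^sub>F i in sequentially. (clip (real i) (snd z) - snd z)\<^sup>2 = 0"
        using eventually_ge_at_top[of N]
      proof eventually_elim
        case (elim i)
        then have "\<bar>snd z\<bar> \<le> i" using N by linarith
        then show ?case by (auto simp: clip_def)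
      qed
      then show "(\<lambda>i. (clip (real i) (snd z) - snd z)\<^sup>2) \<longlonglongrightarrow> 0" by (rule tendsto_eventually)
    qed
  qed (use response_sq clip_error_le in auto)
  then show ?thesis by (simp add: clip_error_def)
qed

lemma sample_average:
  fixes \<phi> :: "(real ^ 'p) \<times> real \<Rightarrow> real"
  assumes \<phi>: "integrable P \<phi>" and n: "0 < n"
  shows "integrable (\<Pi>\<^sub>M i\<in>{..<n}. P) (\<lambda>D. (\<Sum>j<n. \<phi> (D j)) / real n)"
    and "(\<integral>D. (\<Sum>j<n. \<phi> (D j)) / real n \<partial>(\<Pi>\<^sub>M i\<in>{..<n}. P)) = (\<integral>z. \<phi> z \<partial>P)"
proof -
  let ?Q = "\<Pi>\<^sub>M i\<in>{..<n}. P"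
  have comp: "(\<lambda>D. D j) \<in> measurable ?Q P" if "j < n" for j
    using that by (intro measurable_component_singleton) auto
  have distr: "distr ?Q P (\<lambda>D. D j) = P" if "j < n" for j
    using distr_PiM_component[of "{..<n}" "\<lambda>_. P" j] that prob_space_axioms by auto
  have 1: "integrable ?Q (\<lambda>D. \<phi> (D j))" if "j < n" for j
    using integrable_distr[OF comp[OF that], of \<phi>] \<phi> distr[OF that] by simp
  have 2: "(\<integral>D. \<phi> (D j) \<partial>?Q) = (\<integral>z. \<phi> z \<partial>P)" if "j < n" for j
    using integral_distr[OF comp[OF that], of \<phi>] borel_measurable_integrable[OF \<phi>] distr[OF that]
        by simp
  show "integrable ?Q (\<lambda>D. (\<Sum>j<n. \<phi> (D j)) / real n)"
    using 1 by (intro integrable_divide_zero Bochner_Integration.integrable_sum) auto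
  show "(\<integral>D. (\<Sum>j<n. \<phi> (D j)) / real n \<partial>?Q) = (\<integral>z. \<phi> z \<partial>P)"
    using 1 2 n by simp
qed

lemma sample_in_cube:
  fixes n :: nat
  shows "AE D in (\<Pi>\<^sub>M i\<in>{..<n}. P). \<forall>i<n. fst (D i) \<in> unit_cube"
proof -
  have "AE D in (\<Pi>\<^sub>M i\<in>{..<n}. P). fst (D i) \<in> unit_cube" if "i < n" for i
    using that prob_space_axioms in_cube
    by (intro AE_PiM_component[where P="\<lambda>z. fst z \<in> unit_cube"]) auto
  then have "AE D in (\<Pi>\<^sub>M i\<in>{..<n}. P). \<forall>i\<in>{..<n}. fst (D i) \<in> unit_cube"
    by (intro AE_finite_allI) auto
  then show ?thesis by eventually_elim simp
qed

text \<open>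
  Three comparisons lead from the risk to the empirical risk of the untruncated estimator: the
  response is truncated at \<open>L\<close>, which costs \<open>clip_error L\<close> in the risk and again in the empirical
  risk; the expected loss is replaced by the empirical loss, which costs \<open>gap\<close>; and the truncation
  of the estimator is removed, which only increases the loss because \<open>L \<le> \<beta>\<close>. The empirical risk
  is compared with that of a step function if at least \<open>K\<close> first splits see all features, and with
  that of the zero function otherwise.
\<close>

lemma fixed_seed_risk_bound:
  fixes spl :: "'p split_rule" and ls :: "'p ls_rule" and \<sigma> :: "nat \<Rightarrow> nat \<Rightarrow> 'p set"
    and c s :: "'q \<Rightarrow> real" and \<theta> :: "'q \<Rightarrow> real ^ 'p" and \<epsilon> r \<beta> L :: real
  assumes spl: "maximizing_split_rule spl" and ls: "least_squares_rule ls"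
    and meas: "measurable_boost spl ls t k n" and \<sigma>: "\<And>j \<tau>. \<sigma> j \<tau> \<noteq> {}"
    and t: "2 \<le> t" and n: "2 \<le> n" and L: "0 \<le> L" "L \<le> \<beta>"
    and \<epsilon>: "0 < \<epsilon>" and r: "0 < r" "exp r + exp (- (1 + \<epsilon>) * r) \<le> 2"
    and \<theta>: "\<And>q. q \<in> Q \<Longrightarrow> norm (\<theta> q) = 1" and K: "1 \<le> K"
  defines "risk \<equiv> \<lambda>D. \<integral>z. (clip \<beta> (boost_est spl ls t k n D \<sigma> (fst z)) - m (fst z))\<^sup>2 \<partial>P"
    and "fit \<equiv> (\<integral>z. (snd z - step_fun Q c \<theta> s (fst z))\<^sup>2 \<partial>P) + 4 * (\<Sum>q\<in>Q. \<bar>c q\<bar>)\<^sup>2 / real K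
        + (if card {j \<in> {1..k}. \<sigma> j 1 = UNIV} < K then \<integral>z. (snd z)\<^sup>2 \<partial>P else 0)"
    and "gap \<equiv> (\<beta> + L)\<^sup>2 * (real (((CARD('p) + 2) * (t - 1) + 2) * t * k) * ln (4 * real n
        + 3)) / (r * real n)"
  shows "(\<integral>\<^sup>+D. (\<integral>\<^sup>+z. ennreal ((clip \<beta> (boost_est spl ls t k n D \<sigma> (fst z))
      - m (fst z))\<^sup>2) \<partial>P) \<partial>(\<Pi>\<^sub>M i\<in>{..<n}. P))
     \<le> ennreal ((1 + \<epsilon>) * ((1 + \<epsilon>) * ((1 + \<epsilon>) * fit + (1 + 1 / \<epsilon>) * clip_error L) + gap)
         + (1 + 1 / \<epsilon>) * clip_error L - noise)"
proof -
  let ?Q = "\<Pi>\<^sub>M i\<in>{..<n}. P"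
  let ?f = "\<lambda>D. boost_est spl ls t k n D \<sigma>"
  let ?y2 = "\<integral>z. (snd z)\<^sup>2 \<partial>P"
  let ?h = "step_fun Q c \<theta> s"
  let ?V = "\<Sum>q\<in>Q. \<bar>c q\<bar>"
  let ?K' = "card {j \<in> {1..k}. \<sigma> j 1 = UNIV}"
  interpret Q: prob_space ?Q by (intro prob_space_PiM prob_space_axioms)
  have \<beta>: "0 \<le> \<beta>" using L by simp
  have sets_Q: "sets ?Q = sets (\<Pi>\<^sub>M i\<in>{..<n}. borel)" by (intro sets_PiM_cong) auto
  have "(\<lambda>(D, x). ?f D x) \<in> borel_measurable ((\<Pi>\<^sub>M i\<in>{..<n}. borel) \<Otimes>\<^sub>M borel)"
    using meas \<sigma> unfolding measurable_boost_def by blast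
  then have f_Q: "(\<lambda>(D, x). ?f D x) \<in> borel_measurable (?Q \<Otimes>\<^sub>M borel)"
    by (subst measurable_cong_sets[OF sets_pair_measure_cong[OF sets_Q refl] refl])
  have f_comp: "(\<lambda>w. ?f (A w) (B w)) \<in> borel_measurable N"
    if "A \<in> measurable N ?Q" "B \<in> measurable N borel" for A B and N :: "'n measure"
    using measurable_compose[OF measurable_Pair[OF that] f_Q] by simp
  have f_x: "?f D \<in> borel_measurable borel" if "D \<in> space ?Q" for D
    using f_comp[of "\<lambda>_. D" borel "\<lambda>x. x"] that by simp
  have f_pair: "(\<lambda>w. ?f (fst w) (fst (snd w))) \<in> borel_measurable (?Q \<Otimes>\<^sub>M P)"
    by (intro f_comp) measurable
  \<comment> \<open>The loss with truncated response is bounded, so that symmetrization applies to it.\<close>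
  define g where "g D z = (clip \<beta> (?f D (fst z)) - clip L (snd z))\<^sup>2" for D
      and z :: "(real ^ 'p) \<times> real"
  have g_le: "g D z \<le> (\<beta> + L)\<^sup>2" for D z
    unfolding g_def abs_le_square_iff[symmetric]
        using abs_clip_le[OF \<beta>, of "?f D (fst z)"] abs_clip_le[OF L(1), of "snd z"] by linarith
  have g_m: "(\<lambda>(D, z). g D z) \<in> borel_measurable (?Q \<Otimes>\<^sub>M P)"
    unfolding g_def case_prod_unfold using f_pair by measurable
  have g_int: "integrable P (g D)" if "D \<in> space ?Q" for D
  proof (rule integrable_const_bound[of _ "(\<beta> + L)\<^sup>2"])
    have [measurable]: "?f D \<in> borel_measurable borel" by (rule f_x[OF that])
    show "g D \<in> borel_measurable P" unfolding g_def by measurable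
    show "AE z in P. norm (g D z) \<le> (\<beta> + L)\<^sup>2" using g_le by (auto simp: g_def)
  qed
  have pt: "risk D \<le> (1 + \<epsilon>) * (\<integral>z. g D z \<partial>P) + (1 + 1 / \<epsilon>) * clip_error L - noise"
    if D: "D \<in> space ?Q" for D
  proof -
    have [measurable]: "?f D \<in> borel_measurable borel" by (rule f_x[OF D])
    define \<phi> where "\<phi> x = clip \<beta> (?f D x)" for x
    have [measurable]: "\<phi> \<in> borel_measurable borel" unfolding \<phi>_def by measurable
    have \<phi>2: "integrable P (\<lambda>z. (\<phi> (fst z))\<^sup>2)"
      unfolding \<phi>_def by (rule clip_square_integrable[OF _ \<beta>]) measurable
    note c2 = clip_error_integrable[OF L(1)]
    have "risk D + noise = (\<integral>z. (\<phi> (fst z) - snd z)\<^sup>2 \<partial>P)"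
      using risk_decomposition[OF _ \<phi>2] by (simp add: risk_def \<phi>_def)
    also have "\<dots> \<le> (\<integral>z. (1 + \<epsilon>) * g D z + (1 + 1 / \<epsilon>) * (clip L (snd z) - snd z)\<^sup>2 \<partial>P)"
    proof (rule integral_mono)
      show "integrable P (\<lambda>z. (\<phi> (fst z) - snd z)\<^sup>2)"
        using \<phi>2 response_sq by (intro integrable_sq_diff) auto
      show "(\<phi> (fst z) - snd z)\<^sup>2 \<le> (1 + \<epsilon>) * g D z + (1 + 1 / \<epsilon>) * (clip L (snd z) - snd z)\<^sup>2" for z
        unfolding g_def \<phi>_def by (rule sq_triangle[OF \<epsilon>])
    qed (use g_int[OF D] c2 in auto)
    also have "\<dots> = (1 + \<epsilon>) * (\<integral>z. g D z \<partial>P) + (1 + 1 / \<epsilon>) * clip_error L"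
      using g_int[OF D] c2 by (simp add: clip_error_def)
    finally show ?thesis by simp
  qed
  have gen: "(\<integral>D. (\<integral>z. g D z \<partial>P) \<partial>?Q) \<le> (1 + \<epsilon>) * (\<integral>D. (\<Sum>j<n. g D (D j)) / n \<partial>?Q) + gap"
  proof -
    let ?E = "((CARD('p) + 2) * (t - 1) + 2) * t * k"
    let ?S = "(4 * real n + 3) ^ ?E"
    have "(\<integral>D. (\<integral>z. g D z \<partial>P) \<partial>?Q)
       \<le> (1 + \<epsilon>) * (\<integral>D. (\<Sum>j<n. g D (D j)) / n \<partial>?Q) + (\<beta> + L)\<^sup>2 * ln ?S / (r * n)"
    proof (rule expected_risk_le_empirical_risk[OF prob_space_axioms g_m _ _ \<epsilon> r])
      show "0 \<le> g D z \<and> g D z \<le> (\<beta> + L)\<^sup>2" for D z using g_le by (simp add: g_def)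
      show "\<exists>F. finite F \<and> real (card F) \<le> ?S \<and>
           (\<forall>D. {q \<in> {..<n} \<times> (UNIV :: bool set). u < g D (w q)} \<in> F)" for w u
      proof -
        let ?P = "{..<n} \<times> (UNIV :: bool set)"
        let ?F = "range (\<lambda>D. {q \<in> ?P. u < (clip \<beta> (?f D (fst (w q))) - clip L (snd (w q)))\<^sup>2})"
        have P: "finite ?P" "card ?P = 2 * n" by (auto simp: card_cartesian_product)
        have t1: "1 \<le> t" using t by simp
        have "finite ?F" by (rule card_loss_patterns_le(1)[OF P(1) t1])
        moreover have "card ?F \<le> (2 * (2 * n) + 3) ^ ?E"
          using card_loss_patterns_le(2)[OF P(1) t1, of u \<beta> spl ls k n \<sigma> "\<lambda>q. fst (w q)"
              "\<lambda>q. clip L (snd (w q))"] P(2)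
          by simp
        then have "real (card ?F) \<le> real ((2 * (2 * n) + 3) ^ ?E)" by (simp only: of_nat_le_iff)
        then have "real (card ?F) \<le> ?S" by simp
        moreover have "\<forall>D. {q \<in> ?P. u < g D (w q)} \<in> ?F" unfolding g_def by blast
        ultimately show ?thesis by blast
      qed
    qed (use n in simp)
    then show ?thesis using n by (simp add: gap_def ln_realpow)
  qed
  have emp: "(\<integral>D. (\<Sum>j<n. g D (D j)) / n \<partial>?Q) \<le> (1 + \<epsilon>) * fit + (1 + 1 / \<epsilon>) * clip_error L"
  proof -
    define \<psi> where "\<psi> z = (snd z - ?h (fst z))\<^sup>2" for z :: "(real ^ 'p) \<times> real"
    define \<rho> where "\<rho> z = (clip L (snd z) - snd z)\<^sup>2" for z :: "(real ^ 'p) \<times> real"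
    have h2: "integrable P (\<lambda>z. (?h (fst z))\<^sup>2)" by (rule step_fun_square_integrable)
    have \<psi>: "integrable P \<psi>" unfolding \<psi>_def using h2 response_sq by (intro integrable_sq_diff) auto
    have \<rho>: "integrable P \<rho>" unfolding \<rho>_def by (rule clip_error_integrable[OF L(1)])
    have n0: "0 < n" using n by simp
    define a where "a D = (\<Sum>j<n. \<psi> (D j)) / n" for D
    define y where "y D = (if ?K' < K then (\<Sum>j<n. (snd (D j))\<^sup>2) / n else 0)"
      for D :: "nat \<Rightarrow> (real ^ 'p) \<times> real"
    define T where "T D = a D + 4 * ?V\<^sup>2 / K + y D" for D
    have a: "integrable ?Q a" "(\<integral>D. a D \<partial>?Q) = (\<integral>z. \<psi> z \<partial>P)"
      unfolding a_def by (rule sample_average[OF \<psi> n0])+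
    have y: "integrable ?Q y" "(\<integral>D. y D \<partial>?Q) = (if ?K' < K then ?y2 else 0)"
    proof -
      show "integrable ?Q y"
        unfolding y_def by (cases "?K' < K") (simp_all only: if_True if_False
            sample_average(1)[OF response_sq n0], simp)
      show "(\<integral>D. y D \<partial>?Q) = (if ?K' < K then ?y2 else 0)"
        unfolding y_def by (cases "?K' < K") (simp_all only: if_True if_False
            sample_average(2)[OF response_sq n0], simp)
    qed
    have T: "integrable ?Q T" "(\<integral>D. T D \<partial>?Q) = fit"
    proof -
      have "integrable ?Q (\<lambda>D. a D + 4 * ?V\<^sup>2 / K)" using a(1) by simp
      then show "integrable ?Q T" unfolding T_def using y(1)
          by (rule Bochner_Integration.integrable_add)
      have "(\<integral>D. T D \<partial>?Q) = (\<integral>D. a D + 4 * ?V\<^sup>2 / K \<partial>?Q) + (\<integral>D. y D \<partial>?Q)"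
        unfolding T_def using \<open>integrable ?Q (\<lambda>D. a D + 4 * ?V\<^sup>2 / K)\<close> y(1)
        by (rule Bochner_Integration.integral_add)
      also have "(\<integral>D. a D + 4 * ?V\<^sup>2 / K \<partial>?Q) = (\<integral>D. a D \<partial>?Q) + 4 * ?V\<^sup>2 / K"
        using a(1) by (simp add: Q.prob_space)
      finally show "(\<integral>D. T D \<partial>?Q) = fit" unfolding fit_def a(2) y(2) \<psi>_def .
    qed
    have "(\<integral>D. (\<Sum>j<n. g D (D j)) / n \<partial>?Q) \<le> (\<integral>D. (1 + \<epsilon>) * T D + (1
        + 1 / \<epsilon>) * ((\<Sum>j<n. \<rho> (D j)) / n) \<partial>?Q)"
    proof (rule integral_mono_AE)
      show "integrable ?Q (\<lambda>D. (\<Sum>j<n. g D (D j)) / n)"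
      proof (intro integrable_divide_zero Bochner_Integration.integrable_sum)
        fix j assume "j \<in> {..<n}"
        then have "(\<lambda>D. (D, D j)) \<in> measurable ?Q (?Q \<Otimes>\<^sub>M P)"
          by (intro measurable_Pair measurable_component_singleton) auto
        from measurable_compose[OF this g_m] show "integrable ?Q (\<lambda>D. g D (D j))"
          by (intro Q.integrable_const_bound[of _ "(\<beta> + L)\<^sup>2"]) (use g_le in \<open>auto simp: g_def\<close>)
      qed
      show "integrable ?Q (\<lambda>D. (1 + \<epsilon>) * T D + (1 + 1 / \<epsilon>) * ((\<Sum>j<n. \<rho> (D j)) / n))"
        using T(1) sample_average(1)[OF \<rho> n0]
            by (intro Bochner_Integration.integrable_add Bochner_Integration.integrable_mult_right)
      show "AE D in ?Q. (\<Sum>j<n. g D (D j)) / n \<le> (1 + \<epsilon>) * T D + (1 + 1 / \<epsilon>) * ((\<Sum>j<n. \<rho> (D j)) / n)"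
        using sample_in_cube
      proof eventually_elim
        case (elim D)
        let ?E = "boost_sse spl ls t n D \<sigma> k"
        have E_eq: "?E = (\<Sum>j<n. (?f D (fst (D j)) - snd (D j))\<^sup>2)"
          by (simp add: fit_sse_def boost_est_def Let_def power2_commute)
        have E: "?E / n \<le> T D"
          unfolding T_def a_def y_def \<psi>_def
          using elim by (intro boost_sse_average_le[OF spl ls t n K \<theta>]) auto
        have "(\<Sum>j<n. g D (D j)) \<le> (\<Sum>j<n. (1 + \<epsilon>) * (?f D (fst (D j)) - snd (D j))\<^sup>2 + (1
            + 1 / \<epsilon>) * \<rho> (D j))"
        proof (intro sum_mono)
          fix j
          have "g D (D j) \<le> (?f D (fst (D j)) - clip L (snd (D j)))\<^sup>2"
            unfolding g_def using abs_clip_le[OF L(1), of "snd (D j)"] L by (intro clip_dist_le) auto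
          also have "\<dots> \<le> (1 + \<epsilon>) * (?f D (fst (D j)) - snd (D j))\<^sup>2 + (1 + 1 / \<epsilon>) * (snd (D j)
              - clip L (snd (D j)))\<^sup>2"
            by (rule sq_triangle[OF \<epsilon>])
          finally show "g D (D j) \<le> (1 + \<epsilon>) * (?f D (fst (D j)) - snd (D j))\<^sup>2 + (1 + 1 / \<epsilon>) * \<rho> (D j)"
            by (simp add: \<rho>_def power2_commute)
        qed
        also have "\<dots> = (1 + \<epsilon>) * ?E + (1 + 1 / \<epsilon>) * (\<Sum>j<n. \<rho> (D j))"
          by (simp only: sum.distrib sum_distrib_left[symmetric] E_eq)
        finally have "(\<Sum>j<n. g D (D j)) / n \<le> ((1 + \<epsilon>) * ?E + (1 + 1 / \<epsilon>) * (\<Sum>j<n. \<rho> (D j))) / n"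
          by (rule divide_right_mono) simp
        also have "\<dots> = (1 + \<epsilon>) * (?E / n) + (1 + 1 / \<epsilon>) * ((\<Sum>j<n. \<rho> (D j)) / n)"
          by (simp add: add_divide_distrib)
        also have "\<dots> \<le> (1 + \<epsilon>) * T D + (1 + 1 / \<epsilon>) * ((\<Sum>j<n. \<rho> (D j)) / n)"
          using E \<epsilon> by (intro add_right_mono mult_left_mono) auto
        finally show ?case .
      qed
    qed
    also have "\<dots> = (1 + \<epsilon>) * fit + (1 + 1 / \<epsilon>) * clip_error L"
    proof -
      have "(\<integral>D. (1 + \<epsilon>) * T D + (1 + 1 / \<epsilon>) * ((\<Sum>j<n. \<rho> (D j)) / n) \<partial>?Q)
          = (\<integral>D. (1 + \<epsilon>) * T D \<partial>?Q) + (\<integral>D. (1 + 1 / \<epsilon>) * ((\<Sum>j<n. \<rho> (D j)) / n) \<partial>?Q)"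
        using T(1) sample_average(1)[OF \<rho> n0]
        by (intro Bochner_Integration.integral_add Bochner_Integration.integrable_mult_right)
      moreover have "clip_error L = (\<integral>z. \<rho> z \<partial>P)" by (simp add: clip_error_def \<rho>_def)
      ultimately show ?thesis
        by (simp only: integral_mult_right_zero T(2) sample_average(2)[OF \<rho> n0])
    qed
    finally show ?thesis .
  qed
  define G where "G D = (\<integral>z. g D z \<partial>P)" for D
  have G_m: "G \<in> borel_measurable ?Q"
    unfolding G_def using borel_measurable_lebesgue_integral[of "\<lambda>D z. g D z" ?Q] g_m by simp
  have G_int: "integrable ?Q G"
  proof (rule Q.integrable_const_bound[of _ "(\<beta> + L)\<^sup>2"])
    show "AE D in ?Q. norm (G D) \<le> (\<beta> + L)\<^sup>2"
    proof (intro AE_I2)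
      fix D assume D: "D \<in> space ?Q"
      have "0 \<le> G D" unfolding G_def by (intro Bochner_Integration.integral_nonneg) (simp add: g_def)
      moreover have "G D \<le> (\<integral>z. (\<beta> + L)\<^sup>2 \<partial>P)" unfolding G_def
        using g_int[OF D] g_le by (intro integral_mono) auto
      ultimately show "norm (G D) \<le> (\<beta> + L)\<^sup>2" using prob_space by simp
    qed
  qed (rule G_m)
  define b where "b D = (1 + \<epsilon>) * G D + ((1 + 1 / \<epsilon>) * clip_error L - noise)" for D
  have b_int: "integrable ?Q b" unfolding b_def using G_int by auto
  have risk_nn: "(\<integral>\<^sup>+z. ennreal ((clip \<beta> (?f D (fst z)) - m (fst z))\<^sup>2) \<partial>P) = ennreal (risk D)"
      "0 \<le> risk D"
    if D: "D \<in> space ?Q" for D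
  proof -
    have [measurable]: "?f D \<in> borel_measurable borel" by (rule f_x[OF D])
    have "integrable P (\<lambda>z. (clip \<beta> (?f D (fst z)))\<^sup>2)"
      by (rule clip_square_integrable[OF _ \<beta>]) measurable
    then have "integrable P (\<lambda>z. (clip \<beta> (?f D (fst z)) - m (fst z))\<^sup>2)"
      using m_sq by (intro integrable_sq_diff) auto
    then show "(\<integral>\<^sup>+z. ennreal ((clip \<beta> (?f D (fst z)) - m (fst z))\<^sup>2) \<partial>P) = ennreal (risk D)"
      unfolding risk_def by (intro nn_integral_eq_integral) auto
    show "0 \<le> risk D" unfolding risk_def by (intro Bochner_Integration.integral_nonneg) simp
  qed
  have b_ge: "risk D \<le> b D" if "D \<in> space ?Q" for D
    using pt[OF that] by (simp add: b_def G_def)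
  have "(\<integral>\<^sup>+D. (\<integral>\<^sup>+z. ennreal ((clip \<beta> (?f D (fst z)) - m (fst z))\<^sup>2) \<partial>P) \<partial>?Q)
      \<le> (\<integral>\<^sup>+D. ennreal (b D) \<partial>?Q)"
    using risk_nn(1) b_ge by (intro nn_integral_mono) (simp add: ennreal_leI)
  also have "\<dots> = ennreal (\<integral>D. b D \<partial>?Q)"
    using risk_nn(2) b_ge by (intro nn_integral_eq_integral b_int AE_I2) (meson order_trans)
  also have "(\<integral>D. b D \<partial>?Q) = (1 + \<epsilon>) * (\<integral>D. G D \<partial>?Q) + ((1 + 1 / \<epsilon>) * clip_error L - noise)"
    unfolding b_def using G_int by (simp add: Q.prob_space)
  also have "\<dots> \<le> (1 + \<epsilon>) * ((1 + \<epsilon>) * ((1 + \<epsilon>) * fit + (1 + 1 / \<epsilon>) * clip_error L) + gap)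
         + (1 + 1 / \<epsilon>) * clip_error L - noise"
  proof -
    have "(\<integral>D. G D \<partial>?Q) \<le> (1 + \<epsilon>) * ((1 + \<epsilon>) * fit + (1 + 1 / \<epsilon>) * clip_error L) + gap"
      using gen mult_left_mono[OF emp, of "1 + \<epsilon>"] \<epsilon> unfolding G_def by linarith
    from mult_left_mono[OF this, of "1 + \<epsilon>"] \<epsilon> show ?thesis by simp
  qed
  finally show ?thesis by (simp add: ennreal_leI)
qed

end

section \<open>Averaging over the seeds\<close>

text \<open>
  The law of \<open>U\<close> under the measure restricted to an independent event is a multiple of its law.
\<close>

lemma nn_integral_indep_event:
  assumes M: "prob_space M" and ind: "indep_rvs M N1 U N2 V" and v: "{v} \<in> sets N2"
    and f: "f \<in> borel_measurable N1"
  shows "(\<integral>\<^sup>+\<omega>. indicator {\<omega>\<in>space M. V \<omega> = v} \<omega> * f (U \<omega>) \<partial>M)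
     = emeasure M {\<omega>\<in>space M. V \<omega> = v} * (\<integral>\<^sup>+u. f u \<partial>distr M N1 U)"
proof -
  interpret prob_space M by fact
  let ?E = "{\<omega>\<in>space M. V \<omega> = v}"
  have U [measurable]: "U \<in> measurable M N1" and V: "V \<in> measurable M N2"
    using ind by (auto simp: indep_rvs_def)
  have E_eq: "?E = V -` {v} \<inter> space M" by auto
  have E [measurable]: "?E \<in> sets M" unfolding E_eq using V v by (rule measurable_sets)
  let ?D = "density M (indicator ?E)"
  have UD: "U \<in> measurable ?D N1" by simp
  have "distr ?D N1 U = scale_measure (emeasure M ?E) (distr M N1 U)"
  proof (rule measure_eqI)
    fix A assume "A \<in> sets (distr ?D N1 U)"
    then have A [measurable]: "A \<in> sets N1" by simp
    have UA: "U -` A \<inter> space M \<in> sets M" by simp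
    have "emeasure (distr ?D N1 U) A = emeasure ?D (U -` A \<inter> space M)"
      by (subst emeasure_distr[OF UD A]) simp
    also have "\<dots> = (\<integral>\<^sup>+\<omega>. indicator ?E \<omega> * indicator (U -` A \<inter> space M) \<omega> \<partial>M)"
      by (rule emeasure_density) auto
    also have "\<dots> = emeasure M ((U -` A \<inter> space M) \<inter> ?E)"
    proof -
      have "indicator ?E \<omega> * indicator (U -` A \<inter> space M) \<omega>
          = (indicator ((U -` A \<inter> space M) \<inter> ?E) \<omega> :: ennreal)" for \<omega>
        by (auto simp: indicator_def)
      then show ?thesis using UA E by (simp only: nn_integral_indicator sets.Int)
    qed
    also have "\<dots> = ennreal (prob (U -` A \<inter> space M) * prob ?E)"
    proof -
      have "U -` A \<inter> space M \<in> sigma_sets (space M) {U -` A \<inter> space M | A. A \<in> sets N1}"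
        using A by (intro sigma_sets.Basic) auto
      moreover have "?E \<in> sigma_sets (space M) {V -` A \<inter> space M | A. A \<in> sets N2}"
        unfolding E_eq using v by (intro sigma_sets.Basic) auto
      moreover have "indep_set (sigma_sets (space M) {U -` A \<inter> space M | A. A \<in> sets N1})
          (sigma_sets (space M) {V -` A \<inter> space M | A. A \<in> sets N2})"
        using ind by (simp add: indep_rvs_def)
      ultimately have "prob ((U -` A \<inter> space M) \<inter> ?E) = prob (U -` A \<inter> space M) * prob ?E"
        by (intro indep_setD)
      then show ?thesis by (simp only: emeasure_eq_measure)
    qed
    also have "\<dots> = emeasure M ?E * emeasure (distr M N1 U) A"
      by (subst emeasure_distr[OF U A]) (simp add: emeasure_eq_measure ennreal_mult[symmetric]
          mult.commute)
    finally show "emeasure (distr ?D N1 U) A = emeasure (scale_measure (emeasure M ?E) (distr M N1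
        U)) A"
      by simp
  qed simp
  then have "(\<integral>\<^sup>+u. f u \<partial>distr ?D N1 U) = emeasure M ?E * (\<integral>\<^sup>+u. f u \<partial>distr M N1 U)"
    using f by (simp add: nn_integral_scale_measure)
  moreover have "(\<integral>\<^sup>+u. f u \<partial>distr ?D N1 U) = (\<integral>\<^sup>+\<omega>. f (U \<omega>) \<partial>?D)"
    by (rule nn_integral_distr[OF UD]) (use f in simp)
  moreover have "\<dots> = (\<integral>\<^sup>+\<omega>. indicator ?E \<omega> * f (U \<omega>) \<partial>M)"
    using f by (intro nn_integral_density) auto
  ultimately show ?thesis by simp
qed

text \<open>
  Conditioning on an independent variable with finitely many values: a bound that holds for each
  fixed value holds on average.
\<close>

lemma nn_integral_indep_finite_le:
  assumes M: "prob_space M" and ind: "indep_rvs M N1 U N2 V"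
    and S: "finite S" "AE \<omega> in M. V \<omega> \<in> S" "\<And>v. v \<in> S \<Longrightarrow> {v} \<in> sets N2"
    and f: "\<And>v. v \<in> S \<Longrightarrow> f v \<in> borel_measurable N1"
    and h: "\<And>v. v \<in> S \<Longrightarrow> (\<integral>\<^sup>+u. f v u \<partial>distr M N1 U) \<le> h v"
  shows "(\<integral>\<^sup>+\<omega>. f (V \<omega>) (U \<omega>) \<partial>M) \<le> (\<integral>\<^sup>+\<omega>. h (V \<omega>) \<partial>M)"
proof -
  let ?E = "\<lambda>v. {\<omega>\<in>space M. V \<omega> = v}"
  have U [measurable]: "U \<in> measurable M N1" and V: "V \<in> measurable M N2"
    using ind by (auto simp: indep_rvs_def)
  have E [measurable]: "?E v \<in> sets M" if "v \<in> S" for v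
  proof -
    have "?E v = V -` {v} \<inter> space M" by auto
    then show ?thesis using measurable_sets[OF V S(3)[OF that]] by simp
  qed
  have sel: "(\<Sum>v\<in>S. indicator (?E v) \<omega> * F v) = F (V \<omega>)" if "\<omega> \<in> space M" "V \<omega> \<in> S"
    for F :: "'c \<Rightarrow> ennreal" and \<omega>
  proof -
    have "(\<Sum>v\<in>S. indicator (?E v) \<omega> * F v) = (\<Sum>v\<in>S. if v = V \<omega> then F v else 0)"
      using that(1) by (intro sum.cong refl) (auto simp: indicator_def)
    then show ?thesis using S(1) that(2) by simp
  qed
  have "(\<integral>\<^sup>+\<omega>. f (V \<omega>) (U \<omega>) \<partial>M) = (\<integral>\<^sup>+\<omega>. (\<Sum>v\<in>S. indicator (?E v) \<omega> * f v (U \<omega>)) \<partial>M)"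
  proof (rule nn_integral_cong_AE)
    show "AE \<omega> in M. f (V \<omega>) (U \<omega>) = (\<Sum>v\<in>S. indicator (?E v) \<omega> * f v (U \<omega>))"
      using S(2) AE_space by eventually_elim (simp add: sel)
  qed
  also have "\<dots> = (\<Sum>v\<in>S. \<integral>\<^sup>+\<omega>. indicator (?E v) \<omega> * f v (U \<omega>) \<partial>M)"
  proof (rule nn_integral_sum)
    fix v assume v: "v \<in> S"
    have "(\<lambda>\<omega>. f v (U \<omega>)) \<in> borel_measurable M" using U f[OF v] by (rule measurable_compose)
    then show "(\<lambda>\<omega>. indicator (?E v) \<omega> * f v (U \<omega>)) \<in> borel_measurable M"
      using E[OF v] by (intro borel_measurable_times_ennreal borel_measurable_indicator)
  qed
  also have "\<dots> = (\<Sum>v\<in>S. emeasure M (?E v) * (\<integral>\<^sup>+u. f v u \<partial>distr M N1 U))"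
    using S f by (intro sum.cong refl nn_integral_indep_event[OF M ind])
  also have "\<dots> \<le> (\<Sum>v\<in>S. emeasure M (?E v) * h v)"
    using h by (intro sum_mono mult_left_mono) auto
  also have "\<dots> = (\<Sum>v\<in>S. \<integral>\<^sup>+\<omega>. h v * indicator (?E v) \<omega> \<partial>M)"
    using E by (intro sum.cong refl) (simp add: nn_integral_cmult_indicator mult.commute)
  also have "\<dots> = (\<integral>\<^sup>+\<omega>. (\<Sum>v\<in>S. h v * indicator (?E v) \<omega>) \<partial>M)"
    using E by (intro nn_integral_sum[symmetric]) auto
  also have "\<dots> = (\<integral>\<^sup>+\<omega>. h (V \<omega>) \<partial>M)"
  proof (rule nn_integral_cong_AE)
    show "AE \<omega> in M. (\<Sum>v\<in>S. h v * indicator (?E v) \<omega>) = h (V \<omega>)"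
      using S(2) AE_space by eventually_elim (simp only: mult.commute[of "h _"] sel)
  qed
  finally show ?thesis .
qed

text \<open>
  The size of the feature set is uniform on \<open>{1..p}\<close>, and all sets of one size have the same
  weight.
\<close>

lemma sum_seed_prob: "(\<Sum>S\<in>{S :: 'p::finite set. S \<noteq> {}}. seed_prob S) = 1"
proof -
  let ?p = "CARD('p)"
  have c: "card {S :: 'p set. card S = q} = ?p choose q" for q
    using n_subsets[of "UNIV :: 'p set" q] by simp
  have "(\<Sum>S\<in>{S :: 'p set. S \<noteq> {}}. seed_prob S) = (\<Sum>q\<in>{1..?p}. \<Sum>S\<in>{S \<in> {S :: 'p set. S \<noteq> {}}. card S
      = q}. seed_prob S)"
    by (rule sum.group[symmetric]) (auto simp: Suc_le_eq card_gt_0_iff card_mono)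
  also have "\<dots> = (\<Sum>q\<in>{1..?p}. 1 / ?p)"
  proof (intro sum.cong refl)
    fix q assume q: "q \<in> {1..?p}"
    then have e: "{S \<in> {S :: 'p set. S \<noteq> {}}. card S = q} = {S. card S = q}" by auto
    have "0 < ?p choose q" using q by (simp add: zero_less_binomial)
    then show "(\<Sum>S\<in>{S \<in> {S :: 'p set. S \<noteq> {}}. card S = q}. seed_prob S) = 1 / ?p"
      unfolding e using c[of q] by (simp add: seed_prob_def)
  qed
  also have "\<dots> = 1" by simp
  finally show ?thesis .
qed

text \<open>
  The probabilities of the nonempty sets already add up to 1.
\<close>

lemma seed_nonempty_AE:
  fixes Z :: "'w \<Rightarrow> 'p::finite set"
  assumes M: "prob_space M" and Z: "Z \<in> measurable M (count_space UNIV)"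
    and p: "\<And>S. S \<noteq> {} \<Longrightarrow> measure M {\<omega> \<in> space M. Z \<omega> = S} = seed_prob S"
  shows "AE \<omega> in M. Z \<omega> \<noteq> {}"
proof -
  interpret prob_space M by fact
  have ev: "{\<omega> \<in> space M. Z \<omega> = S} \<in> events" for S
    using measurable_sets[OF Z, of "{S}"] by (simp add: vimage_def Int_def conj_commute)
  have "prob {\<omega>\<in>space M. Z \<omega> \<noteq> {}} = prob (\<Union>S\<in>{S. S \<noteq> {}}. {\<omega> \<in> space M. Z \<omega> = S})"
    by (intro arg_cong[where f=prob]) auto
  also have "\<dots> = (\<Sum>S\<in>{S. S \<noteq> {}}. prob {\<omega> \<in> space M. Z \<omega> = S})"
    using ev by (intro finite_measure_finite_Union) (auto simp: disjoint_family_on_def)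
  also have "\<dots> = 1" using p sum_seed_prob by simp
  finally have "prob {\<omega>\<in>space M. Z \<omega> \<noteq> {}} = 1" .
  moreover have "{\<omega>\<in>space M. Z \<omega> \<noteq> {}} \<in> events"
    using measurable_sets[OF Z, of "- {{}}"] by (simp add: vimage_def Int_def conj_commute)
  ultimately show ?thesis by (simp add: prob_Collect_eq_1)
qed

text \<open>
  The Laplace transform of the number of seeds that contain all features. It yields the tail bound
  \<open>P (count < K) \<le> 2 ^ K * E (1 / 2) ^ count\<close>.
\<close>

lemma expectation_half_power:
  fixes Z :: "'i \<Rightarrow> 'w \<Rightarrow> 'p::finite set"
  assumes M: "prob_space M" and I: "finite I"
    and Z: "prob_space.indep_vars M (\<lambda>_. count_space UNIV) Z I"
    and p: "\<And>i S. i \<in> I \<Longrightarrow> S \<noteq> {} \<Longrightarrow> measure M {\<omega> \<in> space M. Z i \<omega> = S} = seed_prob S"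
  shows "(\<integral>\<omega>. (1 / 2 :: real) ^ card {i \<in> I. Z i \<omega> = UNIV} \<partial>M) = (1 - 1 / (2 * real CARD('p))) ^ card I"
    and "integrable M (\<lambda>\<omega>. (1 / 2 :: real) ^ card {i \<in> I. Z i \<omega> = UNIV})"
proof -
  interpret prob_space M by fact
  define q where "q S = (if S = (UNIV :: 'p set) then 1 / 2 else 1 :: real)" for S
  have prod: "(1 / 2 :: real) ^ card {i \<in> I. Z i \<omega> = UNIV} = (\<Prod>i\<in>I. q (Z i \<omega>))" for \<omega>
    using I by (simp add: q_def prod.If_cases Int_def)
  have ind: "indep_vars (\<lambda>_. borel) (\<lambda>i \<omega>. q (Z i \<omega>)) I"
    by (rule indep_vars_compose2[OF Z]) simp
  have Zm: "Z i \<in> measurable M (count_space UNIV)" if "i \<in> I" for i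
    using Z that by (auto simp: indep_vars_def)
  have qm: "(\<lambda>\<omega>. q (Z i \<omega>)) \<in> borel_measurable M" if "i \<in> I" for i
    using measurable_compose[OF Zm[OF that], of q borel] by simp
  have int: "integrable M (\<lambda>\<omega>. q (Z i \<omega>))" if "i \<in> I" for i
    by (rule integrable_const_bound[of _ 1]) (use qm[OF that] in \<open>auto simp: q_def\<close>)
  have ex: "(\<integral>\<omega>. q (Z i \<omega>) \<partial>M) = 1 - 1 / (2 * real CARD('p))" if "i \<in> I" for i
  proof -
    let ?E = "{\<omega> \<in> space M. Z i \<omega> = UNIV}"
    have E: "?E \<in> events"
      using measurable_sets[OF Zm[OF that], of "{UNIV}"] by (simp add: vimage_def Int_def conj_commute)
    have "(\<integral>\<omega>. q (Z i \<omega>) \<partial>M) = (\<integral>\<omega>. 1 - 1 / 2 * indicator ?E \<omega> \<partial>M)"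
      by (intro Bochner_Integration.integral_cong refl) (auto simp: q_def indicator_def)
    also have "\<dots> = 1 - 1 / 2 * prob ?E"
      using E by (subst Bochner_Integration.integral_diff) (auto simp: prob_space less_top[symmetric])
    also have "prob ?E = 1 / real CARD('p)"
      using p[OF that, of UNIV] by (simp add: seed_prob_def)
    finally show ?thesis by simp
  qed
  show "(\<integral>\<omega>. (1 / 2 :: real) ^ card {i \<in> I. Z i \<omega> = UNIV} \<partial>M) = (1 - 1 / (2 * real CARD('p))) ^ card I"
    unfolding prod using indep_vars_lebesgue_integral[OF I ind int] ex by simp
  show "integrable M (\<lambda>\<omega>. (1 / 2 :: real) ^ card {i \<in> I. Z i \<omega> = UNIV})"
    unfolding prod by (rule indep_vars_integrable[OF I ind int])
qed

lemma square_mean_diff_le: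
  fixes a :: "nat \<Rightarrow> real"
  assumes "1 \<le> B"
  shows "(1 / real B * (\<Sum>b = 1..B. a b) - m)\<^sup>2 \<le> (\<Sum>b = 1..B. 1 / real B * (a b - m)\<^sup>2)"
proof -
  have "1 / real B * (\<Sum>b = 1..B. a b) - m = (\<Sum>b = 1..B. a b - m) / B"
    using assms by (simp add: sum_subtractf field_simps)
  then have "(1 / real B * (\<Sum>b = 1..B. a b) - m)\<^sup>2 = (\<Sum>b = 1..B. a b - m)\<^sup>2 / (real B)\<^sup>2"
    by (simp add: power_divide)
  also have "\<dots> \<le> ((\<Sum>b = 1..B. (a b - m)\<^sup>2) * real (card {1..B})) / (real B)\<^sup>2"
    by (intro divide_right_mono sum_squared_le_sum_of_squares) simp
  also have "\<dots> = (\<Sum>b = 1..B. 1 / real B * (a b - m)\<^sup>2)"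
    using assms by (simp add: power2_eq_square sum_divide_distrib)
  finally show ?thesis .
qed

lemma ennreal_add_le: "0 \<le> b \<Longrightarrow> ennreal (a + b) \<le> ennreal a + ennreal b"
  by (cases "0 \<le> a") (simp_all add: ennreal_neg ennreal_leI)

text \<open>
  The bound for fixed seeds, averaged over the seeds and over the members of the ensemble. The
  last term accounts for the event that fewer than \<open>K\<close> first splits of a member see all features.
\<close>

lemma (in regression_law) ensemble_risk_bound:
  fixes M :: "'w measure" and U :: "'w \<Rightarrow> nat \<Rightarrow> (real ^ 'p) \<times> real"
    and seed :: "nat \<times> nat \<times> nat \<Rightarrow> 'w \<Rightarrow> 'p set"
    and spl :: "'p split_rule" and ls :: "'p ls_rule"
    and c s :: "'q \<Rightarrow> real" and \<theta> :: "'q \<Rightarrow> real ^ 'p" and \<epsilon> r \<beta> L :: real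
  assumes M: "prob_space M"
    and law: "distr M (\<Pi>\<^sub>M i\<in>{..<n}. borel) U = (\<Pi>\<^sub>M i\<in>{..<n}. P)"
    and seeds: "prob_space.indep_vars M (\<lambda>_. count_space UNIV) seed (seed_index B k t)"
    and seed_law: "\<And>\<iota> S. \<iota> \<in> seed_index B k t \<Longrightarrow> S \<noteq> {} \<Longrightarrow>
           measure M {\<omega> \<in> space M. seed \<iota> \<omega> = S} = seed_prob S"
    and ind: "indep_rvs M (\<Pi>\<^sub>M i\<in>{..<n}. borel) U
           (\<Pi>\<^sub>M \<iota>\<in>seed_index B k t. count_space UNIV) (\<lambda>\<omega>. \<lambda>\<iota>\<in>seed_index B k t. seed \<iota> \<omega>)"
    and spl: "maximizing_split_rule spl" and ls: "least_squares_rule ls"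
    and meas: "measurable_boost spl ls t k n"
    and t: "2 \<le> t" and B: "1 \<le> B" and n: "2 \<le> n" and L: "0 \<le> L" "L \<le> \<beta>"
    and \<epsilon>: "0 < \<epsilon>" and r: "0 < r" "exp r + exp (- (1 + \<epsilon>) * r) \<le> 2"
    and \<theta>: "\<And>q. q \<in> Q \<Longrightarrow> norm (\<theta> q) = 1" and K: "1 \<le> K"
  defines "fit \<equiv> (\<integral>z. (snd z - step_fun Q c \<theta> s (fst z))\<^sup>2 \<partial>P) + 4 * (\<Sum>q\<in>Q. \<bar>c q\<bar>)\<^sup>2 / real K"
    and "gap \<equiv> (\<beta> + L)\<^sup>2 * (real (((CARD('p) + 2) * (t - 1) + 2) * t * k) * ln (4 * real n
        + 3)) / (r * real n)"
  shows "(\<integral>\<^sup>+\<omega>. (\<integral>\<^sup>+x. ennreal (\<bar>ens_est spl ls t B k \<beta> n (U \<omega>) (\<lambda>\<iota>. seed \<iota> \<omega>) x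
      - m x\<bar>\<^sup>2) \<partial>distr P borel fst) \<partial>M)
     \<le> ennreal ((1 + \<epsilon>) * ((1 + \<epsilon>) * ((1 + \<epsilon>) * fit + (1 + 1 / \<epsilon>) * clip_error L) + gap)
         + (1 + 1 / \<epsilon>) * clip_error L - noise)
       + ennreal ((1 + \<epsilon>) ^ 3 * (\<integral>z. (snd z)\<^sup>2 \<partial>P) * 2 ^ K * (1 - 1 / (2 * real CARD('p))) ^ k)"
    (is "_ \<le> ennreal ?C1 + ennreal (?C2 * 2 ^ K * ?\<gamma> ^ k)")
proof -
  interpret M: prob_space M by fact
  let ?I = "seed_index B k t"
  let ?N1 = "\<Pi>\<^sub>M i\<in>{..<n}. borel :: ((real ^ 'p) \<times> real) measure"
  let ?N2 = "\<Pi>\<^sub>M \<iota>\<in>?I. count_space UNIV :: 'p set measure"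
  let ?Q = "\<Pi>\<^sub>M i\<in>{..<n}. P"
  define V where "V \<omega> = (\<lambda>\<iota>\<in>?I. seed \<iota> \<omega>)" for \<omega>
  define S where "S = (\<Pi>\<^sub>E \<iota>\<in>?I. {T :: 'p set. T \<noteq> {}})"
  define ext where "ext b v = (\<lambda>j \<tau>. if (b, j, \<tau>) \<in> ?I then v (b, j, \<tau>) else UNIV)"
    for b and v :: "nat \<times> nat \<times> nat \<Rightarrow> 'p set"
  define loss where "loss b v D z = (clip \<beta> (boost_est spl ls t k n D (ext b v) (fst z)) - m (fst z))\<^sup>2"
    for b v D and z :: "(real ^ 'p) \<times> real"
  define f where "f v D = (\<Sum>b = 1..B. ennreal (1 / real B) * (\<integral>\<^sup>+z. ennreal (loss b v D z) \<partial>P))" for v D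
  define J where "J b = (\<lambda>j. (b, j, 1 :: nat)) ` {1..k}" for b :: nat
  let ?ens = "\<lambda>\<omega>. ens_est spl ls t B k \<beta> n (U \<omega>) (\<lambda>\<iota>. seed \<iota> \<omega>)"
  let ?cnt = "\<lambda>b \<omega>. card {\<iota> \<in> J b. seed \<iota> \<omega> = UNIV}"
  define few where "few b v = (card {j \<in> {1..k}. ext b v j 1 = UNIV} < K)" for b v
  define h where "h v = (\<Sum>b = 1..B. ennreal (1 / real B) * ennreal (?C1
      + (if few b v then ?C2 else 0)))" for v
  have y2: "0 \<le> (\<integral>z. (snd z)\<^sup>2 \<partial>P)" by (intro Bochner_Integration.integral_nonneg) simp
  have C2: "0 \<le> ?C2" using y2 \<epsilon> by simp
  have finI: "finite ?I" by (simp add: seed_index_def)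
  have J: "J b \<subseteq> ?I" "card (J b) = k" "finite (J b)" if "b \<in> {1..B}" for b
    using that t by (auto simp: J_def seed_index_def card_image inj_on_def)
  define tail where "tail b \<omega> = ?C2 * 2 ^ K * (1 / 2) ^ ?cnt b \<omega>" for b \<omega>
  have tail0: "0 \<le> tail b \<omega>" for b \<omega> using C2 by (simp add: tail_def)
  have tail: "integrable M (tail b)" "(\<integral>\<omega>. tail b \<omega> \<partial>M) = ?C2 * 2 ^ K * ?\<gamma> ^ k" if b: "b \<in> {1..B}" for b
  proof -
    have indJ: "M.indep_vars (\<lambda>_. count_space UNIV) seed (J b)"
      using seeds J(1)[OF b] by (rule M.indep_vars_subset)
    have p: "measure M {\<omega> \<in> space M. seed \<iota> \<omega> = T} = seed_prob T" if "\<iota> \<in> J b" "T \<noteq> {}" for \<iota> T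
      using seed_law that J(1)[OF b] by blast
    note e = expectation_half_power[OF M J(3)[OF b] indJ p]
    show "integrable M (tail b)"
      unfolding tail_def by (intro Bochner_Integration.integrable_mult_right e(2))
    show "(\<integral>\<omega>. tail b \<omega> \<partial>M) = ?C2 * 2 ^ K * ?\<gamma> ^ k"
      unfolding tail_def by (subst integral_mult_right_zero) (simp add: e(1) J(2)[OF b])
  qed
  have nonempty: "ext b v j \<tau> \<noteq> {}" if "v \<in> S" for b v j \<tau>
    using that by (auto simp: S_def ext_def)
  have seed_m: "seed \<iota> \<in> measurable M (count_space UNIV)" if "\<iota> \<in> ?I" for \<iota>
    using seeds that by (auto simp: M.indep_vars_def)
  have V_S: "AE \<omega> in M. V \<omega> \<in> S"
  proof -
    have "AE \<omega> in M. \<forall>\<iota>\<in>?I. seed \<iota> \<omega> \<noteq> {}"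
      using finI seed_nonempty_AE[OF M seed_m seed_law] by (intro AE_finite_allI) auto
    then show ?thesis by eventually_elim (auto simp: V_def S_def)
  qed
  have finS: "finite S" unfolding S_def by (intro finite_PiE finI) auto
  have single: "{v} \<in> sets ?N2" if "v \<in> S" for v
  proof -
    have v: "v \<in> extensional ?I" using that by (auto simp: S_def PiE_def)
    have "(\<Pi>\<^sub>E \<iota>\<in>?I. {v \<iota>}) \<in> sets ?N2" by (intro sets_PiM_I_finite finI) auto
    moreover have "(\<Pi>\<^sub>E \<iota>\<in>?I. {v \<iota>}) = {v}" using v by (rule PiE_singleton)
    ultimately show ?thesis by simp
  qed
  have sets_Q: "sets ?Q = sets ?N1" by (intro sets_PiM_cong) auto
  have boost_m: "(\<lambda>(D, x). boost_est spl ls t k n D (ext b v) x) \<in> borel_measurable (?N1 \<Otimes>\<^sub>M borel)"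
      if "v \<in> S" for b v
    using meas nonempty[OF that] unfolding measurable_boost_def by blast
  have loss_m: "(\<lambda>(D, z). loss b v D z) \<in> borel_measurable (?N1 \<Otimes>\<^sub>M P)" if "v \<in> S" for b v
  proof -
    have "(\<lambda>w. (fst w, fst (snd w))) \<in> measurable (?N1 \<Otimes>\<^sub>M P) (?N1 \<Otimes>\<^sub>M borel)" by measurable
    from measurable_compose[OF this boost_m[OF that]]
    have [measurable]: "(\<lambda>w. boost_est spl ls t k n (fst w) (ext b v) (fst (snd w))) \<in>
        borel_measurable (?N1 \<Otimes>\<^sub>M P)"
      by simp
    show ?thesis unfolding loss_def case_prod_unfold by measurable
  qed
  have risk_m: "(\<lambda>D. \<integral>\<^sup>+z. ennreal (loss b v D z) \<partial>P) \<in> borel_measurable ?N1" if "v \<in> S" for b v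
    using borel_measurable_nn_integral[of "\<lambda>D z. ennreal (loss b v D z)" ?N1] loss_m[OF that]
    by (simp add: case_prod_unfold)
  have U_sp: "U \<omega> \<in> space ?N1" if "\<omega> \<in> space M" for \<omega>
    using ind that unfolding indep_rvs_def by (auto dest: measurable_space)
  \<comment> \<open>The seeds outside the index set are never consulted. Replacing them by a fixed nonempty set
    makes the estimator measurable for the given values of the seeds.\<close>
  have ens: "(\<integral>\<^sup>+x. ennreal (\<bar>?ens \<omega> x - m x\<bar>\<^sup>2) \<partial>distr P borel fst)
       \<le> f (V \<omega>) (U \<omega>)" if \<omega>: "\<omega> \<in> space M" "V \<omega> \<in> S" for \<omega>
  proof -
    have boost: "boost_est spl ls t k n (U \<omega>) (\<lambda>j \<tau>. seed (b, j, \<tau>) \<omega>)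
        = boost_est spl ls t k n (U \<omega>) (ext b (V \<omega>))"
      if "b \<in> {1..B}" for b
    proof -
      have "boost_trees spl ls t n (U \<omega>) (\<lambda>j \<tau>. seed (b, j, \<tau>) \<omega>) k
          = boost_trees spl ls t n (U \<omega>) (ext b (V \<omega>)) k"
        using t that by (intro boost_trees_cong) (auto simp: ext_def V_def seed_index_def)
      then show ?thesis by (simp add: boost_est_def)
    qed
    have loss_m': "(\<lambda>z. loss b (V \<omega>) (U \<omega>) z) \<in> borel_measurable P" for b
      using measurable_compose[OF measurable_Pair1'[OF U_sp[OF \<omega>(1)]] loss_m[OF \<omega>(2), of b]] by simp
    have ens_eq: "?ens \<omega>
        = (\<lambda>x. 1 / real B * (\<Sum>b = 1..B. clip \<beta> (boost_est spl ls t k n (U \<omega>) (ext b (V \<omega>)) x)))"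
      unfolding ens_est_def[abs_def] clip_def using boost by (intro ext) simp
    have boost_m' [measurable]: "boost_est spl ls t k n (U \<omega>) (ext b (V \<omega>)) \<in> borel_measurable
        borel" for b
      using measurable_compose[OF measurable_Pair1'[OF U_sp[OF \<omega>(1)]] boost_m[OF \<omega>(2), of b]] by simp
    have "?ens \<omega> \<in> borel_measurable borel"
      unfolding ens_eq by measurable
    then have [measurable]: "(\<lambda>x. ennreal (\<bar>?ens \<omega> x - m x\<bar>\<^sup>2)) \<in> borel_measurable borel"
      by measurable
    have "(\<integral>\<^sup>+x. ennreal (\<bar>?ens \<omega> x - m x\<bar>\<^sup>2) \<partial>distr P borel fst)
      = (\<integral>\<^sup>+z. ennreal (\<bar>?ens \<omega> (fst z) - m (fst z)\<bar>\<^sup>2) \<partial>P)"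
      by (rule nn_integral_distr) measurable
    also have "(\<integral>\<^sup>+z. ennreal (\<bar>?ens \<omega> (fst z) - m (fst z)\<bar>\<^sup>2) \<partial>P)
        \<le> (\<integral>\<^sup>+z. (\<Sum>b = 1..B. ennreal (1 / real B) * ennreal (loss b (V \<omega>) (U \<omega>) z)) \<partial>P)"
    proof (rule nn_integral_mono)
      fix z :: "(real ^ 'p) \<times> real"
      have "?ens \<omega> (fst z)
        = 1 / real B * (\<Sum>b = 1..B. clip \<beta> (boost_est spl ls t k n (U \<omega>) (ext b (V \<omega>)) (fst z)))"
        by (simp only: ens_eq)
      then have "\<bar>?ens \<omega> (fst z) - m (fst z)\<bar>\<^sup>2
          \<le> (\<Sum>b = 1..B. 1 / real B * loss b (V \<omega>) (U \<omega>) z)"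
        unfolding loss_def using square_mean_diff_le[OF B] by simp
      then have "ennreal (\<bar>?ens \<omega> (fst z) - m (fst z)\<bar>\<^sup>2)
          \<le> ennreal (\<Sum>b = 1..B. 1 / real B * loss b (V \<omega>) (U \<omega>) z)" by (rule ennreal_leI)
      also have "\<dots> = (\<Sum>b = 1..B. ennreal (1 / real B * loss b (V \<omega>) (U \<omega>) z))"
        by (rule sum_ennreal[symmetric]) (simp add: loss_def)
      also have "\<dots> = (\<Sum>b = 1..B. ennreal (1 / real B) * ennreal (loss b (V \<omega>) (U \<omega>) z))"
        by (intro sum.cong refl ennreal_mult) (auto simp: loss_def)
      finally show "ennreal (\<bar>?ens \<omega> (fst z) - m (fst z)\<bar>\<^sup>2)
          \<le> (\<Sum>b = 1..B. ennreal (1 / real B) * ennreal (loss b (V \<omega>) (U \<omega>) z))" .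
    qed
    also have "\<dots> = f (V \<omega>) (U \<omega>)"
      unfolding f_def using loss_m' by (simp add: nn_integral_sum nn_integral_cmult)
    finally show ?thesis .
  qed
  have "(\<integral>\<^sup>+\<omega>. (\<integral>\<^sup>+x. ennreal (\<bar>?ens \<omega> x - m x\<bar>\<^sup>2) \<partial>distr P borel fst) \<partial>M)
     \<le> (\<integral>\<^sup>+\<omega>. f (V \<omega>) (U \<omega>) \<partial>M)"
  proof (rule nn_integral_mono_AE)
    show "AE \<omega> in M. (\<integral>\<^sup>+x. ennreal (\<bar>?ens \<omega> x - m x\<bar>\<^sup>2) \<partial>distr P borel fst)
       \<le> f (V \<omega>) (U \<omega>)"
      using V_S AE_space by eventually_elim (rule ens)
  qed
  also have "\<dots> \<le> (\<integral>\<^sup>+\<omega>. h (V \<omega>) \<partial>M)"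
  proof (rule nn_integral_indep_finite_le[where f=f and h=h and V=V and U=U and ?N1.0="?N1"
      and ?N2.0="?N2",
        OF M _ finS V_S single])
    show "indep_rvs M ?N1 U ?N2 V" proof -
      have "V = (\<lambda>\<omega>. \<lambda>\<iota>\<in>?I. seed \<iota> \<omega>)" by (simp add: V_def fun_eq_iff)
      then show ?thesis using ind by simp
    qed
    show "f v \<in> borel_measurable ?N1" if "v \<in> S" for v
      unfolding f_def using risk_m[OF that] by (intro borel_measurable_sum
          borel_measurable_times_ennreal) auto
    show "(\<integral>\<^sup>+D. f v D \<partial>distr M ?N1 U) \<le> h v" if v: "v \<in> S" for v
    proof -
      have rm: "(\<lambda>D. \<integral>\<^sup>+z. ennreal (loss b v D z) \<partial>P) \<in> borel_measurable ?Q" for b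
        using risk_m[OF v, of b] by (simp only: measurable_cong_sets[OF sets_Q refl])
      have "(\<integral>\<^sup>+D. f v D \<partial>distr M ?N1 U)
        = (\<Sum>b = 1..B. ennreal (1 / real B) * (\<integral>\<^sup>+D. (\<integral>\<^sup>+z. ennreal (loss b v D z) \<partial>P) \<partial>?Q))"
        unfolding law f_def using rm by (simp add: nn_integral_sum nn_integral_cmult)
      also have "\<dots> \<le> h v"
        unfolding h_def
      proof (intro sum_mono mult_left_mono)
        fix b
        let ?pen = "if few b v then \<integral>z. (snd z)\<^sup>2 \<partial>P else 0"
        have "(\<integral>\<^sup>+D. (\<integral>\<^sup>+z. ennreal (loss b v D z) \<partial>P) \<partial>?Q) \<le>
            ennreal ((1 + \<epsilon>) * ((1 + \<epsilon>) * ((1 + \<epsilon>) * (fit + ?pen) + (1 + 1 / \<epsilon>) * clip_error L) + gap)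
         + (1 + 1 / \<epsilon>) * clip_error L - noise)"
          unfolding loss_def few_def fit_def gap_def
          by (rule fixed_seed_risk_bound[OF spl ls meas nonempty[OF v] t n L \<epsilon> r \<theta> K])
        also have "(1 + \<epsilon>) * ((1 + \<epsilon>) * ((1 + \<epsilon>) * (fit + ?pen) + (1 + 1 / \<epsilon>) * clip_error L) + gap)
         + (1 + 1 / \<epsilon>) * clip_error L - noise = ?C1 + (1 + \<epsilon>) ^ 3 * ?pen"
          by (simp add: power3_eq_cube algebra_simps)
        also have "(1 + \<epsilon>) ^ 3 * ?pen = (if few b v then ?C2 else 0)" by simp
        finally show "(\<integral>\<^sup>+D. (\<integral>\<^sup>+z. ennreal (loss b v D z) \<partial>P) \<partial>?Q)
          \<le> ennreal (?C1 + (if few b v then ?C2 else 0))" .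
      qed simp
      finally show ?thesis .
    qed
  qed
  also have "\<dots> \<le> (\<integral>\<^sup>+\<omega>. (\<Sum>b = 1..B. ennreal (1 / real B) * (ennreal ?C1 + ennreal (tail b \<omega>))) \<partial>M)"
  proof (rule nn_integral_mono, unfold h_def, intro sum_mono mult_left_mono)
    fix \<omega> b assume b: "b \<in> {1..B}"
    have "{\<iota> \<in> J b. seed \<iota> \<omega> = UNIV} = (\<lambda>j. (b, j, 1)) ` {j \<in> {1..k}. ext b (V \<omega>) j 1 = UNIV}"
      using J(1)[OF b] by (auto simp: J_def ext_def V_def subset_iff)
    then have eq: "card {j \<in> {1..k}. ext b (V \<omega>) j 1 = UNIV} = ?cnt b \<omega>"
      by (simp add: card_image inj_on_def)
    have "(if few b (V \<omega>) then ?C2 else 0) \<le> tail b \<omega>"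
    proof (cases "few b (V \<omega>)")
      case True
      then have "(2::real) ^ ?cnt b \<omega> \<le> 2 ^ K" unfolding few_def eq by (intro power_increasing) auto
      then have "1 \<le> (2::real) ^ K * (1 / 2) ^ ?cnt b \<omega>" by (simp add: power_one_over field_simps)
      from mult_left_mono[OF this C2] show ?thesis using True by (simp add: tail_def mult.assoc)
    next
      case False
      then show ?thesis using tail0 by simp
    qed
    then have "ennreal (?C1 + (if few b (V \<omega>) then ?C2 else 0)) \<le> ennreal (?C1 + tail b \<omega>)"
      by (intro ennreal_leI) simp
    also have "\<dots> \<le> ennreal ?C1 + ennreal (tail b \<omega>)"
      using tail0 by (rule ennreal_add_le)
    finally show "ennreal (?C1 + (if few b (V \<omega>) then ?C2 else 0)) \<le> ennreal ?C1 + ennreal (tail b \<omega>)" .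
  qed simp
  also have "\<dots> = (\<Sum>b = 1..B. ennreal (1 / real B) * (ennreal ?C1 + (\<integral>\<^sup>+\<omega>. ennreal (tail b \<omega>) \<partial>M)))"
  proof -
    have m: "(\<lambda>\<omega>. ennreal (tail b \<omega>)) \<in> borel_measurable M" if "b \<in> {1..B}" for b
      using borel_measurable_integrable[OF tail(1)[OF that]] by (rule measurable_compose) simp
    have lin: "(\<integral>\<^sup>+\<omega>. a * (c + F \<omega>) \<partial>M) = a * (c + (\<integral>\<^sup>+\<omega>. F \<omega> \<partial>M))"
      if "F \<in> borel_measurable M" for a c :: ennreal and F
      using that by (simp add: nn_integral_cmult nn_integral_add M.emeasure_space_1)
    have "(\<integral>\<^sup>+\<omega>. (\<Sum>b = 1..B. ennreal (1 / real B) * (ennreal ?C1 + ennreal (tail b \<omega>))) \<partial>M)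
        = (\<Sum>b = 1..B. \<integral>\<^sup>+\<omega>. ennreal (1 / real B) * (ennreal ?C1 + ennreal (tail b \<omega>)) \<partial>M)"
      using m by (intro nn_integral_sum borel_measurable_times_ennreal borel_measurable_add) auto
    also have "\<dots> = (\<Sum>b = 1..B. ennreal (1 / real B) * (ennreal ?C1 + (\<integral>\<^sup>+\<omega>. ennreal (tail b \<omega>) \<partial>M)))"
      by (intro sum.cong refl lin m)
    finally show ?thesis .
  qed
  also have "\<dots> = (\<Sum>b = 1..B. ennreal (1 / real B) * (ennreal ?C1 + ennreal (?C2 * 2 ^ K * ?\<gamma> ^ k)))"
  proof (intro sum.cong refl arg_cong2[where f="(*)"] arg_cong2[where f="(+)"])
    fix b assume b: "b \<in> {1..B}"
    have "(\<integral>\<^sup>+\<omega>. ennreal (tail b \<omega>) \<partial>M) = ennreal (\<integral>\<omega>. tail b \<omega> \<partial>M)"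
      using tail(1)[OF b] by (intro nn_integral_eq_integral AE_I2 tail0)
    then show "(\<integral>\<^sup>+\<omega>. ennreal (tail b \<omega>) \<partial>M) = ennreal (?C2 * 2 ^ K * ?\<gamma> ^ k)"
      by (simp only: tail(2)[OF b])
  qed
  also have "\<dots> = (\<Sum>b = 1..B. ennreal (1 / real B)) * (ennreal ?C1 + ennreal (?C2 * 2 ^ K * ?\<gamma> ^ k))"
    by (rule sum_distrib_right[symmetric])
  also have "(\<Sum>b = 1..B. ennreal (1 / real B)) = ennreal (\<Sum>b = 1..B. 1 / real B)"
    by (rule sum_ennreal) simp
  also have "(\<Sum>b = 1..B. 1 / real B) = 1" using B by simp
  finally show ?thesis by simp
qed

section \<open>Consistency\<close>

lemma square_le_exp: "0 < c \<Longrightarrow> y\<^sup>2 \<le> exp (c * y\<^sup>2) / c" for c y :: real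
proof -
  assume "0 < c"
  have "c * y\<^sup>2 \<le> exp (c * y\<^sup>2)" using exp_ge_add_one_self[of "c * y\<^sup>2"] by linarith
  with \<open>0 < c\<close> show ?thesis by (simp add: pos_le_divide_eq mult.commute)
qed

text \<open>
  The defining property of conditional expectations, extended from indicators to square-integrable
  functions of the covariate.
\<close>

lemma regression_law_distr:
  fixes X :: "'w \<Rightarrow> real ^ 'p::finite" and Y :: "'w \<Rightarrow> real"
  assumes M: "prob_space M"
    and X [measurable]: "X \<in> borel_measurable M" and Y [measurable]: "Y \<in> borel_measurable M"
    and cube: "AE \<omega> in M. X \<omega> \<in> unit_cube"
    and m: "regression_function M X Y m"
    and c: "0 < c" "integrable M (\<lambda>\<omega>. exp (c * (Y \<omega>)\<^sup>2))"
    and m2: "integrable M (\<lambda>\<omega>. (m (X \<omega>))\<^sup>2)"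
  shows "regression_law (distr M borel (\<lambda>\<omega>. (X \<omega>, Y \<omega>))) m"
proof -
  interpret M: prob_space M by fact
  let ?Z = "\<lambda>\<omega>. (X \<omega>, Y \<omega>)"
  let ?P = "distr M borel ?Z"
  have Z [measurable]: "?Z \<in> borel_measurable M" by measurable
  have m_b [measurable]: "m \<in> borel_measurable borel" using m by (simp add: regression_function_def)
  have fs [measurable]: "fst \<in> borel_measurable (borel :: ((real ^ 'p) \<times> real) measure)"
    "snd \<in> borel_measurable (borel :: ((real ^ 'p) \<times> real) measure)"
    by (simp_all add: borel_prod[symmetric])
  have Y2: "integrable M (\<lambda>\<omega>. (Y \<omega>)\<^sup>2)"
  proof (rule Bochner_Integration.integrable_bound)
    show "integrable M (\<lambda>\<omega>. exp (c * (Y \<omega>)\<^sup>2) / c)" using c(2) by simp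
    show "AE \<omega> in M. norm ((Y \<omega>)\<^sup>2) \<le> norm (exp (c * (Y \<omega>)\<^sup>2) / c)"
      using square_le_exp[OF c(1)] c(1) by (intro AE_I2) simp
  qed simp
  show ?thesis
  proof (intro regression_law.intro M.prob_space_distr Z regression_law_axioms.intro)
    show "sets ?P = sets borel" by simp
    have "{z \<in> space borel. fst z \<in> unit_cube} \<in> sets (borel :: ((real ^ 'p) \<times> real) measure)"
    proof -
      have "(unit_cube :: (real ^ 'p) set) \<in> sets borel"
        using compact_unit_cube by (intro borel_closed compact_imp_closed)
      then show ?thesis by measurable
    qed
    then show "AE z in ?P. fst z \<in> unit_cube" using cube by (subst AE_distr_iff[OF Z]) auto
    show "integrable ?P (\<lambda>z. (snd z)\<^sup>2)" using Y2 by (subst integrable_distr_eq[OF Z]) auto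
    show "integrable ?P (\<lambda>z. (m (fst z))\<^sup>2)" using m2 by (subst integrable_distr_eq[OF Z]) auto
    show "m \<in> borel_measurable borel" by (rule m_b)
    fix \<phi> :: "real ^ 'p \<Rightarrow> real"
    assume \<phi> [measurable]: "\<phi> \<in> borel_measurable borel" and "integrable ?P (\<lambda>z. (\<phi> (fst z))\<^sup>2)"
    then have \<phi>2: "integrable M (\<lambda>\<omega>. (\<phi> (X \<omega>))\<^sup>2)" by (subst (asm) integrable_distr_eq[OF Z]) auto
    let ?F = "vimage_algebra (space M) X borel"
    have sub: "subalgebra M ?F"
      using measurable_sets[OF X] unfolding subalgebra_def by (auto simp: sets_vimage_algebra2)
    interpret F: finite_measure_subalgebra M ?F by unfold_locales (rule sub)
    have \<phi>F: "(\<lambda>\<omega>. \<phi> (X \<omega>)) \<in> borel_measurable ?F"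
      by (rule measurable_compose[OF measurable_vimage_algebra1 \<phi>]) auto
    have int: "integrable M (\<lambda>\<omega>. \<phi> (X \<omega>) * Y \<omega>)" using \<phi>2 Y2 by (intro integrable_mult_sq) auto
    have "(\<integral>z. \<phi> (fst z) * snd z \<partial>?P) = (\<integral>\<omega>. \<phi> (X \<omega>) * Y \<omega> \<partial>M)"
      by (subst integral_distr[OF Z]) auto
    also have "\<dots> = (\<integral>\<omega>. \<phi> (X \<omega>) * real_cond_exp M ?F Y \<omega> \<partial>M)"
      by (rule F.real_cond_exp_intg(2)[OF int \<phi>F Y, symmetric])
    also have "\<dots> = (\<integral>\<omega>. \<phi> (X \<omega>) * m (X \<omega>) \<partial>M)"
    proof (rule integral_cong_AE)
      show "AE \<omega> in M. \<phi> (X \<omega>) * real_cond_exp M ?F Y \<omega> = \<phi> (X \<omega>) * m (X \<omega>)"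
        using m unfolding regression_function_def by auto
    qed measurable
    also have "\<dots> = (\<integral>z. \<phi> (fst z) * m (fst z) \<partial>?P)"
      by (subst integral_distr[OF Z]) auto
    finally show "(\<integral>z. \<phi> (fst z) * snd z \<partial>?P) = (\<integral>z. \<phi> (fst z) * m (fst z) \<partial>?P)" .
  qed
qed

lemma (in regression_law) ex_step_fun_close:
  assumes "0 < \<delta>"
  shows "\<exists>N c \<theta> s. (\<forall>q<N::nat. norm (\<theta> q) = 1) \<and>
    (\<integral>z. (snd z - step_fun {..<N} c \<theta> s (fst z))\<^sup>2 \<partial>P) \<le> \<delta> + noise"
proof -
  let ?\<mu> = "distr P borel fst"
  interpret \<mu>: cube_distribution ?\<mu>
  proof (intro cube_distribution.intro cube_distribution_axioms.intro prob_space_distr)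
    have "(unit_cube :: (real ^ 'p) set) \<in> sets borel"
      using compact_unit_cube by (intro borel_closed compact_imp_closed)
    then show "AE x in ?\<mu>. x \<in> unit_cube" using in_cube by (subst AE_distr_iff) auto
  qed simp_all
  have "integrable ?\<mu> (\<lambda>x. (m x)\<^sup>2)" using m_sq by (subst integrable_distr_eq) auto
  then have "\<mu>.approximable m" by (intro \<mu>.approximable_square_integrable m_measurable)
  then obtain h where h: "h \<in> step_combs" "(\<integral>\<^sup>+x. ennreal ((m x - h x)\<^sup>2) \<partial>?\<mu>) \<le> ennreal \<delta>"
    unfolding \<mu>.approximable_def using assms by blast
  obtain N c \<theta> s where hs: "h = step_fun {..<N::nat} c \<theta> s" "\<And>q. q < N \<Longrightarrow> norm (\<theta> q) = 1"
    using step_combs_step_fun[OF h(1)] by blast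
  have [measurable]: "h \<in> borel_measurable borel" by (rule step_combs_measurable[OF h(1)])
  have h2: "integrable P (\<lambda>z. (h (fst z))\<^sup>2)" unfolding hs(1) by (rule step_fun_square_integrable)
  have d: "integrable P (\<lambda>z. (h (fst z) - m (fst z))\<^sup>2)"
    using h2 m_sq by (intro integrable_sq_diff) auto
  have "ennreal (\<integral>z. (h (fst z) - m (fst z))\<^sup>2 \<partial>P) = (\<integral>\<^sup>+z. ennreal ((h (fst z) - m (fst z))\<^sup>2) \<partial>P)"
    using d by (intro nn_integral_eq_integral[symmetric]) auto
  also have "\<dots> = (\<integral>\<^sup>+x. ennreal ((m x - h x)\<^sup>2) \<partial>?\<mu>)"
    by (subst nn_integral_distr) (auto simp: power2_commute)
  also have "\<dots> \<le> ennreal \<delta>" by (rule h(2))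
  finally have le: "(\<integral>z. (h (fst z) - m (fst z))\<^sup>2 \<partial>P) \<le> \<delta>" using assms by simp
  have "(\<integral>z. (snd z - h (fst z))\<^sup>2 \<partial>P) = (\<integral>z. (h (fst z) - snd z)\<^sup>2 \<partial>P)"
    by (simp add: power2_commute)
  also have "\<dots> = (\<integral>z. (h (fst z) - m (fst z))\<^sup>2 \<partial>P) + noise"
    by (rule risk_decomposition) (use h2 in auto)
  finally show ?thesis using le hs by (intro exI[of _ N] exI[of _ c] exI[of _ \<theta>] exI[of _ s]) auto
qed

text \<open>
  Since \<open>\<beta> n\<close> is of order \<open>ln n\<close>, the expression is of order \<open>k n * ln n ^ 3 / n\<close>.
\<close>

lemma gap_tendsto_0:
  fixes k :: "nat \<Rightarrow> nat" and \<beta> :: "nat \<Rightarrow> real" and E r L :: real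
  assumes \<beta>: "same_order \<beta> (\<lambda>n. ln (real n))"
    and k: "(\<lambda>n. real (k n)) \<in> o(\<lambda>n. real n / ln (real n) ^ 4)"
    and pos: "0 < r" "0 \<le> E" "0 \<le> L"
  shows "(\<lambda>n. (\<beta> n + L)\<^sup>2 * (E * real (k n) * ln (4 * real n + 3)) / (r * real n)) \<longlonglongrightarrow> 0"
proof -
  obtain c C where C: "0 < c" "0 < C" "\<forall>\<^sub>F n in sequentially. c \<le> \<beta> n / ln (real n)
      \<and> \<beta> n / ln (real n) \<le> C"
    using \<beta> unfolding same_order_def by blast
  have ln_inf: "filterlim (\<lambda>n. ln (real n)) at_top sequentially"
    by (rule filterlim_compose[OF ln_at_top filterlim_real_sequentially])
  have "(\<lambda>n. real (k n) / (real n / ln (real n) ^ 4)) \<longlonglongrightarrow> 0"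
    by (rule smalloD_tendsto[OF k])
  then have "(\<lambda>n. 3 * (C + 1)\<^sup>2 * E / r * (real (k n) / (real n / ln (real n) ^ 4))) \<longlonglongrightarrow> 3 * (C
      + 1)\<^sup>2 * E / r * 0"
    by (intro tendsto_intros)
  then have lim: "(\<lambda>n. 3 * (C + 1)\<^sup>2 * E / r * (real (k n) / (real n / ln (real n) ^ 4))) \<longlonglongrightarrow> 0" by simp
  have ev: "\<forall>\<^sub>F n in sequentially.
      norm ((\<beta> n + L)\<^sup>2 * (E * real (k n) * ln (4 * real n + 3)) / (r * real n))
        \<le> 3 * (C + 1)\<^sup>2 * E / r * (real (k n) / (real n / ln (real n) ^ 4))"
    using C(3) eventually_ge_at_top[of 3] filterlim_at_top[THEN iffD1, OF ln_inf, rule_format,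
        of "max 1 L"]
  proof eventually_elim
    case (elim n)
    let ?l = "ln (real n)"
    have l: "1 \<le> ?l" "L \<le> ?l" using elim by auto
    have "c * ?l \<le> \<beta> n" "\<beta> n \<le> C * ?l" using elim l by (auto simp: field_simps)
    moreover have "0 \<le> c * ?l" using C(1) l by simp
    ultimately have "(\<beta> n + L)\<^sup>2 \<le> ((C + 1) * ?l)\<^sup>2"
      using l pos by (intro power_mono) (auto simp: distrib_right)
    moreover have "ln (4 * real n + 3) \<le> 3 * ?l"
    proof -
      have "9 * real n \<le> (real n)\<^sup>2 * real n" using elim(2) power_mono[of 3 "real n" 2]
          by (intro mult_right_mono) auto
      moreover have "4 * real n + 3 \<le> 9 * real n" using elim(2) by simp
      moreover have "(real n)\<^sup>2 * real n = real n ^ 3" by (simp add: power3_eq_cube power2_eq_square)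
      ultimately have "4 * real n + 3 \<le> real n ^ 3" by linarith
      then have "ln (4 * real n + 3) \<le> ln (real n ^ 3)" by (intro ln_mono) auto
      then show ?thesis using elim(2) by (simp add: ln_realpow)
    qed
    moreover have "0 \<le> ln (4 * real n + 3)" by simp
    ultimately have "(\<beta> n + L)\<^sup>2 * (E * real (k n) * ln (4 * real n + 3)) / (r * real n)
       \<le> ((C + 1) * ?l)\<^sup>2 * (E * real (k n) * (3 * ?l)) / (r * real n)"
      using pos by (intro divide_right_mono mult_mono) auto
    also have "\<dots> = 3 * (C + 1)\<^sup>2 * E / r * (real (k n) / real n) * ?l ^ 3"
      by (simp add: power2_eq_square power3_eq_cube)
    also have "\<dots> \<le> 3 * (C + 1)\<^sup>2 * E / r * (real (k n) / real n) * ?l ^ 4"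
      using l pos by (intro mult_left_mono power_increasing) auto
    also have "\<dots> = 3 * (C + 1)\<^sup>2 * E / r * (real (k n) / (real n / ?l ^ 4))" by simp
    finally have "(\<beta> n + L)\<^sup>2 * (E * real (k n) * ln (4 * real n + 3)) / (r * real n)
       \<le> 3 * (C + 1)\<^sup>2 * E / r * (real (k n) / (real n / ?l ^ 4))" .
    moreover have "0 \<le> (\<beta> n + L)\<^sup>2 * (E * real (k n) * ln (4 * real n + 3)) / (r * real n)"
      using pos by simp
    ultimately show ?case by simp
  qed
  show ?thesis by (rule Lim_null_comparison[OF ev lim])
qed

lemma truncation_eventually_ge:
  assumes "same_order \<beta> (\<lambda>n. ln (real n))"
  shows "\<forall>\<^sub>F n in sequentially. L \<le> \<beta> n"
proof -
  obtain c C where C: "0 < c" "0 < C" "\<forall>\<^sub>F n in sequentially. c \<le> \<beta> n / ln (real n)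
      \<and> \<beta> n / ln (real n) \<le> C"
    using assms unfolding same_order_def by blast
  have ln_inf: "filterlim (\<lambda>n. ln (real n)) at_top sequentially"
    by (rule filterlim_compose[OF ln_at_top filterlim_real_sequentially])
  show ?thesis
    using C(3) filterlim_at_top[THEN iffD1, OF ln_inf, rule_format, of "max 1 (L / c)"]
  proof eventually_elim
    case (elim n)
    then have "L \<le> c * ln (real n)" "c * ln (real n) \<le> \<beta> n" using C(1) by (auto simp: field_simps)
    then show ?case by linarith
  qed
qed

theorem theorem5p1:
  fixes M :: "'w measure"
    and X :: "'w \<Rightarrow> real ^ 'p::finite" and Y :: "'w \<Rightarrow> real"
    and Xs :: "nat \<Rightarrow> 'w \<Rightarrow> real ^ 'p" and Ys :: "nat \<Rightarrow> 'w \<Rightarrow> real"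
    and seed :: "nat \<Rightarrow> nat \<times> nat \<times> nat \<Rightarrow> 'w \<Rightarrow> 'p set"
    and m :: "real ^ 'p \<Rightarrow> real"
    and spl :: "'p split_rule" and ls :: "'p ls_rule"
    and t B :: nat and k :: "nat \<Rightarrow> nat" and \<beta> :: "nat \<Rightarrow> real" and c :: real
  assumes "prob_space M"
    and "X \<in> borel_measurable M" and "Y \<in> borel_measurable M"
    and "AE \<omega> in M. X \<omega> \<in> unit_cube"
    and "regression_function M X Y m"
    \<comment> \<open>the data are i.i.d. copies of \<open>(X, Y)\<close>\<close>
    and "prob_space.indep_vars M (\<lambda>_. borel) (\<lambda>i \<omega>. (Xs i \<omega>, Ys i \<omega>)) UNIV"
    and "\<And>i. distr M borel (\<lambda>\<omega>. (Xs i \<omega>, Ys i \<omega>)) = distr M borel (\<lambda>\<omega>. (X \<omega>, Y \<omega>))"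
    \<comment> \<open>the seeds used for sample size \<open>n\<close> are i.i.d. and independent of the data\<close>
    and "\<And>n. prob_space.indep_vars M (\<lambda>_. count_space UNIV) (seed n) (seed_index B (k n) t)"
    and "\<And>n \<iota> S. \<iota> \<in> seed_index B (k n) t \<Longrightarrow> S \<noteq> {} \<Longrightarrow>
           measure M {\<omega> \<in> space M. seed n \<iota> \<omega> = S} = seed_prob S"
    and "\<And>n. indep_rvs M
           (\<Pi>\<^sub>M i\<in>{..<n}. borel) (\<lambda>\<omega>. \<lambda>i\<in>{..<n}. (Xs i \<omega>, Ys i \<omega>))
           (\<Pi>\<^sub>M \<iota>\<in>seed_index B (k n) t. count_space UNIV)
           (\<lambda>\<omega>. \<lambda>\<iota>\<in>seed_index B (k n) t. seed n \<iota> \<omega>)"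
    \<comment> \<open>the choices of maximizers and minimizers in the algorithm\<close>
    and "maximizing_split_rule spl" and "least_squares_rule ls"
    and "\<And>n. measurable_boost spl ls t (k n) n"
    and "2 \<le> t" and "1 \<le> B"
    and "0 < c" and "integrable M (\<lambda>\<omega>. exp (c * (Y \<omega>)\<^sup>2))"
    and "integrable M (\<lambda>\<omega>. (m (X \<omega>))\<^sup>2)"
    and "same_order \<beta> (\<lambda>n. ln (real n))"
    and "filterlim k at_top sequentially"
    and "(\<lambda>n. real (k n)) \<in> o(\<lambda>n. real n / ln (real n) ^ 4)"
  shows "(\<lambda>n. \<integral>\<^sup>+ \<omega>. (\<integral>\<^sup>+ x.
             ennreal (\<bar>ens_est spl ls t B (k n) (\<beta> n) n
                         (\<lambda>i\<in>{..<n}. (Xs i \<omega>, Ys i \<omega>)) (\<lambda>\<iota>. seed n \<iota> \<omega>) x - m x\<bar>\<^sup>2)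
           \<partial>distr M borel X) \<partial>M) \<longlonglongrightarrow> 0"
proof -
  note M = assms(1) and iid = assms(6,7) and spl = assms(11) and ls = assms(12)
    and t = assms(14) and B = assms(15) and \<beta> = assms(19) and k_inf = assms(20) and k_o = assms(21)
  interpret M: prob_space M by (rule M)
  define P where "P = distr M borel (\<lambda>\<omega>. (X \<omega>, Y \<omega>))"
  interpret regression_law P m
    unfolding P_def by (rule regression_law_distr[OF assms(1-5,16-18)])
  have marginal: "distr M borel X = distr P borel fst"
    unfolding P_def using assms(2,3) by (subst distr_distr) (auto simp: comp_def borel_prod[symmetric])
  define U where "U n \<omega> = (\<lambda>i\<in>{..<n}. (Xs i \<omega>, Ys i \<omega>))" for n \<omega>
  let ?risk = "\<lambda>n. \<integral>\<^sup>+ \<omega>. (\<integral>\<^sup>+ x.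
             ennreal (\<bar>ens_est spl ls t B (k n) (\<beta> n) n (U n \<omega>) (\<lambda>\<iota>. seed n \<iota> \<omega>) x - m x\<bar>\<^sup>2)
           \<partial>distr M borel X) \<partial>M"
  have law: "distr M (\<Pi>\<^sub>M i\<in>{..<n}. borel) (U n) = (\<Pi>\<^sub>M i\<in>{..<n}. P)" if "0 < n" for n
  proof -
    have ind: "M.indep_vars (\<lambda>_. borel) (\<lambda>i \<omega>. (Xs i \<omega>, Ys i \<omega>)) {..<n}"
      using iid(1) by (rule M.indep_vars_subset) simp
    then have rv: "(\<lambda>\<omega>. (Xs i \<omega>, Ys i \<omega>)) \<in> borel_measurable M" if "i \<in> {..<n}" for i
      using that by (auto simp: M.indep_vars_def)
    have "{..<n} \<noteq> {}" using that by auto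
    from M.indep_vars_iff_distr_eq_PiM'[OF this rv] ind
    show ?thesis unfolding U_def[abs_def] P_def by (simp add: iid(2))
  qed
  let ?E = "real (((CARD('p) + 2) * (t - 1) + 2) * t)"
  let ?y2 = "\<integral>z. (snd z)\<^sup>2 \<partial>P"
  let ?\<gamma> = "1 - 1 / (2 * real CARD('p))"
  have noise0: "0 \<le> noise" unfolding noise_def by (intro Bochner_Integration.integral_nonneg) simp
  have ev: "\<forall>\<^sub>F n in sequentially. ?risk n \<le> ennreal e" if e: "0 < e" for e
  proof -
    \<comment> \<open>Six errors of at most \<open>e / 6\<close> each: the inflation of the noise by \<open>(1 + \<epsilon>) ^ 3 - 1 \<le> 7 * \<epsilon>\<close>,
      the distance of \<open>h\<close> from \<open>m\<close>, the greedy excess, the truncation of the response, the gap between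
      expected and empirical loss, and the event that fewer than \<open>K\<close> first splits see all features.
      The first four are fixed by the choice of \<open>\<epsilon>\<close>, \<open>h\<close>, \<open>K\<close> and \<open>L\<close>, in this order; the last two
      vanish as \<open>n\<close> grows.\<close>
    define \<epsilon> where "\<epsilon> = min 1 (e / (42 * (noise + 1)))"
    have \<epsilon>: "0 < \<epsilon>" "\<epsilon> \<le> 1" using e noise0 by (auto simp: \<epsilon>_def)
    have \<epsilon>_noise: "7 * \<epsilon> * noise \<le> e / 6"
    proof -
      have "\<epsilon> \<le> e / (42 * (noise + 1))" by (simp add: \<epsilon>_def)
      then have "\<epsilon> * (42 * (noise + 1)) \<le> e" using noise0 by (simp add: pos_le_divide_eq)
      then have "42 * (\<epsilon> * noise) + 42 * \<epsilon> \<le> e" by (simp add: algebra_simps)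
      then show ?thesis using \<epsilon>(1) by simp
    qed
    obtain r where r: "0 < r" "exp r + exp (- (1 + \<epsilon>) * r) \<le> 2" using ex_step_size[OF \<epsilon>(1)] by blast
    have "0 < e / 48" using e by simp
    from ex_step_fun_close[OF this] obtain N c \<theta> s where h: "\<And>q. q < N \<Longrightarrow> norm (\<theta> q) = 1"
      "(\<integral>z. (snd z - step_fun {..<N::nat} c \<theta> s (fst z))\<^sup>2 \<partial>P) \<le> e / 48 + noise"
      by blast
    let ?A = "\<integral>z. (snd z - step_fun {..<N} c \<theta> s (fst z))\<^sup>2 \<partial>P"
    let ?V = "\<Sum>q<N. \<bar>c q\<bar>"
    obtain K0 :: nat where K0: "192 * ?V\<^sup>2 / e < K0" using reals_Archimedean2 by blast
    define K where "K = Suc K0"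
    have K: "1 \<le> K" "8 * (4 * ?V\<^sup>2 / K) \<le> e / 6"
    proof -
      have "192 * ?V\<^sup>2 / e \<le> K" using K0 by (simp add: K_def)
      then have "192 * ?V\<^sup>2 \<le> K * e" using e by (simp add: pos_divide_le_eq)
      then show "8 * (4 * ?V\<^sup>2 / K) \<le> e / 6" by (simp add: K_def field_simps)
    qed (simp add: K_def)
    have "\<forall>\<^sub>F i in sequentially. clip_error (real i) < e / (30 * (1 + 1 / \<epsilon>))"
      using e \<epsilon> by (intro order_tendstoD(2)[OF clip_error_tendsto_0]) (auto intro!: divide_pos_pos
          mult_pos_pos add_pos_pos)
    then obtain i where i: "clip_error (real i) < e / (30 * (1 + 1 / \<epsilon>))"
      using eventually_happens'[OF sequentially_bot] by blast
    define L where "L = real i"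
    define \<tau> where "\<tau> = (1 + 1 / \<epsilon>) * clip_error L"
    have \<tau>: "0 \<le> \<tau>" "5 * \<tau> \<le> e / 6"
    proof -
      have pos: "0 < 1 + 1 / \<epsilon>" using \<epsilon> by (simp add: add_pos_pos)
      have "0 \<le> clip_error L" unfolding clip_error_def
          by (intro Bochner_Integration.integral_nonneg) simp
      then show "0 \<le> \<tau>" using pos by (simp add: \<tau>_def)
      have "clip_error L * (30 * (1 + 1 / \<epsilon>)) \<le> e" using i pos
          by (simp add: L_def pos_less_divide_eq less_imp_le)
      then show "5 * \<tau> \<le> e / 6" by (simp add: \<tau>_def algebra_simps)
    qed
    define gap where "gap n = (\<beta> n + L)\<^sup>2 * (real (((CARD('p) + 2) * (t - 1)
        + 2) * t * k n) * ln (4 * real n + 3)) / (r * real n)" for n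
    have "gap \<longlonglongrightarrow> 0"
      using gap_tendsto_0[OF \<beta> k_o r(1), of ?E L] by (simp add: gap_def[abs_def] L_def)
    then have ev_gap: "\<forall>\<^sub>F n in sequentially. gap n < e / 12"
      using e by (intro order_tendstoD(2)) auto
    define pen where "pen n = (1 + \<epsilon>) ^ 3 * ?y2 * 2 ^ K * ?\<gamma> ^ k n" for n
    have "pen \<longlonglongrightarrow> 0"
    proof -
      have "(1::real) \<le> 2 * real CARD('p)"
        using zero_less_card_finite[where 'a='p] by linarith
      then have "0 < 1 / (2 * real CARD('p))" "1 / (2 * real CARD('p)) \<le> 1"
        by (simp_all add: divide_le_eq)
      then have "norm ?\<gamma> < 1" unfolding real_norm_def by linarith
      then have "(\<lambda>n. ?\<gamma> ^ n) \<longlonglongrightarrow> 0" by (rule LIMSEQ_power_zero)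
      then have "(\<lambda>n. ?\<gamma> ^ k n) \<longlonglongrightarrow> 0" by (rule filterlim_compose[OF _ k_inf])
      from tendsto_mult_right_zero[OF this] show ?thesis unfolding pen_def[abs_def] .
    qed
    then have ev_pen: "\<forall>\<^sub>F n in sequentially. pen n < e / 6"
      using e by (intro order_tendstoD(2)) auto
    show ?thesis
      using ev_gap ev_pen truncation_eventually_ge[OF \<beta>, of L] eventually_ge_at_top[of 2]
    proof eventually_elim
      case (elim n)
      let ?fit = "?A + 4 * ?V\<^sup>2 / real K"
      let ?C1 = "(1 + \<epsilon>) * ((1 + \<epsilon>) * ((1 + \<epsilon>) * ?fit + (1 + 1 / \<epsilon>) * clip_error L) + gap n)
         + (1 + 1 / \<epsilon>) * clip_error L - noise"
      have "(\<integral>\<^sup>+ \<omega>. (\<integral>\<^sup>+ x.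
             ennreal (\<bar>ens_est spl ls t B (k n) (\<beta> n) n (U n \<omega>) (\<lambda>\<iota>. seed n \<iota> \<omega>) x - m x\<bar>\<^sup>2)
           \<partial>distr P borel fst) \<partial>M) \<le> ennreal ?C1 + ennreal (pen n)"
        unfolding gap_def pen_def
      proof (rule ensemble_risk_bound[OF M _ assms(8) assms(9) _ spl ls assms(13) t B _ _ _ \<epsilon>(1) r _
          K(1)])
        show "distr M (\<Pi>\<^sub>M i\<in>{..<n}. borel) (U n) = (\<Pi>\<^sub>M i\<in>{..<n}. P)" using elim by (intro law) simp
        show "indep_rvs M (\<Pi>\<^sub>M i\<in>{..<n}. borel) (U n) (\<Pi>\<^sub>M \<iota>\<in>seed_index B (k n) t. count_space UNIV)
           (\<lambda>\<omega>. \<lambda>\<iota>\<in>seed_index B (k n) t. seed n \<iota> \<omega>)"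
          unfolding U_def[abs_def] by (rule assms(10))
      qed (use elim h(1) in \<open>auto simp: L_def\<close>)
      also have "\<dots> \<le> ennreal (5 * (e / 6)) + ennreal (e / 6)"
      proof (intro add_mono ennreal_leI)
        have cube: "(1 + \<epsilon>) ^ 3 \<le> 1 + 7 * \<epsilon>" "(1 + \<epsilon>) ^ 3 \<le> 8" "(1 + \<epsilon>)\<^sup>2 \<le> 4"
        proof -
          have "\<epsilon>\<^sup>2 \<le> \<epsilon>" "\<epsilon> ^ 3 \<le> \<epsilon>"
            using power_decreasing[of 1 2 \<epsilon>] power_decreasing[of 1 3 \<epsilon>] \<epsilon> by auto
          moreover have "(1 + \<epsilon>) ^ 3 = 1 + 3 * \<epsilon> + 3 * \<epsilon>\<^sup>2 + \<epsilon> ^ 3" "(1 + \<epsilon>)\<^sup>2 = 1 + 2 * \<epsilon> + \<epsilon>\<^sup>2"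
            by (simp_all add: power2_eq_square power3_eq_cube algebra_simps)
          ultimately show "(1 + \<epsilon>) ^ 3 \<le> 1 + 7 * \<epsilon>" "(1 + \<epsilon>) ^ 3 \<le> 8" "(1 + \<epsilon>)\<^sup>2 \<le> 4" using \<epsilon>
              by linarith+
        qed
        have V0: "0 \<le> 4 * ?V\<^sup>2 / K" by simp
        have gap0: "0 \<le> gap n"
          unfolding gap_def using r(1) by (intro divide_nonneg_nonneg mult_nonneg_nonneg) auto
        have "?C1 = (1 + \<epsilon>) ^ 3 * ?fit + (1 + \<epsilon>)\<^sup>2 * \<tau> + (1 + \<epsilon>) * gap n + \<tau> - noise"
          unfolding \<tau>_def[symmetric] by (simp add: power2_eq_square power3_eq_cube algebra_simps)
        also have "\<dots> \<le> (1 + \<epsilon>) ^ 3 * (e / 48 + noise + 4 * ?V\<^sup>2 / K) + 4 * \<tau> + 2 * gap n + \<tau> - noise"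
          using h(2) cube \<tau>(1) \<epsilon> gap0 by (intro diff_right_mono add_mono mult_left_mono
              mult_right_mono) auto
        also have "(1 + \<epsilon>) ^ 3 * (e / 48 + noise + 4 * ?V\<^sup>2 / K)
            = (1 + \<epsilon>) ^ 3 * (e / 48) + (1 + \<epsilon>) ^ 3 * noise + (1 + \<epsilon>) ^ 3 * (4 * ?V\<^sup>2 / K)"
          by (simp add: distrib_left)
        also have "\<dots> \<le> 8 * (e / 48) + (1 + 7 * \<epsilon>) * noise + 8 * (4 * ?V\<^sup>2 / K)"
          using cube e noise0 V0 by (intro add_mono mult_right_mono) auto
        finally have "?C1 \<le> 8 * (e / 48) + (1 + 7 * \<epsilon>) * noise + 8 * (4 * ?V\<^sup>2 / K) + 4 * \<tau>
            + 2 * gap n + \<tau> - noise"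
          by (simp only:)
        also have "\<dots> \<le> 5 * (e / 6)"
        proof -
          have "(1 + 7 * \<epsilon>) * noise = noise + 7 * \<epsilon> * noise" by (simp add: distrib_right)
          then show ?thesis using \<epsilon>_noise K(2) \<tau>(2) elim(1) by linarith
        qed
        finally show "?C1 \<le> 5 * (e / 6)" .
        show "pen n \<le> e / 6" using elim by simp
      qed
      also have "\<dots> = ennreal e" using e by (simp add: ennreal_plus[symmetric] del: ennreal_plus)
      finally show ?case unfolding marginal .
    qed
  qed
  have "?risk \<longlonglongrightarrow> 0"
  proof (rule order_tendstoI)
    fix a :: ennreal assume "0 < a"
    then obtain e where e: "0 < e" "ennreal e < a"
      by (metis dense ennreal_cases ennreal_less_zero_iff less_top_ennreal not_less_zero
          order.strict_trans1 top_greatest)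
    from ev[OF e(1)] show "\<forall>\<^sub>F n in sequentially. ?risk n < a"
      by eventually_elim (rule order.strict_trans1[OF _ e(2)])
  qed simp
  then show ?thesis unfolding U_def .
qed

end
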